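(* For every type-$B$ composition $\alpha$ of $n$, the lattice $\mathsf{Tam}_{B}(\alpha)$ is congruence uniform (hence semidistributive) and trim.
   Context: Let $n\geq 1$, $\pm[n]=\{-n,\dots,-1,1,\dots,n\}$, and let $\mathfrak{H}_n$ be the group of permutations $\pi$ of $\pm[n]$ with $\pi(-a)=-\pi(a)$ (product = composition), the Coxeter group of type $B_n$ with simple generators $s_0$ (exchanging $1,-1$) and $s_i$ (exchanging $i,i+1$ and $-i,-i-1$), $1\le i\le n-1$; $\ell_S$ is the Coxeter length. Inversions: $\mathsf{Inv}(\pi)=\{t \text{ reflection}:\ell_S(\pi t)<\ell_S(\pi)\}$; explicitly it consists of $[\![i]\!]$ with $\pi(i)<0$, $(\!(i\;j)\!)$ ($0<i<j$) with $\pi(i)>\pi(j)$, and $(\!(-j\;i)\!)$ ($0<i<j$) with $\pi(-j)>\pi(i)$. Weak order: $u\leq_{\mathsf{weak}}v$ iff $\mathsf{Inv}(u)\subseteq\mathsf{Inv}(v)$. A type-$B$ composition of $n$ is a sequence $(\alpha_1,\dots,\alpha_r)$ of positive integers summing to $n$, possibly preceded by a component $0$ (split if present, join otherwise); $p_0=0$, $p_i=\alpha_1+\dots+\alpha_i$. $\mathsf{Part}(\alpha)$ is the partition of $\pm[n]$ into blocks $\{p_{i-1}+1,\dots,p_i\}$ and $\{-p_i,\dots,-p_{i-1}-1\}$ ($1\le i\le r$), where for join $\alpha$ the two blocks with $i=1$ are merged into one. $\mathfrak{H}_\alpha$ is the set of minimal length representatives $\{w:\ell_S(ws)>\ell_S(w)\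 \forall s\in S\setminus J_\alpha\}$, where $J_\alpha=\{s_{p_1},\dots,s_{p_{r-1}}\}$ plus $s_0$ if $\alpha$ is split; equivalently, $\pi\in\mathfrak{H}_\alpha$ iff $\pi$ is increasing on each block of $\mathsf{Part}(\alpha)$. Let $x^+=x+1$ for $x\ne -1$ and $(-1)^+=1$. A type-$B$ $(\alpha,231)$-split pattern (for split $\alpha$) of $\pi\in\mathfrak{H}_\alpha$ is a triple $i<j<k$ of elements of $\pm[n]$ in pairwise distinct blocks, $j>0$, $\pi(i)=\pi(k)^+$, $\pi(i)<\pi(j)$. A type-$B$ $(\alpha,231)$-join pattern (for join $\alpha$) is such a triple with $j>0$, $\pi(i)=\pi(k)^+$ and either ($j>\alpha_1$, $\pi(j)>\pi(i)$) or ($0<j\le\alpha_1$, $\pi(j)<\pi(k)$). $\mathfrak{H}_\alpha(231)$ is the set of $\pi\in\mathfrak{H}_\alpha$ without such patterns, and $\mathsf{Tam}_B(\alpha)=(\mathfrak{H}_\alpha(231),\leq_{\mathsf{weak}})$, which is a lattice. Lattice notions: for a finite lattice $P$, $\mathsf{J}(P)$, $\mathsf{M}(P)$ are the join- and meet-irreducible elements; $j_*$ is the unique element covered by $j\in\mathsf{J}(P)$; $\mathsf{cg}(p,q)$ is the finest lattice congruence identifying $p$ and $q$; $P$ is congruence uniform if $j\mapsto\mathsf{cg}(j_*,j)$ is a bijection from $\mathsf{J}(P)$ to the join-irreducible elements of the congruence lattice, for $P$ and for its dual. $P$ is semidistributive if $p\vee q=p\vee r$ implies $p\vee q=p\vee(q\wedge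 r)$ and dually. The length $\ell(P)$ is the maximal number of elements minus one in a chain. $P$ is extremal if $|\mathsf{J}(P)|=\ell(P)=|\mathsf{M}(P)|$; $p$ is left modular if $(r\vee p)\wedge q=r\vee(p\wedge q)$ for all $r\le q$; $P$ is left modular if it has a maximal chain of $\ell(P)+1$ left-modular elements; $P$ is trim if it is extremal and left modular. *)

theory Defs
  imports
    "HOL-Algebra.Lattice"
    "HOL-Combinatorics.Permutations"
begin

section \<open>Finite lattices\<close>

definition finite_lattice :: "('a, 'b) gorder_scheme \<Rightarrow> bool" where
  "finite_lattice L \<longleftrightarrow> lattice L \<and> finite (carrier L)"

definition covered_by :: "('a, 'b) gorder_scheme \<Rightarrow> 'a \<Rightarrow> 'a \<Rightarrow> bool" where
  "covered_by L x y \<longleftrightarrow> x \<in> carrier L \<and> y \<in> carrier L \<and> x \<sqsubset>\<^bsub>L\<^esub> y \<and>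
     \<not> (\<exists>z\<in>carrier L. x \<sqsubset>\<^bsub>L\<^esub> z \<and> z \<sqsubset>\<^bsub>L\<^esub> y)"

text \<open>As usual, the least element is not join-irreducible.\<close>

definition join_irreducibles :: "('a, 'b) gorder_scheme \<Rightarrow> 'a set" where
  "join_irreducibles L = {j \<in> carrier L. \<not> least L j (carrier L) \<and>
     (\<forall>p\<in>carrier L. \<forall>q\<in>carrier L. j = p \<squnion>\<^bsub>L\<^esub> q \<longrightarrow> j = p \<or> j = q)}"

definition meet_irreducibles :: "('a, 'b) gorder_scheme \<Rightarrow> 'a set" where
  "meet_irreducibles L = {m \<in> carrier L. \<not> greatest L m (carrier L) \<and>
     (\<forall>p\<in>carrier L. \<forall>q\<in>carrier L. m = p \<sqinter>\<^bsub>L\<^esub> q \<longrightarrow> m = p \<or> m = q)}"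

definition lower_star :: "('a, 'b) gorder_scheme \<Rightarrow> 'a \<Rightarrow> 'a" where
  "lower_star L j = (THE x. covered_by L x j)"

definition lattice_congruence :: "('a, 'b) gorder_scheme \<Rightarrow> ('a \<times> 'a) set \<Rightarrow> bool" where
  "lattice_congruence L \<theta> \<longleftrightarrow> equiv (carrier L) \<theta> \<and>
     (\<forall>p q r s. (p, q) \<in> \<theta> \<longrightarrow> (r, s) \<in> \<theta> \<longrightarrow>
        (p \<squnion>\<^bsub>L\<^esub> r, q \<squnion>\<^bsub>L\<^esub> s) \<in> \<theta> \<and> (p \<sqinter>\<^bsub>L\<^esub> r, q \<sqinter>\<^bsub>L\<^esub> s) \<in> \<theta>)"

definition congruence_lattice :: "('a, 'b) gorder_scheme \<Rightarrow> ('a \<times> 'a) set gorder" where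
  "congruence_lattice L =
     \<lparr>carrier = {\<theta>. lattice_congruence L \<theta>}, eq = (=), le = (\<subseteq>)\<rparr>"

definition cg :: "('a, 'b) gorder_scheme \<Rightarrow> 'a \<Rightarrow> 'a \<Rightarrow> ('a \<times> 'a) set" where
  "cg L p q = \<Inter> {\<theta>. lattice_congruence L \<theta> \<and> (p, q) \<in> \<theta>}"

definition cg_bijective :: "('a, 'b) gorder_scheme \<Rightarrow> bool" where
  "cg_bijective L \<longleftrightarrow>
     bij_betw (\<lambda>j. cg L (lower_star L j) j)
       (join_irreducibles L) (join_irreducibles (congruence_lattice L))"

definition congruence_uniform :: "('a, 'b) gorder_scheme \<Rightarrow> bool" where
  "congruence_uniform L \<longleftrightarrow> cg_bijective L \<and> cg_bijective (inv_gorder L)"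

definition semidistributive :: "('a, 'b) gorder_scheme \<Rightarrow> bool" where
  "semidistributive L \<longleftrightarrow>
     (\<forall>p\<in>carrier L. \<forall>q\<in>carrier L. \<forall>r\<in>carrier L.
        (p \<squnion>\<^bsub>L\<^esub> q = p \<squnion>\<^bsub>L\<^esub> r \<longrightarrow> p \<squnion>\<^bsub>L\<^esub> q = p \<squnion>\<^bsub>L\<^esub> (q \<sqinter>\<^bsub>L\<^esub> r)) \<and>
        (p \<sqinter>\<^bsub>L\<^esub> q = p \<sqinter>\<^bsub>L\<^esub> r \<longrightarrow> p \<sqinter>\<^bsub>L\<^esub> q = p \<sqinter>\<^bsub>L\<^esub> (q \<squnion>\<^bsub>L\<^esub> r)))"

definition chain_in :: "('a, 'b) gorder_scheme \<Rightarrow> 'a set \<Rightarrow> bool" where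
  "chain_in L C \<longleftrightarrow> C \<subseteq> carrier L \<and> (\<forall>x\<in>C. \<forall>y\<in>C. x \<sqsubseteq>\<^bsub>L\<^esub> y \<or> y \<sqsubseteq>\<^bsub>L\<^esub> x)"

definition maximal_chain_in :: "('a, 'b) gorder_scheme \<Rightarrow> 'a set \<Rightarrow> bool" where
  "maximal_chain_in L C \<longleftrightarrow> chain_in L C \<and> (\<forall>D. chain_in L D \<and> C \<subseteq> D \<longrightarrow> D = C)"

definition lattice_length :: "('a, 'b) gorder_scheme \<Rightarrow> nat" where
  "lattice_length L = Max {card C - 1 | C. chain_in L C}"

definition extremal :: "('a, 'b) gorder_scheme \<Rightarrow> bool" where
  "extremal L \<longleftrightarrow> card (join_irreducibles L) = lattice_length L \<and>
     lattice_length L = card (meet_irreducibles L)"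

definition left_modular_element :: "('a, 'b) gorder_scheme \<Rightarrow> 'a \<Rightarrow> bool" where
  "left_modular_element L p \<longleftrightarrow> p \<in> carrier L \<and>
     (\<forall>q\<in>carrier L. \<forall>r\<in>carrier L. r \<sqsubseteq>\<^bsub>L\<^esub> q \<longrightarrow>
        (r \<squnion>\<^bsub>L\<^esub> p) \<sqinter>\<^bsub>L\<^esub> q = r \<squnion>\<^bsub>L\<^esub> (p \<sqinter>\<^bsub>L\<^esub> q))"

definition left_modular :: "('a, 'b) gorder_scheme \<Rightarrow> bool" where
  "left_modular L \<longleftrightarrow>
     (\<exists>C. maximal_chain_in L C \<and> card C = lattice_length L + 1 \<and>
        (\<forall>p\<in>C. left_modular_element L p))"

definition trim :: "('a, 'b) gorder_scheme \<Rightarrow> bool" where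
  "trim L \<longleftrightarrow> extremal L \<and> left_modular L"


section \<open>The hyperoctahedral group\<close>

definition pm :: "nat \<Rightarrow> int set" where
  "pm n = {- int n..int n} - {0}"

text \<open>A permutation of \<^term>\<open>pm n\<close> is a function on all integers fixing every point
  outside \<^term>\<open>pm n\<close>; products are compositions \<^term>\<open>(\<circ>)\<close>.\<close>

definition hyperoct :: "nat \<Rightarrow> (int \<Rightarrow> int) set" where
  "hyperoct n = {\<pi>. \<pi> permutes pm n \<and> (\<forall>a\<in>pm n. \<pi> (- a) = - \<pi> a)}"

definition simple_gen :: "nat \<Rightarrow> int \<Rightarrow> int" where
  "simple_gen i =
     (if i = 0 then transpose 1 (- 1)
      else transpose (int i) (int i + 1) \<circ> transpose (- int i) (- int i - 1))"

definition simple_gens :: "nat \<Rightarrow> (int \<Rightarrow> int) set" where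
  "simple_gens n = simple_gen ` {0..<n}"

definition coxeter_length :: "nat \<Rightarrow> (int \<Rightarrow> int) \<Rightarrow> nat" where
  "coxeter_length n w =
     (LEAST k. \<exists>ss. set ss \<subseteq> simple_gens n \<and> length ss = k \<and> w = foldr (\<circ>) ss id)"

definition reflections :: "nat \<Rightarrow> (int \<Rightarrow> int) set" where
  "reflections n = {w \<circ> s \<circ> inv w | w s. w \<in> hyperoct n \<and> s \<in> simple_gens n}"

definition Inv :: "nat \<Rightarrow> (int \<Rightarrow> int) \<Rightarrow> (int \<Rightarrow> int) set" where
  "Inv n \<pi> = {t \<in> reflections n. coxeter_length n (\<pi> \<circ> t) < coxeter_length n \<pi>}"

definition weak_le :: "nat \<Rightarrow> (int \<Rightarrow> int) \<Rightarrow> (int \<Rightarrow> int) \<Rightarrow> bool" where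
  "weak_le n u v \<longleftrightarrow> Inv n u \<subseteq> Inv n v"


section \<open>Type-B compositions and parabolic quotients\<close>

definition typeB_composition :: "nat \<Rightarrow> nat list \<Rightarrow> bool" where
  "typeB_composition n \<alpha> \<longleftrightarrow>
     (\<exists>\<beta>. (\<alpha> = \<beta> \<or> \<alpha> = 0 # \<beta>) \<and> (\<forall>a\<in>set \<beta>. 0 < a) \<and> sum_list \<beta> = n)"

definition split_comp :: "nat list \<Rightarrow> bool" where
  "split_comp \<alpha> \<longleftrightarrow> \<alpha> \<noteq> [] \<and> hd \<alpha> = 0"

definition pos_parts :: "nat list \<Rightarrow> nat list" where
  "pos_parts \<alpha> = (if split_comp \<alpha> then tl \<alpha> else \<alpha>)"

definition psum :: "nat list \<Rightarrow> nat \<Rightarrow> nat" where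
  "psum \<alpha> i = sum_list (take i (pos_parts \<alpha>))"

definition pos_block :: "nat list \<Rightarrow> nat \<Rightarrow> int set" where
  "pos_block \<alpha> i = {int (psum \<alpha> (i - 1)) + 1..int (psum \<alpha> i)}"

definition neg_block :: "nat list \<Rightarrow> nat \<Rightarrow> int set" where
  "neg_block \<alpha> i = {- int (psum \<alpha> i)..- int (psum \<alpha> (i - 1)) - 1}"

definition Part :: "nat list \<Rightarrow> int set set" where
  "Part \<alpha> =
     (let r = length (pos_parts \<alpha>) in
      if split_comp \<alpha> then pos_block \<alpha> ` {1..r} \<union> neg_block \<alpha> ` {1..r}
      else insert (pos_block \<alpha> 1 \<union> neg_block \<alpha> 1)
             (pos_block \<alpha> ` {2..r} \<union> neg_block \<alpha> ` {2..r}))"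

definition J_gens :: "nat list \<Rightarrow> (int \<Rightarrow> int) set" where
  "J_gens \<alpha> =
     (\<lambda>i. simple_gen (psum \<alpha> i)) ` {1..<length (pos_parts \<alpha>)} \<union>
     (if split_comp \<alpha> then {simple_gen 0} else {})"

definition quotient_reps :: "nat \<Rightarrow> nat list \<Rightarrow> (int \<Rightarrow> int) set" where
  "quotient_reps n \<alpha> = {w \<in> hyperoct n. \<forall>s \<in> simple_gens n - J_gens \<alpha>.
     coxeter_length n (w \<circ> s) > coxeter_length n w}"


section \<open>Pattern avoidance and the type-B parabolic Tamari lattice\<close>

definition succ_pm :: "int \<Rightarrow> int" where
  "succ_pm x = (if x = - 1 then 1 else x + 1)"

definition in_distinct_blocks :: "nat list \<Rightarrow> int \<Rightarrow> int \<Rightarrow> int \<Rightarrow> bool" where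
  "in_distinct_blocks \<alpha> i j k \<longleftrightarrow>
     (\<exists>A\<in>Part \<alpha>. \<exists>B\<in>Part \<alpha>. \<exists>C\<in>Part \<alpha>.
        i \<in> A \<and> j \<in> B \<and> k \<in> C \<and> A \<noteq> B \<and> A \<noteq> C \<and> B \<noteq> C)"

definition split_pattern ::
  "nat \<Rightarrow> nat list \<Rightarrow> (int \<Rightarrow> int) \<Rightarrow> int \<Rightarrow> int \<Rightarrow> int \<Rightarrow> bool" where
  "split_pattern n \<alpha> \<pi> i j k \<longleftrightarrow>
     i \<in> pm n \<and> j \<in> pm n \<and> k \<in> pm n \<and> i < j \<and> j < k \<and> in_distinct_blocks \<alpha> i j k \<and>
     j > 0 \<and> \<pi> i = succ_pm (\<pi> k) \<and> \<pi> i < \<pi> j"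

definition join_pattern ::
  "nat \<Rightarrow> nat list \<Rightarrow> (int \<Rightarrow> int) \<Rightarrow> int \<Rightarrow> int \<Rightarrow> int \<Rightarrow> bool" where
  "join_pattern n \<alpha> \<pi> i j k \<longleftrightarrow>
     i \<in> pm n \<and> j \<in> pm n \<and> k \<in> pm n \<and> i < j \<and> j < k \<and> in_distinct_blocks \<alpha> i j k \<and>
     j > 0 \<and> \<pi> i = succ_pm (\<pi> k) \<and>
     (j > int (hd \<alpha>) \<and> \<pi> j > \<pi> i \<or> 0 < j \<and> j \<le> int (hd \<alpha>) \<and> \<pi> j < \<pi> k)"

definition avoiders_231 :: "nat \<Rightarrow> nat list \<Rightarrow> (int \<Rightarrow> int) set" where
  "avoiders_231 n \<alpha> = {\<pi> \<in> quotient_reps n \<alpha>.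
     if split_comp \<alpha> then \<not> (\<exists>i j k. split_pattern n \<alpha> \<pi> i j k)
     else \<not> (\<exists>i j k. join_pattern n \<alpha> \<pi> i j k)}"

definition Tam_B :: "nat \<Rightarrow> nat list \<Rightarrow> (int \<Rightarrow> int) gorder" where
  "Tam_B n \<alpha> = \<lparr>carrier = avoiders_231 n \<alpha>, eq = (=), le = weak_le n\<rparr>"

end

theory Submission
  imports Defs "HOL-Library.Product_Lexorder"
begin

text \<open>
  Number the blocks of a composition by an odd monotone function \<open>\<beta>\<close> on positions. An inversion
  between positions \<open>a < c\<close> in different blocks, taken up to \<open>(a, c) \<mapsto> (-c, -a)\<close>, generates a
  smallest avoider, and these avoiders turn out to be the join-irreducibles. Assigning to an avoider
  \<open>x\<close> the set \<open>A x\<close> of join-irreducibles below it embeds the lattice as a closure system of sets,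
  in which the join of \<open>x\<close> and \<open>y\<close> comes from the transitive closure of the union of the two
  inversion sets. Everything follows from three features of this closure system.

  \<^item> There is a linear order on the join-irreducibles all of whose initial segments are closed;
    they form the left modular chain, and its length shows extremality.
  \<^item> For each join-irreducible \<open>j\<close>, the elements above \<open>j\<^sub>*\<close> but not above \<open>j\<close> are stable under joins;
    their greatest element is the meet-irreducible paired with \<open>j\<close>.
  \<^item> Deleting from all sets \<open>A x\<close> the join-irreducibles of large height \<open>c - a\<close> is a lattice
    homomorphism, since transitivity produces a pair only from shorter ones. Such congruences
    separate the join-irreducibles, so \<open>j \<mapsto> cg(j\<^sub>*, j)\<close> is injective.
\<close>

section \<open>Lattices represented by sets of join-irreducibles\<close>

text \<open>The interface asks for joins only: meets are intersections of the sets
  \<open>A x\<close>, because \<open>A x\<close> contains \<open>A (g t)\<close> along with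
  \<open>t\<close>. Surjectivity of the map from join-irreducibles to join-irreducible congruences
  holds in every finite lattice, so injectivity is the point, and it has to hold in the dual as
  well. One argument serves both: the edge from \<open>m t\<close> up to its only cover is
  perspective to the edge below \<open>g t\<close> and generates the same congruence. This also
  shows that \<open>m\<close> is injective, hence that there are as many meet-irreducibles as
  join-irreducibles. The obstacle in type B is the identification of \<open>(a, c)\<close> with
  \<open>(-c, -a)\<close>. A generator and its mirror image can be composed through the central
  block, so a join-irreducible may invert pairs longer than its index, and truncation by height
  would fail for its inversion set. Generators are therefore compared through the smaller sets
  \<open>dn t\<close>, which contain only pairs nested in \<open>t\<close>; mirror images and
  composites follow automatically, since inversion sets are symmetric and transitive.\<close>

text \<open>
  \<open>A x\<close> indexes the join-irreducibles below \<open>x\<close>, and \<open>g t\<close> is the join-irreducible with index \<open>t\<close>.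
\<close>

locale trim_representation =
  fixes L :: "('a, 'm) gorder_scheme"
    and T :: "'b set"
    and A :: "'a \<Rightarrow> 'b set"
    and J :: "'a \<Rightarrow> 'a \<Rightarrow> 'a"
    and g :: "'b \<Rightarrow> 'a"
    and r :: "'b \<Rightarrow> 'r :: linorder"
  assumes eq_L: "eq L = (=)"
    and finite_T: "finite T"
    and A_sub: "x \<in> carrier L \<Longrightarrow> A x \<subseteq> T"
    and A_inj: "inj_on A (carrier L)"
    and le_iff: "x \<in> carrier L \<Longrightarrow> y \<in> carrier L \<Longrightarrow> le L x y \<longleftrightarrow> A x \<subseteq> A y"
    and J_closed: "x \<in> carrier L \<Longrightarrow> y \<in> carrier L \<Longrightarrow> J x y \<in> carrier L"
    and J_upper: "x \<in> carrier L \<Longrightarrow> y \<in> carrier L \<Longrightarrow> A x \<union> A y \<subseteq> A (J x y)"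
    and J_least: "x \<in> carrier L \<Longrightarrow> y \<in> carrier L \<Longrightarrow> z \<in> carrier L \<Longrightarrow>
      A x \<union> A y \<subseteq> A z \<Longrightarrow> A (J x y) \<subseteq> A z"
    and g_closed: "t \<in> T \<Longrightarrow> g t \<in> carrier L"
    and g_mem: "t \<in> T \<Longrightarrow> t \<in> A (g t)"
    and g_least: "x \<in> carrier L \<Longrightarrow> t \<in> A x \<Longrightarrow> A (g t) \<subseteq> A x"
    and r_inj: "inj_on r T"
    and initial_segment: "U \<subseteq> T \<Longrightarrow> (\<And>s t. s \<in> U \<Longrightarrow> t \<in> T \<Longrightarrow> r t \<le> r s \<Longrightarrow> t \<in> U) \<Longrightarrow>
      \<exists>x\<in>carrier L. A x = U"
    and join_avoids: "t \<in> T \<Longrightarrow> x \<in> carrier L \<Longrightarrow> y \<in> carrier L \<Longrightarrow>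
      A (g t) \<subseteq> insert t (A x) \<Longrightarrow> A (g t) \<subseteq> insert t (A y) \<Longrightarrow>
      t \<notin> A x \<Longrightarrow> t \<notin> A y \<Longrightarrow> t \<notin> A (J x y)"
    and separating: "s \<in> T \<Longrightarrow> t \<in> T \<Longrightarrow> s \<noteq> t \<Longrightarrow>
      \<exists>S. (s \<in> S) \<noteq> (t \<in> S) \<and> (\<forall>x\<in>carrier L. \<forall>y\<in>carrier L. \<forall>z\<in>carrier L.
        A x \<inter> S = A y \<inter> S \<longrightarrow> A (J x z) \<inter> S \<subseteq> A (J y z))"
begin

section \<open>Order, meets and joins recovered from the sets \<open>A x\<close>\<close>

lemma A_eqD: "x \<in> carrier L \<Longrightarrow> y \<in> carrier L \<Longrightarrow> A x = A y \<Longrightarrow> x = y"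
  using A_inj by (auto dest: inj_onD)

lemma finite_A: "x \<in> carrier L \<Longrightarrow> finite (A x)"
  using A_sub finite_T finite_subset by blast

lemma finite_carrier: "finite (carrier L)"
proof (rule inj_on_finite[OF A_inj])
  show "A ` carrier L \<subseteq> Pow T" using A_sub by (simp add: image_subset_iff)
qed (simp add: finite_T)

lemma exists_maximal:
  assumes "x \<in> carrier L" "P x"
  obtains z where "z \<in> carrier L" "P z" "\<And>y. y \<in> carrier L \<Longrightarrow> P y \<Longrightarrow> A z \<subseteq> A y \<Longrightarrow> A y = A z"
proof -
  have "finite (A ` {y \<in> carrier L. P y})" "A ` {y \<in> carrier L. P y} \<noteq> {}"
    using finite_carrier assms by auto
  from finite_has_maximal[OF this] obtain M where M: "M \<in> A ` {y \<in> carrier L. P y}" "\<And>Y. Y \<in> A ` {y \<in> carrier L. P y} \<Longrightarrow> M \<subseteq> Y \<Longrightarrow> M = Y"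
    by (metis)
  from M(1) obtain z where z: "z \<in> carrier L" "P z" "M = A z" by blast
  show thesis
  proof (rule that[OF z(1,2)])
    fix y assume "y \<in> carrier L" "P y" "A z \<subseteq> A y"
    then have "A y \<in> A ` {y \<in> carrier L. P y}" by simp
    from M(2)[OF this] \<open>A z \<subseteq> A y\<close> show "A y = A z" using z(3) by simp
  qed
qed

lemma exists_minimal:
  assumes "x \<in> carrier L" "P x"
  obtains z where "z \<in> carrier L" "P z" "\<And>y. y \<in> carrier L \<Longrightarrow> P y \<Longrightarrow> A y \<subseteq> A z \<Longrightarrow> A y = A z"
proof -
  have "finite (A ` {y \<in> carrier L. P y})" "A ` {y \<in> carrier L. P y} \<noteq> {}"
    using finite_carrier assms by auto
  from finite_has_minimal[OF this] obtain M where M: "M \<in> A ` {y \<in> carrier L. P y}" "\<And>Y. Y \<in> A ` {y \<in> carrier L. P y} \<Longrightarrow> Y \<subseteq> M \<Longrightarrow> M = Y"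
    by (metis)
  from M(1) obtain z where z: "z \<in> carrier L" "P z" "M = A z" by blast
  show thesis
  proof (rule that[OF z(1,2)])
    fix y assume "y \<in> carrier L" "P y" "A y \<subseteq> A z"
    then have "A y \<in> A ` {y \<in> carrier L. P y}" by simp
    from M(2)[OF this] \<open>A y \<subseteq> A z\<close> show "A y = A z" using z(3) by simp
  qed
qed

lemma exists_bottom: "\<exists>x\<in>carrier L. A x = {}"
  using initial_segment[of "{}"] by simp

lemma exists_top: "\<exists>x\<in>carrier L. A x = T"
  using initial_segment[of T] by simp

text \<open>A maximal lower bound \<open>z\<close> contains every \<open>t\<close> of the
  intersection, because joining \<open>g t\<close> to \<open>z\<close> gives another lower
  bound.\<close>

lemma exists_meet:
  assumes x: "x \<in> carrier L" and y: "y \<in> carrier L"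
  shows "\<exists>z\<in>carrier L. A z = A x \<inter> A y"
proof -
  obtain b where "b \<in> carrier L" "A b \<subseteq> A x \<inter> A y" using exists_bottom by auto
  from exists_maximal[where P = "\<lambda>w. A w \<subseteq> A x \<inter> A y", OF this] obtain z where z: "z \<in> carrier L" "A z \<subseteq> A x \<inter> A y"
    and max: "\<And>w. w \<in> carrier L \<Longrightarrow> A w \<subseteq> A x \<inter> A y \<Longrightarrow> A z \<subseteq> A w \<Longrightarrow> A w = A z" by blast
  have "t \<in> A z" if t: "t \<in> A x" "t \<in> A y" for t
  proof -
    have T: "t \<in> T" using t A_sub[OF x] by blast
    have "A z \<union> A (g t) \<subseteq> A x" "A z \<union> A (g t) \<subseteq> A y"
      using z g_least t x y by auto
    then have "A (J z (g t)) \<subseteq> A x \<inter> A y"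
      using J_least[OF z(1) g_closed[OF T]] x y by simp
    then have "A (J z (g t)) = A z"
      using max[OF J_closed[OF z(1) g_closed[OF T]]] J_upper[OF z(1) g_closed[OF T]] by simp
    then show ?thesis using J_upper[OF z(1) g_closed[OF T]] g_mem[OF T] by blast
  qed
  then show ?thesis using z by blast
qed

lemma is_partial_order: "partial_order L"
proof
  show "x \<in> carrier L \<Longrightarrow> eq L x x" for x by (simp add: eq_L)
  show "eq L x y \<Longrightarrow> x \<in> carrier L \<Longrightarrow> y \<in> carrier L \<Longrightarrow> eq L y x" for x y
    by (simp add: eq_L)
  show "eq L x y \<Longrightarrow> eq L y z \<Longrightarrow> x \<in> carrier L \<Longrightarrow> y \<in> carrier L \<Longrightarrow> z \<in> carrier L \<Longrightarrow> eq L x z"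
    for x y z by (simp add: eq_L)
qed (auto simp: eq_L le_iff intro: A_eqD)

lemma least_J:
  assumes "x \<in> carrier L" "y \<in> carrier L"
  shows "least L (J x y) (Upper L {x, y})"
proof (rule least_UpperI)
  show "le L z (J x y)" if "z \<in> {x, y}" for z
    using that J_upper[OF assms] assms by (auto simp: le_iff J_closed)
  show "le L (J x y) z" if "z \<in> Upper L {x, y}" for z
  proof -
    have "z \<in> carrier L" "le L x z" "le L y z" using that assms by (auto simp: Upper_def)
    then have "z \<in> carrier L" "A x \<union> A y \<subseteq> A z" using assms by (simp_all add: le_iff)
    then show ?thesis using J_least[OF assms] assms by (simp add: le_iff J_closed)
  qed
qed (use assms J_closed in auto)

lemma greatest_meet:
  assumes "x \<in> carrier L" "y \<in> carrier L" "z \<in> carrier L" "A z = A x \<inter> A y"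
  shows "greatest L z (Lower L {x, y})"
proof (rule greatest_LowerI)
  show "le L z w" if "w \<in> {x, y}" for w
    using that assms by (auto simp: le_iff)
  show "le L w z" if "w \<in> Lower L {x, y}" for w
  proof -
    have "w \<in> carrier L" "le L w x" "le L w y" using that assms by (auto simp: Lower_def)
    then have "w \<in> carrier L" "A w \<subseteq> A x" "A w \<subseteq> A y" using assms by (simp_all add: le_iff)
    then show ?thesis using assms by (simp add: le_iff)
  qed
qed (use assms in auto)

lemma is_lattice: "lattice L"
proof -
  interpret partial_order L by (rule is_partial_order)
  show ?thesis
  proof
    fix x y assume xy: "x \<in> carrier L" "y \<in> carrier L"
    show "\<exists>s. least L s (Upper L {x, y})" using least_J[OF xy] by blast
    show "\<exists>s. greatest L s (Lower L {x, y})" using greatest_meet[OF xy] exists_meet[OF xy] by blast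
  qed
qed

lemma finite_lattice_L: "finite_lattice L"
  by (simp add: finite_lattice_def is_lattice finite_carrier)

lemma join_eq:
  assumes "x \<in> carrier L" "y \<in> carrier L"
  shows "join L x y = J x y"
proof -
  have "least L (join L x y) (Upper L {x, y})"
    unfolding join_def sup_def using least_J[OF assms] by (rule someI)
  then show ?thesis
    using partial_order.least_unique[OF is_partial_order _ least_J[OF assms]] by blast
qed

lemma meet_mem: "x \<in> carrier L \<Longrightarrow> y \<in> carrier L \<Longrightarrow> meet L x y \<in> carrier L"
  and A_meet: "x \<in> carrier L \<Longrightarrow> y \<in> carrier L \<Longrightarrow> A (meet L x y) = A x \<inter> A y"
proof -
  assume xy: "x \<in> carrier L" "y \<in> carrier L"
  then obtain z where z: "z \<in> carrier L" "A z = A x \<inter> A y" using exists_meet by blast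
  then have "greatest L z (Lower L {x, y})" using greatest_meet xy by blast
  then have "greatest L (meet L x y) (Lower L {x, y})"
    unfolding meet_def inf_def by (rule someI)
  with \<open>greatest L z _\<close> have "meet L x y = z"
    using is_partial_order partial_order.greatest_unique by metis
  with z show "meet L x y \<in> carrier L" "A (meet L x y) = A x \<inter> A y" by auto
qed

lemma join_mem: "x \<in> carrier L \<Longrightarrow> y \<in> carrier L \<Longrightarrow> join L x y \<in> carrier L"
  by (simp add: join_eq J_closed)

lemma A_join_least:
  "x \<in> carrier L \<Longrightarrow> y \<in> carrier L \<Longrightarrow> z \<in> carrier L \<Longrightarrow>
   A (join L x y) \<subseteq> A z \<longleftrightarrow> A x \<subseteq> A z \<and> A y \<subseteq> A z"
  using J_upper[of x y] J_least[of x y z] by (auto simp: join_eq)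

lemma A_join_upper:
  "x \<in> carrier L \<Longrightarrow> y \<in> carrier L \<Longrightarrow> A x \<subseteq> A (join L x y)"
  "x \<in> carrier L \<Longrightarrow> y \<in> carrier L \<Longrightarrow> A y \<subseteq> A (join L x y)"
  using J_upper[of x y] by (auto simp: join_eq)

lemma join_absorb:
  assumes "x \<in> carrier L" "y \<in> carrier L" "A x \<subseteq> A y"
  shows "join L x y = y" "join L y x = y"
proof -
  have "A (join L x y) = A y" "A (join L y x) = A y"
    using A_join_least[OF assms(1,2,2)] A_join_upper(2)[OF assms(1,2)]
      A_join_least[OF assms(2,1,2)] A_join_upper(1)[OF assms(2,1)] assms(3) by blast+
  then show "join L x y = y" "join L y x = y"
    using A_eqD[OF join_mem[OF assms(1,2)] assms(2)] A_eqD[OF join_mem[OF assms(2,1)] assms(2)]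
    by simp_all
qed

lemma meet_absorb:
  assumes "x \<in> carrier L" "y \<in> carrier L" "A x \<subseteq> A y"
  shows "meet L x y = x" "meet L y x = x"
proof -
  have "A (meet L x y) = A x" "A (meet L y x) = A x"
    using A_meet[OF assms(1,2)] A_meet[OF assms(2,1)] assms(3) by blast+
  then show "meet L x y = x" "meet L y x = x"
    using A_eqD[OF meet_mem[OF assms(1,2)] assms(1)] A_eqD[OF meet_mem[OF assms(2,1)] assms(1)]
    by simp_all
qed

section \<open>Join-irreducibles and the meet-irreducibles paired with them\<close>

lemma A_g_rank: "t \<in> T \<Longrightarrow> s \<in> A (g t) \<Longrightarrow> s \<noteq> t \<Longrightarrow> r s < r t"
proof -
  assume t: "t \<in> T" and s: "s \<in> A (g t)" "s \<noteq> t"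
  obtain x where x: "x \<in> carrier L" "A x = {u \<in> T. r u \<le> r t}"
    using initial_segment[of "{u \<in> T. r u \<le> r t}"] by force
  then have "s \<in> T" "r s \<le> r t" using g_least[of x t] t s by auto
  then show ?thesis using s(2) t r_inj by (metis inj_onD order_le_less)
qed

definition g_lower :: "'b \<Rightarrow> 'a" where
  "g_lower t = (SOME x. x \<in> carrier L \<and> A x = A (g t) - {t})"

text \<open>By \<open>A_g_rank\<close> all other members of \<open>A (g t)\<close> come before
  \<open>t\<close>, so removing \<open>t\<close> amounts to intersecting with the initial segment
  strictly before \<open>t\<close>.\<close>

lemma g_lower:
  assumes t: "t \<in> T"
  shows "g_lower t \<in> carrier L" "A (g_lower t) = A (g t) - {t}"
proof -
  obtain x where x: "x \<in> carrier L" "A x = {u \<in> T. r u < r t}"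
    using initial_segment[of "{u \<in> T. r u < r t}"] by force
  have "A (g t) - {t} = A (g t) \<inter> A x"
    using A_g_rank[OF t] A_sub[OF g_closed[OF t]] x by auto
  then have "\<exists>y. y \<in> carrier L \<and> A y = A (g t) - {t}"
    using exists_meet[OF g_closed[OF t] x(1)] by auto
  from someI_ex[OF this]
  show "g_lower t \<in> carrier L" "A (g_lower t) = A (g t) - {t}"
    unfolding g_lower_def by auto
qed

text \<open>The meet-irreducible paired with \<open>g t\<close>.\<close>

definition m :: "'b \<Rightarrow> 'a" where
  "m t = (SOME x. x \<in> carrier L \<and> A (g t) \<subseteq> insert t (A x) \<and> t \<notin> A x \<and>
    (\<forall>y\<in>carrier L. A (g t) \<subseteq> insert t (A y) \<longrightarrow> t \<notin> A y \<longrightarrow> A y \<subseteq> A x))"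

text \<open>Two candidates can be joined without acquiring \<open>t\<close> by
  \<open>join_avoids\<close>, so a maximal candidate is the greatest one. Thus \<open>m t\<close> is
  the greatest element above \<open>g_lower t\<close> that is not above \<open>g t\<close>.\<close>

lemma m:
  assumes t: "t \<in> T"
  shows m_closed: "m t \<in> carrier L"
    and m_upper: "A (g t) \<subseteq> insert t (A (m t))"
    and m_notin: "t \<notin> A (m t)"
    and m_greatest: "y \<in> carrier L \<Longrightarrow> A (g t) \<subseteq> insert t (A y) \<Longrightarrow> t \<notin> A y \<Longrightarrow> A y \<subseteq> A (m t)"
proof -
  let ?P = "\<lambda>x. A (g t) \<subseteq> insert t (A x) \<and> t \<notin> A x"
  have "?P (g_lower t)" using g_lower[OF t] by auto
  from exists_maximal[where P = ?P, OF g_lower(1)[OF t] this] obtain z where z: "z \<in> carrier L" "?P z"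
    and max: "\<And>w. w \<in> carrier L \<Longrightarrow> ?P w \<Longrightarrow> A z \<subseteq> A w \<Longrightarrow> A w = A z" by blast
  have "A y \<subseteq> A z" if "y \<in> carrier L" "?P y" for y
  proof -
    have ub: "A z \<subseteq> A (J z y)" "A y \<subseteq> A (J z y)" using J_upper[OF z(1) that(1)] by auto
    have "t \<notin> A (J z y)" using join_avoids[OF t z(1) that(1)] z(2) that(2) by simp
    then have "?P (J z y)" using ub(1) z(2) by blast
    then have "A (J z y) = A z" using max[OF J_closed[OF z(1) that(1)]] ub(1) by simp
    then show ?thesis using ub(2) by simp
  qed
  with z have "\<exists>x. x \<in> carrier L \<and> A (g t) \<subseteq> insert t (A x) \<and> t \<notin> A x \<and>
    (\<forall>y\<in>carrier L. A (g t) \<subseteq> insert t (A y) \<longrightarrow> t \<notin> A y \<longrightarrow> A y \<subseteq> A x)" by blast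
  note * = someI_ex[OF this, folded m_def]
  show "m t \<in> carrier L" using * by (elim conjE)
  show "A (g t) \<subseteq> insert t (A (m t))" using * by (elim conjE)
  show "t \<notin> A (m t)" using * by (elim conjE)
  show "A y \<subseteq> A (m t)" if "y \<in> carrier L" "A (g t) \<subseteq> insert t (A y)" "t \<notin> A y"
    using * that by (elim conjE) (drule bspec[of _ _ y], simp_all)
qed

definition m_cover :: "'b \<Rightarrow> 'a" where
  "m_cover t = join L (m t) (g t)"

lemma m_cover_closed: "t \<in> T \<Longrightarrow> m_cover t \<in> carrier L"
  by (simp add: m_cover_def join_mem m_closed g_closed)

lemma mem_m_cover: "t \<in> T \<Longrightarrow> t \<in> A (m_cover t)"
  unfolding m_cover_def 
  by (rule subsetD[OF A_join_upper(2)[OF m_closed g_closed] g_mem])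

lemma m_le_m_cover: "t \<in> T \<Longrightarrow> A (m t) \<subseteq> A (m_cover t)"
  unfolding m_cover_def by (rule A_join_upper(1)[OF m_closed g_closed])

text \<open>An element strictly above \<open>m t\<close> contains all of \<open>A (g t)\<close>
  except possibly \<open>t\<close>; if it missed \<open>t\<close>, it would lie below
  \<open>m t\<close>. Hence \<open>m_cover t\<close> is the only upper cover of
  \<open>m t\<close>.\<close>

lemma above_m:
  assumes t: "t \<in> T" and x: "x \<in> carrier L" "A (m t) \<subset> A x"
  shows "t \<in> A x" "A (m_cover t) \<subseteq> A x"
proof -
  show "t \<in> A x" using m_greatest[OF t x(1)] m_upper[OF t] x by blast
  then show "A (m_cover t) \<subseteq> A x"
    unfolding m_cover_def using A_join_least[OF m_closed[OF t] g_closed[OF t] x(1)] x g_least[OF x(1)] by blast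
qed

text \<open>A maximal element strictly below \<open>j\<close> joins with any generator it misses to
  \<open>j\<close>, and irreducibility leaves only the generator. Conversely, if neither
  \<open>p\<close> nor \<open>q\<close> contains \<open>t\<close>, their join stays below
  \<open>g_lower t\<close>.\<close>

lemma join_irreducibles_eq: "join_irreducibles L = g ` T"
proof (intro equalityI subsetI)
  fix j assume j: "j \<in> join_irreducibles L"
  then have jc: "j \<in> carrier L" and nl: "\<not> least L j (carrier L)"
    and irr: "\<And>p q. p \<in> carrier L \<Longrightarrow> q \<in> carrier L \<Longrightarrow> j = join L p q \<Longrightarrow> j = p \<or> j = q"
    by (auto simp: join_irreducibles_def)
  from nl have "A j \<noteq> {}" using jc by (auto simp: least_def le_iff)
  then obtain b where "b \<in> carrier L" "A b \<subset> A j" using exists_bottom by blast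
  from exists_maximal[where P = "\<lambda>w. A w \<subset> A j", OF this] obtain x where x: "x \<in> carrier L" "A x \<subset> A j"
    and max: "\<And>w. w \<in> carrier L \<Longrightarrow> A w \<subset> A j \<Longrightarrow> A x \<subseteq> A w \<Longrightarrow> A w = A x" by blast
  from x obtain t where t: "t \<in> A j" "t \<notin> A x" by blast
  have T: "t \<in> T" using t A_sub jc by blast
  have le: "A (join L x (g t)) \<subseteq> A j" using A_join_least x(1) g_closed[OF T] jc x(2) g_least[OF jc t(1)] by blast
  have "A x \<subseteq> A (join L x (g t))" "t \<in> A (join L x (g t))"
    using A_join_upper[OF x(1) g_closed[OF T]] g_mem[OF T] by auto
  then have "A (join L x (g t)) = A j"
    using max[OF join_mem[OF x(1) g_closed[OF T]]] le t(2) by blast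
  then have "j = join L x (g t)" using A_eqD jc join_mem x(1) g_closed[OF T] by metis
  then have "j = x \<or> j = g t" using irr x(1) g_closed[OF T] by blast
  then show "j \<in> g ` T" using x(2) T by auto
next
  fix j assume "j \<in> g ` T"
  then obtain t where t: "t \<in> T" "j = g t" by blast
  have "\<not> least L (g t) (carrier L)"
  proof
    assume "least L (g t) (carrier L)"
    then have "A (g t) \<subseteq> A (g_lower t)" using g_lower[OF t(1)] g_closed[OF t(1)] le_iff by (auto simp: least_def)
    then show False using g_lower[OF t(1)] g_mem[OF t(1)] by blast
  qed
  moreover have "g t = p \<or> g t = q" if pq: "p \<in> carrier L" "q \<in> carrier L" "g t = join L p q" for p q
  proof -
    have le: "A p \<subseteq> A (g t)" "A q \<subseteq> A (g t)" using A_join_upper[OF pq(1,2)] pq(3) by auto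
    have "t \<in> A p \<or> t \<in> A q"
    proof (rule ccontr)
      assume "\<not> ?thesis"
      then have "A (g t) \<subseteq> A (g_lower t)"
        using le A_join_least[OF pq(1,2) g_lower(1)[OF t(1)]] g_lower(2)[OF t(1)] pq(3) by auto
      then show False using g_lower[OF t(1)] g_mem[OF t(1)] by blast
    qed
    then show ?thesis using g_least pq le A_eqD g_closed[OF t(1)] by (metis subset_antisym)
  qed
  ultimately show "j \<in> join_irreducibles L"
    using t g_closed by (auto simp: join_irreducibles_def)
qed

lemma g_inj: "inj_on g T"
proof (rule inj_onI)
  fix s t assume st: "s \<in> T" "t \<in> T" "g s = g t"
  show "s = t"
  proof (rule ccontr)
    assume "s \<noteq> t"
    then have "r s < r t" "r t < r s"
      using A_g_rank[OF st(2), of s] A_g_rank[OF st(1), of t] st(3) g_mem[OF st(1)] g_mem[OF st(2)] by auto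
    then show False by simp
  qed
qed

text \<open>An element of least rank in the difference has the rest of \<open>A (g t)\<close>
  already inside \<open>A x\<close>. The step from \<open>x\<close> to \<open>join L x (g t)\<close>
  is then perspective to the cover below \<open>g t\<close>, which is how all later arguments climb
  in the lattice.\<close>

lemma minimal_difference:
  assumes "x \<in> carrier L" "y \<in> carrier L" "\<not> A y \<subseteq> A x"
  obtains t where "t \<in> T" "t \<in> A y" "t \<notin> A x" "A (g t) \<subseteq> insert t (A x)"
proof -
  have "finite (A y - A x)" "A y - A x \<noteq> {}" using finite_A assms by auto
  then obtain t where t: "t \<in> A y - A x" "\<And>s. s \<in> A y - A x \<Longrightarrow> r t \<le> r s"
    using arg_min_if_finite[of "A y - A x" r] by (metis linorder_not_le)
  have T: "t \<in> T" using t A_sub assms by blast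
  have "A (g t) \<subseteq> insert t (A x)"
  proof
    fix s assume s: "s \<in> A (g t)"
    show "s \<in> insert t (A x)"
    proof (rule ccontr)
      assume "s \<notin> insert t (A x)"
      then have "r s < r t" "s \<in> A y - A x"
        using A_g_rank[OF T s] g_least[OF assms(2)] s t by auto
      then show False using t(2) by force
    qed
  qed
  then show thesis using that T t by blast
qed

text \<open>For \<open>x\<close> minimal above \<open>j\<close> and a minimal difference
  \<open>t\<close>, the element \<open>m t\<close> lies above \<open>j\<close> and meets
  \<open>x\<close> in \<open>j\<close>. Conversely, two elements strictly above \<open>m t\<close>
  both contain \<open>t\<close>, and so does their meet.\<close>

lemma meet_irreducibles_eq: "meet_irreducibles L = m ` T"
proof (intro equalityI subsetI)
  fix j assume j: "j \<in> meet_irreducibles L"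
  then have jc: "j \<in> carrier L" and nl: "\<not> greatest L j (carrier L)"
    and irr: "\<And>p q. p \<in> carrier L \<Longrightarrow> q \<in> carrier L \<Longrightarrow> j = meet L p q \<Longrightarrow> j = p \<or> j = q"
    by (auto simp: meet_irreducibles_def)
  from nl have "A j \<noteq> T" using jc A_sub by (auto simp: greatest_def le_iff)
  then obtain b where "b \<in> carrier L" "A j \<subset> A b" using exists_top A_sub jc by blast
  from exists_minimal[where P = "\<lambda>w. A j \<subset> A w", OF this] obtain x where x: "x \<in> carrier L" "A j \<subset> A x"
    and min: "\<And>w. w \<in> carrier L \<Longrightarrow> A j \<subset> A w \<Longrightarrow> A w \<subseteq> A x \<Longrightarrow> A w = A x" by blast
  from x minimal_difference[OF jc x(1)] obtain t
    where t: "t \<in> T" "t \<in> A x" "t \<notin> A j" "A (g t) \<subseteq> insert t (A j)" by blast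
  have le: "A j \<subseteq> A (m t)" using m_greatest t jc by blast
  have ne: "A x \<noteq> A (meet L x (m t))" using A_meet[OF x(1) m_closed[OF t(1)]] m_notin[OF t(1)] t by blast
  have "A j = A (meet L x (m t))"
    using min[OF meet_mem[OF x(1) m_closed[OF t(1)]]] ne
      A_meet[OF x(1) m_closed[OF t(1)]] x(2) le by blast
  then have "j = meet L x (m t)" using A_eqD jc meet_mem x(1) m_closed[OF t(1)] by metis
  then have "j = x \<or> j = m t" using irr x(1) m_closed[OF t(1)] by blast
  then show "j \<in> m ` T" using x(2) t by auto
next
  fix j assume "j \<in> m ` T"
  then obtain t where t: "t \<in> T" "j = m t" by blast
  have "\<not> greatest L (m t) (carrier L)"
  proof
    assume "greatest L (m t) (carrier L)"
    then have "A (g t) \<subseteq> A (m t)" using g_closed[OF t(1)] m_closed[OF t(1)] le_iff by (auto simp: greatest_def)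
    then show False using m_notin[OF t(1)] g_mem[OF t(1)] by blast
  qed
  moreover have "m t = p \<or> m t = q" if pq: "p \<in> carrier L" "q \<in> carrier L" "m t = meet L p q" for p q
  proof (rule ccontr)
    assume "\<not> ?thesis"
    moreover have "A (m t) \<subseteq> A p" "A (m t) \<subseteq> A q" using A_meet pq by auto
    ultimately have "A (m t) \<subset> A p" "A (m t) \<subset> A q"
      using pq m_closed[OF t(1)] A_eqD by (metis psubsetI)+
    then have "t \<in> A p \<inter> A q" using above_m t pq by blast
    then show False using A_meet pq m_notin[OF t(1)] by metis
  qed
  ultimately show "j \<in> meet_irreducibles L"
    using t m_closed by (auto simp: meet_irreducibles_def)
qed

section \<open>Congruences and perspective edges\<close>

lemma restriction_congruence:
  assumes "\<forall>x\<in>carrier L. \<forall>y\<in>carrier L. \<forall>z\<in>carrier L.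
        A x \<inter> S = A y \<inter> S \<longrightarrow> A (J x z) \<inter> S \<subseteq> A (J y z)"
  shows "lattice_congruence L {(x, y). x \<in> carrier L \<and> y \<in> carrier L \<and> A x \<inter> S = A y \<inter> S}"
    (is "lattice_congruence L ?R")
proof -
  \<comment> \<open>The one-sided hypothesis becomes an equality by exchanging \<open>x\<close> and
    \<open>y\<close>. Meets need no hypothesis, being intersections.\<close>
  have sub: "A (J x z) \<inter> S = A (J y z) \<inter> S"
    if "x \<in> carrier L" "y \<in> carrier L" "z \<in> carrier L" "A x \<inter> S = A y \<inter> S" for x y z
  proof -
    have "A (J x z) \<inter> S \<subseteq> A (J y z)" "A (J y z) \<inter> S \<subseteq> A (J x z)" using assms that by simp_all
    then show ?thesis by blast
  qed
  have comm: "J x y = J y x" if "x \<in> carrier L" "y \<in> carrier L" for x y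
  proof (rule A_eqD[OF J_closed[OF that] J_closed[OF that(2,1)]])
    show "A (J x y) = A (J y x)"
      using J_least[OF that J_closed[OF that(2,1)]] J_upper[OF that(2,1)]
        J_least[OF that(2,1) J_closed[OF that]] J_upper[OF that] by simp
  qed
  have e: "equiv (carrier L) ?R"
    by (auto simp: equiv_def refl_on_def sym_def trans_def)
  have j: "(join L p p', join L q q') \<in> ?R" if "(p, q) \<in> ?R" "(p', q') \<in> ?R" for p q p' q'
  proof -
    have "A (J p p') \<inter> S = A (J q p') \<inter> S" using that sub by auto
    also have "\<dots> = A (J q q') \<inter> S" using that sub[of p' q' q] comm by auto
    finally show ?thesis using that by (auto simp: join_eq J_closed)
  qed
  have k: "(meet L p p', meet L q q') \<in> ?R" if "(p, q) \<in> ?R" "(p', q') \<in> ?R" for p q p' q'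
    using that by (auto simp: A_meet meet_mem)
  show ?thesis unfolding lattice_congruence_def by (intro conjI allI impI e j k)
qed

lemma congruence_refl: "lattice_congruence L \<theta> \<Longrightarrow> x \<in> carrier L \<Longrightarrow> (x, x) \<in> \<theta>"
  by (auto simp: lattice_congruence_def equiv_def refl_on_def)

lemma congruence_sub: "lattice_congruence L \<theta> \<Longrightarrow> (x, y) \<in> \<theta> \<Longrightarrow> x \<in> carrier L \<and> y \<in> carrier L"
  unfolding lattice_congruence_def equiv_def by blast

lemma congruence_join:
  "lattice_congruence L \<theta> \<Longrightarrow> (x, y) \<in> \<theta> \<Longrightarrow> z \<in> carrier L \<Longrightarrow> (join L x z, join L y z) \<in> \<theta>"
  "lattice_congruence L \<theta> \<Longrightarrow> (x, y) \<in> \<theta> \<Longrightarrow> z \<in> carrier L \<Longrightarrow> (join L z x, join L z y) \<in> \<theta>"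
  using congruence_refl by (auto simp: lattice_congruence_def)

lemma congruence_meet:
  "lattice_congruence L \<theta> \<Longrightarrow> (x, y) \<in> \<theta> \<Longrightarrow> z \<in> carrier L \<Longrightarrow> (meet L x z, meet L y z) \<in> \<theta>"
  "lattice_congruence L \<theta> \<Longrightarrow> (x, y) \<in> \<theta> \<Longrightarrow> z \<in> carrier L \<Longrightarrow> (meet L z x, meet L z y) \<in> \<theta>"
  using congruence_refl by (auto simp: lattice_congruence_def)

lemma congruence_sym: "lattice_congruence L \<theta> \<Longrightarrow> (x, y) \<in> \<theta> \<Longrightarrow> (y, x) \<in> \<theta>"
  by (auto simp: lattice_congruence_def equiv_def dest: symD)

lemma congruence_trans: "lattice_congruence L \<theta> \<Longrightarrow> (x, y) \<in> \<theta> \<Longrightarrow> (y, z) \<in> \<theta> \<Longrightarrow> (x, z) \<in> \<theta>"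
  by (auto simp: lattice_congruence_def equiv_def dest: transD)

text \<open>The interval from \<open>x\<close> to \<open>y\<close> projects down onto the edge below
  \<open>g t\<close>, so a congruence collapsing \<open>x\<close> with \<open>y\<close> also
  collapses that edge.\<close>

lemma perspective:
  assumes t: "t \<in> T" and x: "x \<in> carrier L" "t \<notin> A x" "A (g t) \<subseteq> insert t (A x)"
    and y: "y \<in> carrier L" "A x \<subseteq> A y" "t \<in> A y"
  shows "meet L (g t) x = g_lower t" "meet L (g t) y = g t" "join L x (g_lower t) = x"
proof -
  show "meet L (g t) x = g_lower t"
    by (rule A_eqD) (use g_lower[OF t] A_meet[OF g_closed[OF t] x(1)] x meet_mem g_closed[OF t] in auto)
  show "meet L (g t) y = g t" using meet_absorb(1)[OF g_closed[OF t] y(1)] g_least y by blast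
  show "join L x (g_lower t) = x" using join_absorb(2)[OF g_lower(1)[OF t] x(1)] g_lower(2)[OF t] x by blast
qed

lemma contracts_m_iff:
  assumes "lattice_congruence L \<theta>" "t \<in> T"
  shows "(m t, m_cover t) \<in> \<theta> \<longleftrightarrow> (g_lower t, g t) \<in> \<theta>"
proof
  note * = perspective[OF assms(2) m_closed m_notin m_upper m_cover_closed m_le_m_cover mem_m_cover,
      OF assms(2) assms(2) assms(2) assms(2) assms(2) assms(2)]
  assume "(m t, m_cover t) \<in> \<theta>"
  then show "(g_lower t, g t) \<in> \<theta>"
    using congruence_meet(2)[OF assms(1), of "m t" "m_cover t" "g t"] g_closed[OF assms(2)] * by simp
next
  note * = perspective[OF assms(2) m_closed m_notin m_upper m_cover_closed m_le_m_cover mem_m_cover,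
      OF assms(2) assms(2) assms(2) assms(2) assms(2) assms(2)]
  assume "(g_lower t, g t) \<in> \<theta>"
  then show "(m t, m_cover t) \<in> \<theta>"
    using congruence_join(2)[OF assms(1), of "g_lower t" "g t" "m t"] m_closed[OF assms(2)] *
    by (simp add: m_cover_def)
qed

lemma cg_m: "t \<in> T \<Longrightarrow> cg L (m t) (m_cover t) = cg L (g_lower t) (g t)"
  unfolding cg_def by (intro arg_cong[of _ _ Inter] Collect_cong conj_cong refl contracts_m_iff)

lemma congruence_Inter:
  assumes "\<And>\<theta>. \<theta> \<in> X \<Longrightarrow> lattice_congruence L \<theta>" "X \<noteq> {}"
  shows "lattice_congruence L (\<Inter>X)"
proof -
  have "equiv (carrier L) (\<Inter>X)"
  proof (rule equivI)
    show "refl_on (carrier L) (\<Inter>X)"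
      using assms congruence_refl congruence_sub unfolding refl_on_def by blast
    show "sym (\<Inter>X)" using assms congruence_sym unfolding sym_def by blast
    show "trans (\<Inter>X)" using assms congruence_trans unfolding trans_def by blast
    show "\<Inter>X \<subseteq> carrier L \<times> carrier L"
      using assms congruence_sub by fast
  qed
  moreover have "(join L p p', join L q q') \<in> \<Inter>X \<and> (meet L p p', meet L q q') \<in> \<Inter>X"
    if "(p, q) \<in> \<Inter>X" "(p', q') \<in> \<Inter>X" for p q p' q'
    using that assms(1) unfolding lattice_congruence_def by blast
  ultimately show ?thesis unfolding lattice_congruence_def by blast
qed

lemma congruence_full: "lattice_congruence L (carrier L \<times> carrier L)"
  unfolding lattice_congruence_def
  by (auto simp: equiv_def refl_on_def sym_def trans_def join_mem meet_mem)

lemma cg_congruence: "p \<in> carrier L \<Longrightarrow> q \<in> carrier L \<Longrightarrow> lattice_congruence L (cg L p q)"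
  unfolding cg_def
proof (rule congruence_Inter)
  assume "p \<in> carrier L" "q \<in> carrier L"
  then show "{\<theta>. lattice_congruence L \<theta> \<and> (p, q) \<in> \<theta>} \<noteq> {}" using congruence_full by blast
qed simp

lemma cg_mem: "(p, q) \<in> cg L p q" by (auto simp: cg_def)

lemma cg_least: "lattice_congruence L \<theta> \<Longrightarrow> (p, q) \<in> \<theta> \<Longrightarrow> cg L p q \<subseteq> \<theta>"
  by (auto simp: cg_def)

text \<open>The sets of \<open>g_lower u\<close> and \<open>g u\<close> differ in \<open>u\<close>
  alone, so restricting to \<open>S\<close> collapses this edge exactly when
  \<open>u \<notin> S\<close>. A set \<open>S\<close> containing just one of \<open>s\<close> and
  \<open>t\<close> therefore tells their congruences apart.\<close>

lemma cg_g_inj: "inj_on (\<lambda>t. cg L (g_lower t) (g t)) T"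
proof (rule inj_onI, rule ccontr)
  fix s t assume st: "s \<in> T" "t \<in> T" "cg L (g_lower s) (g s) = cg L (g_lower t) (g t)" "s \<noteq> t"
  then obtain S where S: "(s \<in> S) \<noteq> (t \<in> S)" and "\<forall>x\<in>carrier L. \<forall>y\<in>carrier L. \<forall>z\<in>carrier L.
        A x \<inter> S = A y \<inter> S \<longrightarrow> A (J x z) \<inter> S \<subseteq> A (J y z)"
    using separating[of s t] by blast
  from restriction_congruence[OF this(2)] have c: "lattice_congruence L
      {(x, y). x \<in> carrier L \<and> y \<in> carrier L \<and> A x \<inter> S = A y \<inter> S}" (is "lattice_congruence L ?R") .
  have iff: "(g_lower u, g u) \<in> ?R \<longleftrightarrow> u \<notin> S" if "u \<in> T" for u
    using g_lower[OF that] g_closed[OF that] g_mem[OF that] by blast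
  have "(g_lower s, g s) \<in> ?R \<longleftrightarrow> (g_lower t, g t) \<in> ?R"
    using cg_least[OF c] cg_mem st(3) by blast
  with iff st S show False by blast
qed

text \<open>Injectivity comes through the congruences: \<open>m t\<close> determines its unique
  upper cover, this edge generates the same congruence as the edge below \<open>g t\<close>, and
  that congruence determines \<open>t\<close>.\<close>

lemma m_inj: "inj_on m T"
proof (rule inj_onI)
  fix s t assume st: "s \<in> T" "t \<in> T" "m s = m t"
  have "A (m s) \<subset> A (m_cover s)" "A (m t) \<subset> A (m_cover t)"
    using mem_m_cover m_le_m_cover m_notin st by blast+
  then have "A (m_cover s) = A (m_cover t)"
    using above_m(2)[OF st(1) m_cover_closed[OF st(2)]] above_m(2)[OF st(2) m_cover_closed[OF st(1)]] st(3)
    by auto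
  then have "m_cover s = m_cover t" using A_eqD m_cover_closed st by metis
  then have "cg L (g_lower s) (g s) = cg L (g_lower t) (g t)"
    using cg_m st by metis
  then show "s = t" using cg_g_inj st by (auto dest: inj_onD)
qed

text \<open>A congruence is determined by the edges below join-irreducibles that it collapses:
  climbing from \<open>p\<close> to \<open>q\<close> by minimal differences, each step is
  perspective to such an edge. Incomparable elements are connected through their meet.\<close>

lemma congruence_le_of_generators:
  assumes \<theta>: "lattice_congruence L \<theta>" and \<phi>: "lattice_congruence L \<phi>"
    and gens: "\<And>t. t \<in> T \<Longrightarrow> (g_lower t, g t) \<in> \<theta> \<Longrightarrow> (g_lower t, g t) \<in> \<phi>"
  shows "\<theta> \<subseteq> \<phi>"
proof -
  have chain: "(p, q) \<in> \<phi>" if "(p, q) \<in> \<theta>" "p \<in> carrier L" "q \<in> carrier L" "A p \<subseteq> A q" for p q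
    using that
  proof (induction "card (A q - A p)" arbitrary: p rule: less_induct)
    case less
    show ?case
    proof (cases "A q \<subseteq> A p")
      case True
      then show ?thesis using less.prems A_eqD congruence_refl[OF \<phi>] by (metis subset_antisym)
    next
      case False
      then obtain t where t: "t \<in> T" "t \<in> A q" "t \<notin> A p" "A (g t) \<subseteq> insert t (A p)"
        using minimal_difference less.prems by metis
      note * = perspective[OF t(1) less.prems(2) t(3) t(4) less.prems(3) less.prems(4) t(2)]
      have "(g_lower t, g t) \<in> \<phi>"
        using gens[OF t(1)] congruence_meet(2)[OF \<theta> less.prems(1) g_closed[OF t(1)]] * by simp
      then have 1: "(p, join L p (g t)) \<in> \<phi>"
        using congruence_join(2)[OF \<phi> _ less.prems(2)] * by fastforce
      have jc: "join L p (g t) \<in> carrier L" using join_mem less.prems g_closed t by blast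
      have jq: "A (join L p (g t)) \<subseteq> A q"
        using A_join_least less.prems g_closed[OF t(1)] g_least t by blast
      have "(join L (join L p (g t)) p, join L (join L p (g t)) q) \<in> \<theta>"
        using congruence_join(2)[OF \<theta> less.prems(1) jc] .
      moreover have "join L (join L p (g t)) p = join L p (g t)"
        using join_absorb(2)[OF less.prems(2) jc] A_join_upper less.prems(2) g_closed[OF t(1)] by blast
      moreover have "join L (join L p (g t)) q = q" using join_absorb(1)[OF jc less.prems(3) jq] .
      ultimately have th: "(join L p (g t), q) \<in> \<theta>" by simp
      have "A q - A (join L p (g t)) \<subset> A q - A p"
        using A_join_upper[OF less.prems(2) g_closed[OF t(1)]] g_mem[OF t(1)] t by blast
      then have "card (A q - A (join L p (g t))) < card (A q - A p)"
        using finite_A[OF less.prems(3)] by (simp add: psubset_card_mono)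
      then have "(join L p (g t), q) \<in> \<phi>" using less.hyps th jc less.prems(3) jq by blast
      with 1 show ?thesis using congruence_trans[OF \<phi>] by blast
    qed
  qed
  show ?thesis
  proof (rule subrelI)
    fix p q assume pq: "(p, q) \<in> \<theta>"
    then have c: "p \<in> carrier L" "q \<in> carrier L" using congruence_sub[OF \<theta>] by auto
    have mc: "meet L p q \<in> carrier L" using meet_mem c by blast
    have "(meet L p q, q) \<in> \<theta>"
      using congruence_meet(1)[OF \<theta> pq c(2)] meet_absorb(1)[OF c(2) c(2)] by simp
    moreover have "(meet L p q, p) \<in> \<theta>"
      using congruence_sym[OF \<theta> congruence_meet(2)[OF \<theta> pq c(1)]] meet_absorb(1)[OF c(1) c(1)] by simp
    ultimately have "(meet L p q, q) \<in> \<phi>" "(meet L p q, p) \<in> \<phi>"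
      using chain mc c A_meet by auto
    then show "(p, q) \<in> \<phi>" using congruence_sym[OF \<phi>] congruence_trans[OF \<phi>] by blast
  qed
qed

text \<open>Joining or meeting a zigzag with a fixed element gives a zigzag again, so the two
  arguments of an operation can be replaced one after the other.\<close>

lemma congruence_trancl:
  assumes \<phi>: "lattice_congruence L \<phi>" and \<psi>: "lattice_congruence L \<psi>"
  shows "lattice_congruence L ((\<phi> \<union> \<psi>)\<^sup>+)" (is "lattice_congruence L (?R\<^sup>+)")
proof -
  have sub: "?R \<subseteq> carrier L \<times> carrier L" using congruence_sub[OF \<phi>] congruence_sub[OF \<psi>] by auto
  have subp: "?R\<^sup>+ \<subseteq> carrier L \<times> carrier L" using trancl_subset_Sigma[OF sub] .
  have "refl_on (carrier L) (?R\<^sup>+)" using congruence_refl[OF \<phi>] subp by (auto simp: refl_on_def)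
  moreover have "sym (?R\<^sup>+)"
    by (rule sym_trancl) (use congruence_sym[OF \<phi>] congruence_sym[OF \<psi>] in \<open>auto simp: sym_def\<close>)
  ultimately have e: "equiv (carrier L) (?R\<^sup>+)" using subp by (auto simp: equiv_def)
  have lift: "(f p, f q) \<in> ?R\<^sup>+" if "(p, q) \<in> ?R\<^sup>+" "\<And>p q. (p, q) \<in> ?R \<Longrightarrow> (f p, f q) \<in> ?R" for f p q
    using that(1) by induction (use that(2) in \<open>auto intro: trancl_into_trancl\<close>)
  have "(join L p p', join L q q') \<in> ?R\<^sup>+ \<and> (meet L p p', meet L q q') \<in> ?R\<^sup>+"
    if pq: "(p, q) \<in> ?R\<^sup>+" "(p', q') \<in> ?R\<^sup>+" for p q p' q'
  proof -
    have c: "p' \<in> carrier L" "q \<in> carrier L" using pq subp by auto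
    have "(join L p p', join L q p') \<in> ?R\<^sup>+"
      by (rule lift[OF pq(1)]) (use c congruence_join(1)[OF \<phi>] congruence_join(1)[OF \<psi>] in blast)
    moreover have "(join L q p', join L q q') \<in> ?R\<^sup>+"
      by (rule lift[OF pq(2)]) (use c congruence_join(2)[OF \<phi>] congruence_join(2)[OF \<psi>] in blast)
    moreover have "(meet L p p', meet L q p') \<in> ?R\<^sup>+"
      by (rule lift[OF pq(1)]) (use c congruence_meet(1)[OF \<phi>] congruence_meet(1)[OF \<psi>] in blast)
    moreover have "(meet L q p', meet L q q') \<in> ?R\<^sup>+"
      by (rule lift[OF pq(2)]) (use c congruence_meet(2)[OF \<phi>] congruence_meet(2)[OF \<psi>] in blast)
    ultimately show ?thesis by (meson trancl_trans)
  qed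
  with e show ?thesis unfolding lattice_congruence_def by blast
qed

text \<open>The join of an order record is a choice among least upper bounds, so the
  characterization is proved for every candidate \<open>\<theta>\<close> before the choice is
  evaluated.\<close>

lemma join_congruence_lattice:
  assumes \<phi>: "lattice_congruence L \<phi>" and \<psi>: "lattice_congruence L \<psi>"
  shows "join (congruence_lattice L) \<phi> \<psi> = (\<phi> \<union> \<psi>)\<^sup>+"
proof -
  have "least (congruence_lattice L) \<theta> (Upper (congruence_lattice L) {\<phi>, \<psi>}) \<longleftrightarrow> \<theta> = (\<phi> \<union> \<psi>)\<^sup>+" for \<theta>
  proof -
    have le: "(\<phi> \<union> \<psi>)\<^sup>+ \<subseteq> \<rho>" if "lattice_congruence L \<rho>" "\<phi> \<subseteq> \<rho>" "\<psi> \<subseteq> \<rho>" for \<rho>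
    proof -
      have "trans \<rho>" using that congruence_trans by (auto intro: transI)
      then show ?thesis using that trancl_mono_subset[of "\<phi> \<union> \<psi>" \<rho>] by simp
    qed
    have U: "Upper (congruence_lattice L) {\<phi>, \<psi>} = {\<rho>. lattice_congruence L \<rho> \<and> \<phi> \<subseteq> \<rho> \<and> \<psi> \<subseteq> \<rho>}"
      using assms by (auto simp: Upper_def congruence_lattice_def)
    have mem: "(\<phi> \<union> \<psi>)\<^sup>+ \<in> Upper (congruence_lattice L) {\<phi>, \<psi>}"
      unfolding U using congruence_trancl[OF assms] by auto
    show ?thesis
    proof
      assume l: "least (congruence_lattice L) \<theta> (Upper (congruence_lattice L) {\<phi>, \<psi>})"
      then have "\<theta> \<subseteq> (\<phi> \<union> \<psi>)\<^sup>+" using least_le[OF l mem] by (simp add: congruence_lattice_def)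
      moreover have "(\<phi> \<union> \<psi>)\<^sup>+ \<subseteq> \<theta>" using least_mem[OF l] le unfolding U by blast
      ultimately show "\<theta> = (\<phi> \<union> \<psi>)\<^sup>+" by simp
    next
      assume "\<theta> = (\<phi> \<union> \<psi>)\<^sup>+"
      then show "least (congruence_lattice L) \<theta> (Upper (congruence_lattice L) {\<phi>, \<psi>})"
        using mem le unfolding least_def U by (auto simp: congruence_lattice_def)
    qed
  qed
  then show ?thesis unfolding join_def sup_def by simp
qed

lemma congruence_Id: "lattice_congruence L (Id_on (carrier L))"
  unfolding lattice_congruence_def
  by (auto simp: equiv_def refl_on_def sym_def trans_def join_mem meet_mem)

lemma join_irreducible_cg:
  assumes t: "t \<in> T"
  shows "cg L (g_lower t) (g t) \<in> join_irreducibles (congruence_lattice L)"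
proof -
  let ?\<theta> = "cg L (g_lower t) (g t)"
  have c: "lattice_congruence L ?\<theta>" using cg_congruence g_lower g_closed t by blast
  have "t \<notin> A (g_lower t)" by (simp add: g_lower(2)[OF t])
  then have ne: "g_lower t \<noteq> g t" using g_mem[OF t] by auto
  have "\<not> least (congruence_lattice L) ?\<theta> (carrier (congruence_lattice L))"
  proof
    assume "least (congruence_lattice L) ?\<theta> (carrier (congruence_lattice L))"
    then have "?\<theta> \<subseteq> Id_on (carrier L)"
      using congruence_Id by (auto simp: least_def congruence_lattice_def)
    then have "(g_lower t, g t) \<in> Id_on (carrier L)" using cg_mem by (rule subsetD)
    then show False using ne by auto
  qed
  moreover have "?\<theta> = \<phi> \<or> ?\<theta> = \<psi>"
    if \<phi>: "lattice_congruence L \<phi>" and \<psi>: "lattice_congruence L \<psi>"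
      and eq: "?\<theta> = join (congruence_lattice L) \<phi> \<psi>" for \<phi> \<psi>
  proof -
    have eq': "?\<theta> = (\<phi> \<union> \<psi>)\<^sup>+" using eq join_congruence_lattice[OF \<phi> \<psi>] by simp
    have sub: "\<phi> \<subseteq> ?\<theta>" "\<psi> \<subseteq> ?\<theta>" unfolding eq' by auto
    have "(g_lower t, g t) \<in> (\<phi> \<union> \<psi>)\<^sup>+" using cg_mem eq' by metis
    \<comment> \<open>Projecting a zigzag from \<open>g_lower t\<close> to \<open>g t\<close> into the two-element interval
      \<open>[g_lower t, g t]\<close> yields a single step that contracts it.\<close>
    moreover have "(g_lower t, g t) \<in> \<phi> \<union> \<psi> \<or> \<not> A (g t) \<subseteq> A x" if "(g_lower t, x) \<in> (\<phi> \<union> \<psi>)\<^sup>+" for x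
      using that
    proof induction
      case (base y)
      show ?case
      proof (cases "A (g t) \<subseteq> A y")
        case True
        have yc: "y \<in> carrier L" using base congruence_sub \<phi> \<psi> by blast
        have "meet L (g t) (g_lower t) = g_lower t" "meet L (g t) y = g t"
          using meet_absorb(2)[OF g_lower(1)[OF t] g_closed[OF t]] g_lower(2)[OF t]
            meet_absorb(1)[OF g_closed[OF t] yc True] by auto
        then show ?thesis
          using base congruence_meet(2)[OF \<phi> _ g_closed[OF t], of "g_lower t" y]
            congruence_meet(2)[OF \<psi> _ g_closed[OF t], of "g_lower t" y] by auto
      qed simp
    next
      case (step y z)
      show ?case
      proof (cases "A (g t) \<subseteq> A y \<or> \<not> A (g t) \<subseteq> A z")
        case True
        with step show ?thesis by blast
      next
        case False
        have yc: "y \<in> carrier L" "z \<in> carrier L" using step congruence_sub \<phi> \<psi> by blast+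
        have ty: "t \<notin> A y" using False g_least yc by blast
        let ?f = "\<lambda>u. join L (g_lower t) (meet L (g t) u)"
        have "A (meet L (g t) y) \<subseteq> A (g_lower t)"
          using A_meet[OF g_closed[OF t] yc(1)] g_lower(2)[OF t] ty by auto
        then have "?f y = g_lower t"
          using join_absorb(2)[OF meet_mem[OF g_closed[OF t] yc(1)] g_lower(1)[OF t]] by simp
        moreover have "?f z = g t"
          using join_absorb(1)[OF g_lower(1)[OF t] g_closed[OF t]] g_lower(2)[OF t]
            meet_absorb(1)[OF g_closed[OF t] yc(2)] False by auto
        moreover have "(?f y, ?f z) \<in> \<phi> \<union> \<psi>"
          using step(2) congruence_join(2)[OF \<phi> congruence_meet(2)[OF \<phi> _ g_closed[OF t]] g_lower(1)[OF t]]
            congruence_join(2)[OF \<psi> congruence_meet(2)[OF \<psi> _ g_closed[OF t]] g_lower(1)[OF t]] by blast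
        ultimately show ?thesis by simp
      qed
    qed
    ultimately have "(g_lower t, g t) \<in> \<phi> \<union> \<psi>" by blast
    then show ?thesis using cg_least \<phi> \<psi> sub by blast
  qed
  ultimately show ?thesis using c by (auto simp: join_irreducibles_def congruence_lattice_def)
qed

text \<open>A congruence is generated by the finitely many edges below join-irreducibles that it
  collapses. Splitting off one generator at a time, join-irreducibility leaves a single one.\<close>

lemma join_irreducible_congruence:
  assumes "\<theta> \<in> join_irreducibles (congruence_lattice L)"
  shows "\<exists>t\<in>T. \<theta> = cg L (g_lower t) (g t)"
proof -
  let ?K = "congruence_lattice L"
  have \<theta>: "lattice_congruence L \<theta>" and nl: "\<not> least ?K \<theta> (carrier ?K)"
    and irr: "\<And>\<phi> \<psi>. lattice_congruence L \<phi> \<Longrightarrow> lattice_congruence L \<psi> \<Longrightarrow> \<theta> = join ?K \<phi> \<psi> \<Longrightarrow> \<theta> = \<phi> \<or> \<theta> = \<psi>"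
    using assms by (auto simp: join_irreducibles_def congruence_lattice_def)
  define C where "C Y = \<Inter>{\<phi>. lattice_congruence L \<phi> \<and> (\<forall>t\<in>Y. (g_lower t, g t) \<in> \<phi>)}" for Y
  define X where "X = {t \<in> T. (g_lower t, g t) \<in> \<theta>}"
  have Cc: "lattice_congruence L (C Y)" if "Y \<subseteq> T" for Y
    unfolding C_def
  proof (rule congruence_Inter)
    have "(g_lower t, g t) \<in> carrier L \<times> carrier L" if "t \<in> Y" for t
      using g_lower(1) g_closed that \<open>Y \<subseteq> T\<close> by auto
    then show "{\<phi>. lattice_congruence L \<phi> \<and> (\<forall>t\<in>Y. (g_lower t, g t) \<in> \<phi>)} \<noteq> {}"
      using congruence_full by blast
  qed simp
  have Cm: "(g_lower t, g t) \<in> C Y" if "t \<in> Y" for t Y using that by (auto simp: C_def)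
  have Cl: "C Y \<subseteq> \<phi>" if "lattice_congruence L \<phi>" "\<And>t. t \<in> Y \<Longrightarrow> (g_lower t, g t) \<in> \<phi>" for Y \<phi>
    using that by (auto simp: C_def)
  have fX: "finite X" unfolding X_def using finite_T by simp
  have "\<theta> = C Y \<longrightarrow> (\<exists>t\<in>Y. \<theta> = cg L (g_lower t) (g t))" if "Y \<subseteq> T" "finite Y" for Y
    using that(2,1)
  proof (induction Y rule: finite_induct)
    case empty
    have "least ?K (C {}) (carrier ?K)"
      using Cl[of _ "{}"] Cc[of "{}"] by (auto simp: least_def congruence_lattice_def)
    then show ?case using nl by metis
  next
    case (insert t Y)
    let ?g = "cg L (g_lower t) (g t)"
    have t: "t \<in> T" and Y: "Y \<subseteq> T" using insert by auto
    have gc: "lattice_congruence L ?g" using cg_congruence g_lower g_closed t by blast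
    show ?case
    proof
      assume eq: "\<theta> = C (insert t Y)"
      have "C (insert t Y) = (C Y \<union> ?g)\<^sup>+"
      proof
        show "C (insert t Y) \<subseteq> (C Y \<union> ?g)\<^sup>+"
          by (rule Cl[OF congruence_trancl[OF Cc[OF Y] gc]]) (use Cm cg_mem in blast)
        have "C Y \<union> ?g \<subseteq> C (insert t Y)"
          using Cl[OF Cc[of "insert t Y"], of Y] Cm cg_least[OF Cc[of "insert t Y"]] insert.prems by blast
        moreover have "trans (C (insert t Y))"
          using congruence_trans[OF Cc[OF insert.prems]] by (auto intro: transI)
        ultimately show "(C Y \<union> ?g)\<^sup>+ \<subseteq> C (insert t Y)"
          using trancl_mono_subset[of "C Y \<union> ?g" "C (insert t Y)"] by simp
      qed
      then have "\<theta> = C Y \<or> \<theta> = ?g"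
        using irr[OF Cc[OF Y] gc] eq join_congruence_lattice[OF Cc[OF Y] gc] by simp
      then show "\<exists>t\<in>insert t Y. \<theta> = cg L (g_lower t) (g t)" using insert.IH[OF Y] by blast
    qed
  qed
  moreover have "\<theta> = C X"
  proof
    have XT: "X \<subseteq> T" by (auto simp: X_def)
    show "\<theta> \<subseteq> C X" by (rule congruence_le_of_generators[OF \<theta> Cc[OF XT]]) (use Cm in \<open>auto simp: X_def\<close>)
    show "C X \<subseteq> \<theta>" by (rule Cl[OF \<theta>]) (auto simp: X_def)
  qed
  moreover have "X \<subseteq> T" by (auto simp: X_def)
  ultimately show ?thesis using fX by blast
qed

lemma bij_cg_g: "bij_betw (\<lambda>t. cg L (g_lower t) (g t)) T (join_irreducibles (congruence_lattice L))"
proof (rule bij_betw_imageI[OF cg_g_inj], intro equalityI subsetI)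
  fix \<theta> assume "\<theta> \<in> (\<lambda>t. cg L (g_lower t) (g t)) ` T"
  then show "\<theta> \<in> join_irreducibles (congruence_lattice L)" using join_irreducible_cg by auto
next
  fix \<theta> assume "\<theta> \<in> join_irreducibles (congruence_lattice L)"
  from join_irreducible_congruence[OF this] show "\<theta> \<in> (\<lambda>t. cg L (g_lower t) (g t)) ` T" by auto
qed

section \<open>Covers and congruence uniformity\<close>

lemma lless_iff:
  assumes "x \<in> carrier L" "y \<in> carrier L"
  shows "lless L x y \<longleftrightarrow> A x \<subset> A y"
proof -
  have "x = y \<longleftrightarrow> A x = A y" using A_eqD[OF assms] by auto
  then show ?thesis using assms by (simp add: lless_def eq_L le_iff psubset_eq)
qed

lemma lower_star_g:
  assumes t: "t \<in> T"
  shows "lower_star L (g t) = g_lower t"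
  unfolding lower_star_def
proof (rule the_equality)
  show "covered_by L (g_lower t) (g t)"
    unfolding covered_by_def using g_lower[OF t] g_closed[OF t] g_mem[OF t]
    by (auto simp: lless_iff)
  fix x assume x: "covered_by L x (g t)"
  then have xc: "x \<in> carrier L" and lt: "A x \<subset> A (g t)"
    by (auto simp: covered_by_def lless_iff g_closed[OF t])
  then have "A x \<subseteq> A (g_lower t)" using g_least[OF xc] g_lower(2)[OF t] by blast
  moreover have "\<not> (lless L x (g_lower t) \<and> lless L (g_lower t) (g t))"
    using x g_lower(1)[OF t] unfolding covered_by_def by blast
  then have "\<not> (A x \<subset> A (g_lower t) \<and> A (g_lower t) \<subset> A (g t))"
    using xc g_lower(1)[OF t] g_closed[OF t] by (simp add: lless_iff)
  moreover have "A (g_lower t) \<subset> A (g t)" using g_lower(2)[OF t] g_mem[OF t] by blast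
  ultimately show "x = g_lower t" using A_eqD[OF xc g_lower(1)[OF t]] by blast
qed

lemma lower_star_dual_m:
  assumes t: "t \<in> T"
  shows "lower_star (inv_gorder L) (m t) = m_cover t"
proof -
  have cov: "covered_by (inv_gorder L) x y \<longleftrightarrow> covered_by L y x" for x y
    by (auto simp: covered_by_def lless_def eq_L)
  have lt: "A (m t) \<subset> A (m_cover t)" using m_le_m_cover mem_m_cover m_notin t by blast
  show ?thesis
    unfolding lower_star_def cov
  proof (rule the_equality)
    show "covered_by L (m t) (m_cover t)"
      unfolding covered_by_def using m_closed[OF t] m_cover_closed[OF t] lt above_m(2)[OF t]
      by (auto simp: lless_iff)
    fix x assume x: "covered_by L (m t) x"
    then have xc: "x \<in> carrier L" and ltx: "A (m t) \<subset> A x"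
      by (auto simp: covered_by_def lless_iff m_closed[OF t])
    then have "A (m_cover t) \<subseteq> A x" using above_m(2)[OF t] by blast
    moreover have "\<not> A (m_cover t) \<subset> A x"
      using x m_cover_closed[OF t] lt by (auto simp: covered_by_def lless_iff m_closed[OF t])
    ultimately show "x = m_cover t" using A_eqD xc m_cover_closed[OF t] by blast
  qed
qed

lemma congruence_uniform_L: "congruence_uniform L"
proof -
  have "bij_betw (\<lambda>j. cg L (lower_star L j) j) (g ` T) (join_irreducibles (congruence_lattice L))"
  proof (rule bij_betw_imageI)
    have *: "cg L (lower_star L (g t)) (g t) = cg L (g_lower t) (g t)" if "t \<in> T" for t
      using lower_star_g that by simp
    show "inj_on (\<lambda>j. cg L (lower_star L j) j) (g ` T)"
      using cg_g_inj * by (auto simp: inj_on_def)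
    show "(\<lambda>j. cg L (lower_star L j) j) ` g ` T = join_irreducibles (congruence_lattice L)"
      using bij_cg_g * by (auto simp: bij_betw_def image_image)
  qed
  moreover
  \<comment> \<open>Reversing the order exchanges the two halves of the compatibility condition, so
    the dual has the same congruences.\<close>
  have Keq: "congruence_lattice (inv_gorder L) = congruence_lattice L"
    and cgeq: "cg (inv_gorder L) = cg L"
    by (auto simp: congruence_lattice_def lattice_congruence_def cg_def fun_eq_iff)
  have Meq: "join_irreducibles (inv_gorder L) = m ` T"
    unfolding meet_irreducibles_eq[symmetric] join_irreducibles_def meet_irreducibles_def by simp
  have "bij_betw (\<lambda>j. cg L (lower_star (inv_gorder L) j) j) (m ` T) (join_irreducibles (congruence_lattice L))"
  proof (rule bij_betw_imageI)
    \<comment> \<open>In the dual, \<open>lower_star\<close> is the upper endpoint of the edge, so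
      the endpoints appear in the opposite order.\<close>
    have "cg L p q = cg L q p" for p q
      unfolding cg_def by (intro arg_cong[of _ _ Inter] Collect_cong) (auto intro: congruence_sym)
    then have *: "cg L (lower_star (inv_gorder L) (m t)) (m t) = cg L (g_lower t) (g t)" if "t \<in> T" for t
      using lower_star_dual_m cg_m that by metis
    show "inj_on (\<lambda>j. cg L (lower_star (inv_gorder L) j) j) (m ` T)"
      using cg_g_inj * by (auto simp: inj_on_def)
    show "(\<lambda>j. cg L (lower_star (inv_gorder L) j) j) ` m ` T = join_irreducibles (congruence_lattice L)"
      using bij_cg_g * by (auto simp: bij_betw_def image_image)
  qed
  ultimately show ?thesis
    unfolding congruence_uniform_def cg_bijective_def join_irreducibles_eq Meq Keq cgeq by blast
qed

section \<open>Semidistributivity\<close>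

lemma between_m:
  assumes t: "t \<in> T" and x: "x \<in> carrier L" "A x \<subseteq> A (m_cover t)" "\<not> A x \<subseteq> A (m t)"
  shows "t \<in> A x"
proof -
  \<comment> \<open>A minimal difference \<open>s\<close> between \<open>m t\<close> and
    \<open>x\<close> can only be \<open>t\<close>: it puts \<open>m s\<close> above
    \<open>m t\<close>, and not strictly, since otherwise \<open>m_cover t\<close>, hence
    \<open>x\<close> and with it \<open>s\<close>, would lie below \<open>m s\<close>.\<close>
  obtain s where s: "s \<in> T" "s \<in> A x" "s \<notin> A (m t)" "A (g s) \<subseteq> insert s (A (m t))"
    using minimal_difference[OF m_closed[OF t] x(1,3)] .
  have "A (m t) \<subseteq> A (m s)" using m_greatest[OF s(1) m_closed[OF t]] s by blast
  moreover have "\<not> A (m t) \<subset> A (m s)"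
    using above_m(2)[OF t m_closed[OF s(1)]] s(2) x(2) m_notin[OF s(1)] by blast
  ultimately have "m t = m s" using A_eqD[OF m_closed[OF t] m_closed[OF s(1)]] by blast
  then have "t = s" using inj_onD[OF m_inj] s(1) t by blast
  then show ?thesis using s(2) by simp
qed

lemma semidistributive_L: "semidistributive L"
proof -
  have 1: "join L p q = join L p (meet L q u)"
    if c: "p \<in> carrier L" "q \<in> carrier L" "u \<in> carrier L" and eq: "join L p q = join L p u" for p q u
  proof -
    let ?y = "join L p (meet L q u)"
    have mc: "meet L q u \<in> carrier L" using meet_mem c by blast
    have yc: "?y \<in> carrier L" "join L p q \<in> carrier L" using join_mem mc c by auto
    have le: "A ?y \<subseteq> A (join L p q)"
      using A_join_least[OF c(1) mc yc(2)] A_join_upper[OF c(1,2)] A_meet[OF c(2,3)] by blast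
    have "A (join L p q) \<subseteq> A ?y"
    proof (rule ccontr)
      assume n: "\<not> ?thesis"
      \<comment> \<open>A maximal \<open>z\<close> above \<open>?y\<close> and not above the join
        equals \<open>m t\<close> for a minimal difference \<open>t\<close>, and the join lies below
        \<open>m_cover t\<close>. Neither \<open>q\<close> nor \<open>u\<close> lies below
        \<open>z\<close>, so by \<open>between_m\<close> both contain \<open>t\<close>, and so does
        their meet: a contradiction.\<close>
      obtain z where z: "z \<in> carrier L" "A ?y \<subseteq> A z \<and> \<not> A (join L p q) \<subseteq> A z"
        and max: "\<And>w. w \<in> carrier L \<Longrightarrow> A ?y \<subseteq> A w \<and> \<not> A (join L p q) \<subseteq> A w \<Longrightarrow> A z \<subseteq> A w \<Longrightarrow> A w = A z"
        using exists_maximal[OF yc(1), where P = "\<lambda>w. A ?y \<subseteq> A w \<and> \<not> A (join L p q) \<subseteq> A w"] n by auto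
      obtain t where t: "t \<in> T" "t \<in> A (join L p q)" "t \<notin> A z" "A (g t) \<subseteq> insert t (A z)"
        using minimal_difference[OF z(1) yc(2)] z(2) by blast
      have "A z \<subseteq> A (m t)" using m_greatest t z(1) by blast
      then have "A (m t) = A z"
        using max[OF m_closed[OF t(1)]] z(2) m_notin[OF t(1)] t(2) by blast
      then have zm: "z = m t" using A_eqD z(1) m_closed[OF t(1)] by metis
      have up: "A (join L p q) \<subseteq> A (m_cover t)"
        using max[OF m_cover_closed[OF t(1)]] z(2) zm m_le_m_cover[OF t(1)] mem_m_cover[OF t(1)] t(3) by blast
      have p: "A p \<subseteq> A z" using z(2) A_join_upper[OF c(1) mc] by blast
      have "\<not> A q \<subseteq> A z" using A_join_least[OF c(1,2) z(1)] z(2) p by blast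
      moreover have "\<not> A u \<subseteq> A z" using A_join_least[OF c(1,3) z(1)] z(2) p eq by auto
      moreover have "A q \<subseteq> A (m_cover t)" "A u \<subseteq> A (m_cover t)"
        using up A_join_upper(2)[OF c(1,2)] A_join_upper(2)[OF c(1,3)] eq by auto
      ultimately have "t \<in> A q" "t \<in> A u" using between_m[OF t(1)] c zm by auto
      then have "t \<in> A ?y" using A_join_upper(2)[OF c(1) mc] A_meet[OF c(2,3)] by auto
      then show False using t(3) z(2) by blast
    qed
    with le show ?thesis using A_eqD yc by blast
  qed
  have 2: "meet L p q = meet L p (join L q u)"
    if c: "p \<in> carrier L" "q \<in> carrier L" "u \<in> carrier L" and eq: "meet L p q = meet L p u" for p q u
  proof -
    have mc: "meet L p q \<in> carrier L" "join L q u \<in> carrier L" using meet_mem join_mem c by auto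
    have Aeq: "A p \<inter> A q = A p \<inter> A u" using eq A_meet c by metis
    have "A (meet L p (join L q u)) \<subseteq> A (meet L p q)"
    proof (rule ccontr)
      assume "\<not> ?thesis"
      then obtain t where t0: "t \<in> T" "t \<in> A (meet L p (join L q u))" "t \<notin> A (meet L p q)"
        "A (g t) \<subseteq> insert t (A (meet L p q))"
        by (rule minimal_difference[OF mc(1) meet_mem[OF c(1) mc(2)]])
      then have t: "t \<in> T" "t \<in> A p" "t \<in> A (join L q u)" "t \<notin> A p \<inter> A q"
        "A (g t) \<subseteq> insert t (A p \<inter> A q)"
        using A_meet[OF c(1) mc(2)] A_meet[OF c(1,2)] by auto
      \<comment> \<open>Since \<open>p\<close> meets \<open>q\<close> and \<open>u\<close> in the
        same set, both contain \<open>A (g t)\<close> up to \<open>t\<close>; hence their join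
        cannot acquire \<open>t\<close>.\<close>
      have "t \<notin> A q" "t \<notin> A u" using t Aeq by auto
      then have "t \<notin> A (J q u)" using join_avoids[OF t(1) c(2,3)] t(5) Aeq by blast
      then show False using t(3) join_eq[OF c(2,3)] by simp
    qed
    moreover have "A (meet L p q) \<subseteq> A (meet L p (join L q u))"
      using A_meet[OF c(1) mc(2)] A_meet[OF c(1,2)] A_join_upper[OF c(2,3)] by auto
    ultimately show ?thesis using A_eqD mc meet_mem c by blast
  qed
  show ?thesis unfolding semidistributive_def using 1 2 by blast
qed

section \<open>Trimness\<close>

lemma chain_card:
  assumes "chain_in L D"
  shows "card D \<le> Suc (card T)"
proof -
  have D: "D \<subseteq> carrier L" using assms by (simp add: chain_in_def)
  have tot: "A x \<subseteq> A y \<or> A y \<subseteq> A x" if "x \<in> D" "y \<in> D" for x y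
  proof -
    have "le L x y \<or> le L y x" using assms that by (simp add: chain_in_def)
    then show ?thesis using that D by (simp add: le_iff subsetD)
  qed
  have "inj_on (\<lambda>x. card (A x)) D"
  proof (rule inj_onI)
    fix x y assume xy: "x \<in> D" "y \<in> D" "card (A x) = card (A y)"
    then have c: "x \<in> carrier L" "y \<in> carrier L" using D by auto
    from tot[OF xy(1,2)] have "A x = A y"
      using card_subset_eq[OF finite_A[OF c(2)], of "A x"] card_subset_eq[OF finite_A[OF c(1)], of "A y"] xy(3)
      by auto
    then show "x = y" by (rule A_eqD[OF c])
  qed
  moreover have "(\<lambda>x. card (A x)) ` D \<subseteq> {..card T}"
    using D A_sub finite_T by (auto intro: card_mono)
  ultimately have "card D \<le> card {..card T}" by (metis card_inj_on_le finite_atMost)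
  then show ?thesis by simp
qed

text \<open>A minimal difference \<open>t\<close> violating the equality would come after all of
  \<open>A p\<close> in the linear order. The initial segment before \<open>t\<close>, hence
  \<open>p\<close>, lies below \<open>m t\<close>, and so does \<open>u\<close>; then
  \<open>t\<close> could not belong to \<open>join L u p\<close>.\<close>

lemma left_modular_initial:
  assumes p: "p \<in> carrier L" and init: "\<And>s t. s \<in> A p \<Longrightarrow> t \<in> T \<Longrightarrow> r t \<le> r s \<Longrightarrow> t \<in> A p"
  shows "left_modular_element L p"
  unfolding left_modular_element_def
proof (intro conjI ballI impI)
  show "p \<in> carrier L" by fact
  fix q u assume q: "q \<in> carrier L" and u: "u \<in> carrier L" and "le L u q"
  then have uq: "A u \<subseteq> A q" by (simp add: le_iff)
  let ?y = "join L u (meet L p q)" and ?z = "meet L (join L u p) q"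
  have mc: "meet L p q \<in> carrier L" "join L u p \<in> carrier L" using meet_mem join_mem p q u by auto
  have yc: "?y \<in> carrier L" and zc: "?z \<in> carrier L" using mc meet_mem join_mem q u by auto
  have Az: "A ?z = A (join L u p) \<inter> A q" using A_meet mc q by blast
  have "A u \<subseteq> A ?z" "A (meet L p q) \<subseteq> A ?z"
    unfolding Az using A_join_upper[OF u p] A_meet[OF p q] uq by auto
  then have "A ?y \<subseteq> A ?z" using A_join_least[OF u mc(1) zc] by simp
  moreover have "A ?z \<subseteq> A ?y"
  proof (rule ccontr)
    assume "\<not> ?thesis"
    then obtain t where t: "t \<in> T" "t \<in> A ?z" "t \<notin> A ?y" "A (g t) \<subseteq> insert t (A ?y)"
      using minimal_difference[OF yc zc] by blast
    have "t \<notin> A p"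
      using t(2,3) Az A_join_upper(2)[OF u mc(1)] A_meet[OF p q] by auto
    then have below: "r s < r t" if "s \<in> A p" for s using init[OF that t(1)] by force
    obtain x where x: "x \<in> carrier L" "A x = {s \<in> T. r s < r t}"
      using initial_segment[of "{s \<in> T. r s < r t}"] by force
    have "A (g t) \<subseteq> insert t (A x)" 
      using A_g_rank[OF t(1)] A_sub[OF g_closed[OF t(1)]] unfolding x(2) by blast
    then have "A x \<subseteq> A (m t)" using m_greatest[OF t(1) x(1)] x(2) by blast
    then have "A p \<subseteq> A (m t)" using below A_sub[OF p] x(2) by blast
    moreover have "A u \<subseteq> A (m t)"
      using m_greatest[OF t(1) yc t(4) t(3)] A_join_upper(1)[OF u mc(1)] by blast
    ultimately have "A (join L u p) \<subseteq> A (m t)" using A_join_least[OF u p m_closed[OF t(1)]] by simp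
    then have "t \<in> A (m t)" using t(2) unfolding Az by (simp add: subsetD)
    then show False using m_notin[OF t(1)] by contradiction
  qed
  ultimately show "meet L (join L u p) q = join L u (meet L p q)" using A_eqD[OF zc yc] by simp
qed

lemma trim_L: "trim L"
proof -
  define f where "f t = (SOME x. x \<in> carrier L \<and> A x = {s \<in> T. r s \<le> r t})" for t
  have f: "f t \<in> carrier L" "A (f t) = {s \<in> T. r s \<le> r t}" for t
  proof -
    have "\<exists>x. x \<in> carrier L \<and> A x = {s \<in> T. r s \<le> r t}"
      using initial_segment[of "{s \<in> T. r s \<le> r t}"] by force
    from someI_ex[OF this] show "f t \<in> carrier L" "A (f t) = {s \<in> T. r s \<le> r t}"
      unfolding f_def by auto
  qed
  obtain b where b: "b \<in> carrier L" "A b = {}" using exists_bottom by blast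
  \<comment> \<open>The bottom is added separately because every segment \<open>f t\<close> with
    \<open>t \<in> T\<close> is nonempty; this accounts for the one element by which the chain
    exceeds \<open>T\<close>.\<close>
  define D where "D = insert b (f ` T)"
  have inj: "inj_on f T"
  proof (rule inj_onI)
    fix s t assume st: "s \<in> T" "t \<in> T" "f s = f t"
    then have "{u \<in> T. r u \<le> r s} = {u \<in> T. r u \<le> r t}" using f(2)[of s] f(2)[of t] by simp
    then have "r s \<le> r t" "r t \<le> r s" using st by blast+
    then show "s = t" using st r_inj by (simp add: inj_on_def)
  qed
  have "b \<notin> f ` T" using b f by auto
  then have card: "card D = Suc (card T)"
    unfolding D_def using inj finite_T by (simp add: card_image)
  have chain: "chain_in L D"
    unfolding chain_in_def D_def using b f by (auto simp: le_iff)
  have len: "lattice_length L = card T"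
    unfolding lattice_length_def
  proof (rule Max_eqI)
    have "{C. chain_in L C} \<subseteq> Pow (carrier L)" by (auto simp: chain_in_def)
    then have "finite {C. chain_in L C}" using finite_carrier by (simp add: finite_subset)
    then show "finite {card C - 1 |C. chain_in L C}" by simp
    show "y \<le> card T" if "y \<in> {card C - 1 |C. chain_in L C}" for y
    proof -
      obtain C where "y = card C - 1" "chain_in L C" using \<open>y \<in> _\<close> by blast
      then show ?thesis using chain_card[of C] by simp
    qed
    have "card T = card D - 1" using card by simp
    then show "card T \<in> {card C - 1 |C. chain_in L C}" using chain by blast
  qed
  have "maximal_chain_in L D"
    unfolding maximal_chain_in_def
  proof (intro conjI allI impI)
    show "chain_in L D" by (fact chain)
    fix E assume E: "chain_in L E \<and> D \<subseteq> E"
    then have "finite E" using finite_subset[OF _ finite_carrier] by (simp add: chain_in_def)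
    then show "E = D" using card_seteq[of E D] E chain_card[of E] card by simp
  qed
  moreover have "left_modular_element L p" if "p \<in> D" for p
  proof (rule left_modular_initial)
    show "p \<in> carrier L" using that b f unfolding D_def by auto
    show "t \<in> A p" if "s \<in> A p" "t \<in> T" "r t \<le> r s" for s t
      using \<open>p \<in> D\<close> that b f unfolding D_def by auto
  qed
  ultimately have "left_modular L" unfolding left_modular_def using card len by auto
  moreover have "extremal L"
    unfolding extremal_def join_irreducibles_eq meet_irreducibles_eq len
    by (simp add: card_image g_inj m_inj)
  ultimately show ?thesis by (simp add: trim_def)
qed

end

section \<open>Inversions of signed permutations\<close>

lemma pm_iff: "x \<in> pm n \<longleftrightarrow> x \<noteq> 0 \<and> - int n \<le> x \<and> x \<le> int n"
  by (auto simp: pm_def)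

lemma uminus_pm_iff [simp]: "- x \<in> pm n \<longleftrightarrow> x \<in> pm n"
  by (auto simp: pm_iff)

lemma finite_pm: "finite (pm n)"
  by (simp add: pm_def)

lemma hyperoct_permutes: "w \<in> hyperoct n \<Longrightarrow> w permutes pm n"
  by (simp add: hyperoct_def)

lemma hyperoct_odd: "w \<in> hyperoct n \<Longrightarrow> w (- x) = - w x"
proof (cases "x \<in> pm n")
  case False
  assume "w \<in> hyperoct n"
  then have "w x = x" "w (- x) = - x" using False by (auto simp: hyperoct_def permutes_def)
  then show ?thesis by simp
qed (simp add: hyperoct_def)

lemma hyperoct_pm: "w \<in> hyperoct n \<Longrightarrow> w x \<in> pm n \<longleftrightarrow> x \<in> pm n"
  using permutes_in_image[OF hyperoct_permutes] .

lemma hyperoct_eq_iff: "w \<in> hyperoct n \<Longrightarrow> w x = w y \<longleftrightarrow> x = y"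
  using permutes_inj[OF hyperoct_permutes] by (simp add: inj_eq)

lemma hyperoct_id: "id \<in> hyperoct n"
  by (simp add: hyperoct_def permutes_id)

lemma hyperoct_comp: "u \<in> hyperoct n \<Longrightarrow> v \<in> hyperoct n \<Longrightarrow> u \<circ> v \<in> hyperoct n"
proof -
  assume u: "u \<in> hyperoct n" and v: "v \<in> hyperoct n"
  have "(u \<circ> v) (- a) = - (u \<circ> v) a" for a
    using hyperoct_odd[OF u] hyperoct_odd[OF v] by simp
  then show ?thesis
    using permutes_compose[OF hyperoct_permutes[OF v] hyperoct_permutes[OF u]]
    unfolding hyperoct_def by blast
qed

lemma hyperoct_inv:
  assumes w: "w \<in> hyperoct n" shows "inv w \<in> hyperoct n"
proof -
  have "inv w (- a) = - inv w a" for a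
  proof -
    have "w (- inv w a) = - a"
      using hyperoct_odd[OF w] permutes_inverses(1)[OF hyperoct_permutes[OF w]] by simp
    then show ?thesis
      using permutes_inverses(2)[OF hyperoct_permutes[OF w]] by metis
  qed
  then show ?thesis using permutes_inv[OF hyperoct_permutes[OF w]] by (simp add: hyperoct_def)
qed

text \<open>One formula for both kinds of reflections: for \<open>c = - a\<close> it is the sign
  change at \<open>a\<close>.\<close>

definition signed_swap :: "int \<Rightarrow> int \<Rightarrow> int \<Rightarrow> int" where
  "signed_swap a c x = (if x = a then c else if x = c then a else if x = - a then - c
     else if x = - c then - a else x)"

lemma signed_swap_twice: "a \<noteq> 0 \<Longrightarrow> c \<noteq> 0 \<Longrightarrow> signed_swap a c (signed_swap a c x) = x"
  by (auto simp: signed_swap_def)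

lemma signed_swap_commute: "signed_swap a c = signed_swap c a"
  by (auto simp: signed_swap_def fun_eq_iff)

lemma signed_swap_uminus: "a \<noteq> 0 \<Longrightarrow> c \<noteq> 0 \<Longrightarrow> signed_swap (- c) (- a) = signed_swap a c"
  by (auto simp: signed_swap_def fun_eq_iff)

lemma signed_swap_hyperoct:
  assumes "a \<in> pm n" "c \<in> pm n"
  shows "signed_swap a c \<in> hyperoct n"
proof -
  have nz: "a \<noteq> 0" "c \<noteq> 0" using assms by (auto simp: pm_iff)
  have "signed_swap a c permutes pm n"
  proof (rule bij_imp_permutes)
    show "signed_swap a c x = x" if "x \<notin> pm n" for x
    proof -
      have "x \<noteq> a" "x \<noteq> c" "x \<noteq> - a" "x \<noteq> - c" using that assms by auto
      then show ?thesis by (simp add: signed_swap_def)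
    qed
    have sub: "signed_swap a c x \<in> pm n" if "x \<in> pm n" for x
      using that assms by (simp add: signed_swap_def)
    show "bij_betw (signed_swap a c) (pm n) (pm n)"
      by (rule bij_betwI[where g = "signed_swap a c"]) (auto simp: sub signed_swap_twice[OF nz])
  qed
  moreover have "signed_swap a c (- x) = - signed_swap a c x" for x
    using nz by (auto simp: signed_swap_def)
  ultimately show ?thesis by (simp add: hyperoct_def)
qed

text \<open>Conjugation by \<open>w\<close> carries the reflection at two positions to the
  reflection at their values, written here without inverses.\<close>

lemma comp_signed_swap:
  assumes w: "w \<in> hyperoct n"
  shows "w \<circ> signed_swap a c = signed_swap (w a) (w c) \<circ> w"
proof
  fix x
  have "w x = - w y \<longleftrightarrow> x = - y" for y
    using hyperoct_eq_iff[OF w, of x "- y"] hyperoct_odd[OF w] by simp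
  then show "(w \<circ> signed_swap a c) x = (signed_swap (w a) (w c) \<circ> w) x"
    by (simp add: signed_swap_def hyperoct_eq_iff[OF w] hyperoct_odd[OF w])
qed

text \<open>The generator \<open>s\<^sub>i\<close> exchanges \<open>low i\<close> and \<open>i + 1\<close>, so that \<open>s\<^sub>0\<close> needs no special treatment.\<close>

definition low :: "nat \<Rightarrow> int" where "low i = (if i = 0 then - 1 else int i)"

lemma simple_gen_eq: "simple_gen i = signed_swap (low i) (int i + 1)"
proof
  fix x
  show "simple_gen i x = signed_swap (low i) (int i + 1) x"
  proof (cases "i = 0")
    case True
    then show ?thesis by (simp add: simple_gen_def signed_swap_def low_def transpose_def)
  next
    case False
    then have pos: "int i > 0" by simp
    consider "x = int i" | "x = int i + 1" | "x = - int i" | "x = - int i - 1"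
      | "x \<notin> {int i, int i + 1, - int i, - int i - 1}" by blast
    then show ?thesis
      using False pos by cases (simp_all add: simple_gen_def signed_swap_def low_def transpose_def)
  qed
qed

lemma low_pm: "i < n \<Longrightarrow> low i \<in> pm n" "i < n \<Longrightarrow> int i + 1 \<in> pm n" "low i < int i + 1"
  by (auto simp: pm_iff low_def)

lemma simple_gen_hyperoct: "s \<in> simple_gens n \<Longrightarrow> s \<in> hyperoct n"
  by (auto simp: simple_gens_def simple_gen_eq intro!: signed_swap_hyperoct low_pm)

lemma simple_gen_inj: "simple_gen i = simple_gen j \<Longrightarrow> i = j"
proof -
  assume "simple_gen i = simple_gen j"
  then have "signed_swap (low i) (int i + 1) (int i + 1) = signed_swap (low j) (int j + 1) (int i + 1)"
    by (simp add: simple_gen_eq)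
  then show "i = j" by (auto simp: signed_swap_def low_def split: if_splits)
qed

section \<open>Words in the generators, exchange and length\<close>

definition word :: "(int \<Rightarrow> int) list \<Rightarrow> int \<Rightarrow> int" where
  "word ss = foldr (\<circ>) ss id"

lemma word_Nil: "word [] = id"
  by (simp add: word_def)

lemma word_Cons: "word (s # ss) = s \<circ> word ss"
  by (simp add: word_def)

lemma word_append: "word (us @ vs) = word us \<circ> word vs"
  by (induction us) (simp_all add: word_Nil word_Cons comp_assoc)

lemma word_hyperoct: "set ss \<subseteq> simple_gens n \<Longrightarrow> word ss \<in> hyperoct n"
proof (induction ss)
  case Nil
  show ?case unfolding word_Nil by (rule hyperoct_id)
next
  case (Cons s ss)
  then have "s \<in> hyperoct n" "word ss \<in> hyperoct n" using simple_gen_hyperoct by auto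
  then show ?case unfolding word_Cons by (rule hyperoct_comp)
qed

text \<open>A generator reverses only one pair of nonzero numbers, up to mirroring, so it is
  recognized as the reflection at any pair it reverses.\<close>

lemma simple_gen_inverts:
  assumes "p < q" "p \<noteq> 0" "q \<noteq> 0" "simple_gen i p > simple_gen i q"
  shows "simple_gen i = signed_swap p q"
proof -
  have "p = low i \<and> q = int i + 1 \<or> p = - int i - 1 \<and> q = - low i"
    using assms by (auto simp: simple_gen_eq signed_swap_def low_def split: if_splits)
  then show ?thesis
  proof
    assume "p = - int i - 1 \<and> q = - low i"
    then show ?thesis
      using signed_swap_uminus[of "low i" "int i + 1"] by (simp add: simple_gen_eq low_def)
  qed (simp add: simple_gen_eq)
qed

text \<open>The strong exchange condition. Some letter must reverse the images of \<open>a\<close>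
  and \<open>c\<close> under the suffix following it; this letter is the reflection at those images,
  so deleting it has the effect of multiplying by \<open>signed_swap a c\<close>.\<close>

lemma exchange:
  assumes "set ss \<subseteq> simple_gens n" "a \<in> pm n" "c \<in> pm n" "a < c" "word ss a > word ss c"
  shows "\<exists>us s vs. ss = us @ s # vs \<and> s \<circ> word vs = word vs \<circ> signed_swap a c"
  using assms
proof (induction ss)
  case Nil
  then show ?case by (simp add: word_Nil)
next
  case (Cons s ss)
  have ss: "set ss \<subseteq> simple_gens n" and s: "s \<in> simple_gens n" using Cons.prems by auto
  have h: "word ss \<in> hyperoct n" using word_hyperoct[OF ss] .
  show ?case
  proof (cases "word ss a > word ss c")
    case True
    from Cons.IH[OF ss Cons.prems(2-4) True] obtain us s' vs
      where "ss = us @ s' # vs" "s' \<circ> word vs = word vs \<circ> signed_swap a c" by blast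
    then have "s # ss = (s # us) @ s' # vs \<and> s' \<circ> word vs = word vs \<circ> signed_swap a c" by simp
    then show ?thesis by blast
  next
    case False
    obtain i where i: "s = simple_gen i" using s by (auto simp: simple_gens_def)
    have "word ss a < word ss c" using False Cons.prems(4) hyperoct_eq_iff[OF h, of a c] by simp
    moreover have "word ss a \<noteq> 0" "word ss c \<noteq> 0"
      using hyperoct_pm[OF h] Cons.prems(2,3) by (auto simp: pm_iff)
    moreover have "simple_gen i (word ss a) > simple_gen i (word ss c)" 
      using Cons.prems(5) unfolding i word_Cons comp_apply .
    ultimately have "s = signed_swap (word ss a) (word ss c)" using simple_gen_inverts i by blast
    then have "s \<circ> word ss = word ss \<circ> signed_swap a c" using comp_signed_swap[OF h] by simp
    then show ?thesis by (metis append_Nil)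
  qed
qed

text \<open>A termination measure for sorting: as in the rearrangement inequality, undoing a descent
  increases the sum of \<open>i * w i\<close>. The summand \<open>int n\<close> keeps the terms
  nonnegative.\<close>

definition defect :: "nat \<Rightarrow> (int \<Rightarrow> int) \<Rightarrow> int" where
  "defect n w = (\<Sum>i\<in>{1..int n}. i * (int n - w i))"

lemma defect_nonneg:
  assumes "w \<in> hyperoct n" shows "0 \<le> defect n w"
  unfolding defect_def
proof (rule sum_nonneg)
  fix i assume "i \<in> {1..int n}"
  moreover from this have "w i \<le> int n" using hyperoct_pm[OF assms, of i] by (simp add: pm_iff)
  ultimately show "0 \<le> i * (int n - w i)" by simp
qed

lemma defect_decreases:
  assumes w: "w \<in> hyperoct n" and i: "i < n" and d: "w (low i) > w (int i + 1)"
  shows "defect n (w \<circ> simple_gen i) < defect n w"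
proof -
  let ?s = "simple_gen i"
  have "defect n w - defect n (w \<circ> ?s) = (\<Sum>j\<in>{1..int n}. j * (w (?s j) - w j))"
    unfolding defect_def sum_subtractf[symmetric] by (rule sum.cong) (auto simp: algebra_simps)
  \<comment> \<open>Only positive positions enter the sum; of the positions moved by the generator
    these are \<open>i\<close> and \<open>i + 1\<close>, or just \<open>1\<close> when
    \<open>i = 0\<close>.\<close>
  also have "\<dots> = (\<Sum>j\<in>{low i, int i + 1} \<inter> {1..int n}. j * (w (?s j) - w j))"
    by (rule sum.mono_neutral_right) (auto simp: simple_gen_eq signed_swap_def low_def)
  also have "\<dots> > 0"
  proof (cases "i = 0")
    case True
    then have "{low i, int i + 1} \<inter> {1..int n} = {1}" using i by (auto simp: low_def)
    then show ?thesis using d True by (simp add: simple_gen_eq signed_swap_def low_def)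
  next
    case False
    then have "{low i, int i + 1} \<inter> {1..int n} = {int i, int i + 1}" using i by (auto simp: low_def)
    then show ?thesis using d False by (simp add: simple_gen_eq signed_swap_def low_def algebra_simps)
  qed
  finally show ?thesis by simp
qed

text \<open>The values at the positions from \<open>1\<close> to \<open>n\<close> are positive and
  increasing; counting up from \<open>1\<close> bounds them below, counting down from
  \<open>n\<close> bounds them above.\<close>

lemma no_descent_id:
  assumes w: "w \<in> hyperoct n" and d: "\<And>i. i < n \<Longrightarrow> w (low i) < w (int i + 1)"
  shows "w = id"
proof -
  have lower: "int i \<le> w (int i)" if "1 \<le> i" "i \<le> n" for i
    using that
  proof (induction i)
    case (Suc i)
    show ?case
    proof (cases "i = 0")
      case True
      then show ?thesis using d[of 0] Suc.prems hyperoct_odd[OF w, of 1] by (simp add: low_def)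
    next
      case False
      then show ?thesis using d[of i] Suc by (simp add: low_def add.commute)
    qed
  qed simp
  have upper: "w (int n - int k) \<le> int n - int k" if "k < n" for k
    using that
  proof (induction k)
    case 0
    then show ?case using hyperoct_pm[OF w, of "int n"] by (simp add: pm_iff)
  next
    case (Suc k)
    then have "w (low (n - Suc k)) < w (int (n - Suc k) + 1)" using d[of "n - Suc k"] by simp
    moreover have "int (n - Suc k) + 1 = int n - int k" "low (n - Suc k) = int n - int (Suc k)"
      using Suc.prems by (auto simp: low_def of_nat_diff)
    ultimately show ?case using Suc by simp
  qed
  have pos: "w x = x" if "0 < x" "x \<le> int n" for x
  proof -
    have "1 \<le> nat x" "nat x \<le> n" "nat (int n - x) < n" using that by auto
    with lower[of "nat x"] upper[of "nat (int n - x)"] that show ?thesis by simp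
  qed
  have "w x = x" for x
  proof (cases "x \<in> pm n")
    case True
    then show ?thesis using pos[of x] pos[of "- x"] hyperoct_odd[OF w, of x]
      by (cases "x > 0") (auto simp: pm_iff)
  next
    case False
    then show ?thesis using hyperoct_permutes[OF w] by (simp add: permutes_def)
  qed
  then show ?thesis by (simp add: fun_eq_iff)
qed

lemma hyperoct_word:
  assumes "w \<in> hyperoct n"
  shows "\<exists>ss. set ss \<subseteq> simple_gens n \<and> w = word ss"
  using assms
proof (induction "nat (defect n w)" arbitrary: w rule: less_induct)
  case less
  show ?case
  proof (cases "\<forall>i<n. w (low i) < w (int i + 1)")
    case True
    then have "w = word []" using no_descent_id[OF less.prems] by (simp add: word_Nil)
    then show ?thesis by (intro exI[of _ "[]"]) simp
  next
    case False
    then obtain i where i: "i < n" "\<not> w (low i) < w (int i + 1)" by blast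
    then have d: "w (low i) > w (int i + 1)"
      using hyperoct_eq_iff[OF less.prems, of "low i" "int i + 1"] low_pm(3)[of i] by simp
    have s: "simple_gen i \<in> simple_gens n" using i by (simp add: simple_gens_def)
    have h: "w \<circ> simple_gen i \<in> hyperoct n" using hyperoct_comp less.prems simple_gen_hyperoct[OF s] by blast
    have "nat (defect n (w \<circ> simple_gen i)) < nat (defect n w)"
      using defect_decreases[OF less.prems i(1) d] defect_nonneg[OF h] by simp
    from less.hyps[OF this h] obtain ss
      where ss: "set ss \<subseteq> simple_gens n" "w \<circ> simple_gen i = word ss" by blast
    have "simple_gen i \<circ> simple_gen i = id"
      using signed_swap_twice[of "low i" "int i + 1"] low_pm(1,2)[OF i(1)] by (auto simp: simple_gen_eq fun_eq_iff pm_iff)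
    then have "w = (w \<circ> simple_gen i) \<circ> simple_gen i" by (simp add: comp_assoc)
    then have "w = word (ss @ [simple_gen i])" using ss by (simp add: word_append word_Cons word_Nil)
    then show ?thesis using ss s by (intro exI[of _ "ss @ [simple_gen i]"]) simp
  qed
qed

lemma coxeter_length_word:
  assumes "w \<in> hyperoct n"
  obtains ss where "set ss \<subseteq> simple_gens n" "w = word ss" "length ss = coxeter_length n w"
proof -
  let ?P = "\<lambda>k. \<exists>ss. set ss \<subseteq> simple_gens n \<and> length ss = k \<and> w = foldr (\<circ>) ss id"
  have "\<exists>k. ?P k" using hyperoct_word[OF assms] unfolding word_def by blast
  then have "?P (coxeter_length n w)" unfolding coxeter_length_def by (rule LeastI_ex)
  then show thesis using that unfolding word_def by blast
qed

lemma coxeter_length_le: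
  "set ss \<subseteq> simple_gens n \<Longrightarrow> coxeter_length n (word ss) \<le> length ss"
  unfolding coxeter_length_def word_def by (rule Least_le) blast

lemma coxeter_length_swap_less:
  assumes w: "w \<in> hyperoct n" and ac: "a \<in> pm n" "c \<in> pm n" "a < c" and d: "w a > w c"
  shows "coxeter_length n (w \<circ> signed_swap a c) < coxeter_length n w"
proof -
  obtain ss where ss: "set ss \<subseteq> simple_gens n" "w = word ss" "length ss = coxeter_length n w"
    using coxeter_length_word[OF w] by blast
  from exchange[OF ss(1) ac] d ss(2) obtain us s vs
    where e: "ss = us @ s # vs" "s \<circ> word vs = word vs \<circ> signed_swap a c" by blast
  have "s \<in> simple_gens n" using ss(1) e(1) by simp
  then obtain i where i: "i < n" "s = simple_gen i" by (auto simp: simple_gens_def)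
  have inv: "s \<circ> s = id"
    using signed_swap_twice[of "low i" "int i + 1"] low_pm(1,2)[OF i(1)] i by (auto simp: simple_gen_eq fun_eq_iff pm_iff)
  have "w \<circ> signed_swap a c = word us \<circ> (s \<circ> (word vs \<circ> signed_swap a c))"
    unfolding ss(2) e(1) word_append word_Cons comp_assoc ..
  also have "\<dots> = word us \<circ> ((s \<circ> s) \<circ> word vs)" unfolding e(2)[symmetric] comp_assoc ..
  also have "\<dots> = word (us @ vs)" using inv by (simp add: word_append)
  finally have "coxeter_length n (w \<circ> signed_swap a c) \<le> length (us @ vs)"
    using coxeter_length_le[of "us @ vs" n] ss(1) e(1) by simp
  then show ?thesis using ss(3) e(1) by simp
qed

lemma coxeter_length_swap_greater:
  assumes w: "w \<in> hyperoct n" and ac: "a \<in> pm n" "c \<in> pm n" "a < c" and d: "w a < w c"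
  shows "coxeter_length n w < coxeter_length n (w \<circ> signed_swap a c)"
proof -
  have h: "w \<circ> signed_swap a c \<in> hyperoct n" using hyperoct_comp[OF w signed_swap_hyperoct[OF ac(1,2)]] .
  have "(w \<circ> signed_swap a c) a > (w \<circ> signed_swap a c) c" using d ac(3) by (simp add: signed_swap_def)
  from coxeter_length_swap_less[OF h ac this]
  have "coxeter_length n (w \<circ> (signed_swap a c \<circ> signed_swap a c)) < coxeter_length n (w \<circ> signed_swap a c)"
    unfolding comp_assoc .
  moreover have "signed_swap a c \<circ> signed_swap a c = id" using ac signed_swap_twice[of a c] by (auto simp: fun_eq_iff pm_iff)
  ultimately show ?thesis by simp
qed

lemma coxeter_length_swap_iff:
  assumes w: "w \<in> hyperoct n" and ac: "a \<in> pm n" "c \<in> pm n" "a < c"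
  shows "coxeter_length n (w \<circ> signed_swap a c) < coxeter_length n w \<longleftrightarrow> w c < w a"
    and "coxeter_length n w < coxeter_length n (w \<circ> signed_swap a c) \<longleftrightarrow> w a < w c"
proof -
  consider "w a < w c" | "w c < w a" using hyperoct_eq_iff[OF w, of a c] ac(3) by linarith
  note cs = this
  show "coxeter_length n (w \<circ> signed_swap a c) < coxeter_length n w \<longleftrightarrow> w c < w a"
    by (rule cs) (use coxeter_length_swap_less[OF assms] coxeter_length_swap_greater[OF assms] in linarith)+
  show "coxeter_length n w < coxeter_length n (w \<circ> signed_swap a c) \<longleftrightarrow> w a < w c"
    by (rule cs) (use coxeter_length_swap_less[OF assms] coxeter_length_swap_greater[OF assms] in linarith)+
qed

text \<open>Conjugates of generators are swaps by \<open>comp_signed_swap\<close>. In the other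
  direction, the exchange property applied to a word for the swap itself exhibits the swap as a
  conjugate of one of the letters.\<close>

lemma reflections_eq: "reflections n = {signed_swap a c | a c. a \<in> pm n \<and> c \<in> pm n \<and> a < c}"
proof (intro equalityI subsetI)
  fix t assume "t \<in> reflections n"
  then obtain w i where w: "w \<in> hyperoct n" and i: "i < n" and t: "t = w \<circ> simple_gen i \<circ> inv w"
    by (auto simp: reflections_def simple_gens_def)
  let ?a = "w (low i)" and ?c = "w (int i + 1)"
  have "t = signed_swap ?a ?c \<circ> (w \<circ> inv w)"
    unfolding t simple_gen_eq comp_signed_swap[OF w] by (simp add: comp_assoc)
  also have "w \<circ> inv w = id" using permutes_inv_o(1)[OF hyperoct_permutes[OF w]] .
  finally have t': "t = signed_swap ?a ?c" by simp
  have pm: "?a \<in> pm n" "?c \<in> pm n" using hyperoct_pm[OF w] low_pm(1,2)[OF i] by auto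
  have ne: "?a \<noteq> ?c" using hyperoct_eq_iff[OF w] low_pm(3)[of i] by auto
  show "t \<in> {signed_swap a c | a c. a \<in> pm n \<and> c \<in> pm n \<and> a < c}"
  proof (cases "?a < ?c")
    case True
    then show ?thesis using t' pm by blast
  next
    case False
    then have "?c < ?a" using ne by simp
    moreover have "t = signed_swap ?c ?a" using t' signed_swap_commute by simp
    ultimately show ?thesis using pm by blast
  qed
next
  fix t assume "t \<in> {signed_swap a c | a c. a \<in> pm n \<and> c \<in> pm n \<and> a < c}"
  then obtain a c where t: "t = signed_swap a c" and ac: "a \<in> pm n" "c \<in> pm n" "a < c" by blast
  obtain ss where ss: "set ss \<subseteq> simple_gens n" "signed_swap a c = word ss"
    using hyperoct_word[OF signed_swap_hyperoct[OF ac(1,2)]] by blast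
  have "signed_swap a c a > signed_swap a c c" using ac(3) by (simp add: signed_swap_def)
  then have "word ss a > word ss c" using ss(2) by simp
  from exchange[OF ss(1) ac this] obtain us s vs
    where e: "ss = us @ s # vs" "s \<circ> word vs = word vs \<circ> signed_swap a c" by blast
  let ?v = "word vs"
  have v: "?v \<in> hyperoct n" using word_hyperoct ss(1) e(1) by simp
  have "inv ?v \<circ> s \<circ> inv (inv ?v) = inv ?v \<circ> (?v \<circ> signed_swap a c)"
    unfolding e(2)[symmetric] inv_inv_eq[OF permutes_bij[OF hyperoct_permutes[OF v]]] comp_assoc ..
  also have "\<dots> = (inv ?v \<circ> ?v) \<circ> signed_swap a c" unfolding comp_assoc ..
  also have "inv ?v \<circ> ?v = id" using permutes_inv_o(2)[OF hyperoct_permutes[OF v]] .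
  finally have "t = inv ?v \<circ> s \<circ> inv (inv ?v)" unfolding t by (simp only: id_o)
  moreover have "s \<in> simple_gens n" using ss(1) e(1) by simp
  ultimately show "t \<in> reflections n"
    using hyperoct_inv[OF v] unfolding reflections_def by blast
qed

text \<open>A reflection appears as both \<open>(a, c)\<close> and \<open>(- c, - a)\<close>, which
  coincide for sign changes. This redundancy lets transitivity work on pairs as it does for ordinary
  permutations.\<close>

definition inversions :: "nat \<Rightarrow> (int \<Rightarrow> int) \<Rightarrow> (int \<times> int) set" where
  "inversions n w = {(a, c). a \<in> pm n \<and> c \<in> pm n \<and> a < c \<and> w c < w a}"

lemma weak_le_iff:
  assumes u: "u \<in> hyperoct n" and v: "v \<in> hyperoct n"
  shows "weak_le n u v \<longleftrightarrow> inversions n u \<subseteq> inversions n v"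
proof
  assume le: "weak_le n u v"
  show "inversions n u \<subseteq> inversions n v"
  proof (rule subrelI)
    fix a c assume "(a, c) \<in> inversions n u"
    then have ac: "a \<in> pm n" "c \<in> pm n" "a < c" and d: "u c < u a" by (auto simp: inversions_def)
    have "signed_swap a c \<in> reflections n" unfolding reflections_eq using ac by blast
    then have "signed_swap a c \<in> Inv n u" using d coxeter_length_swap_iff(1)[OF u ac] by (simp add: Inv_def)
    then have "signed_swap a c \<in> Inv n v" using le by (auto simp: weak_le_def)
    then show "(a, c) \<in> inversions n v"
      using coxeter_length_swap_iff(1)[OF v ac] ac by (simp add: Inv_def inversions_def)
  qed
next
  assume le: "inversions n u \<subseteq> inversions n v"
  show "weak_le n u v"
    unfolding weak_le_def
  proof
    fix t assume t: "t \<in> Inv n u"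
    then obtain a c where tt: "t = signed_swap a c" and ac: "a \<in> pm n" "c \<in> pm n" "a < c"
      by (auto simp: Inv_def reflections_eq)
    then have "(a, c) \<in> inversions n u"
      using t coxeter_length_swap_iff(1)[OF u ac] by (simp add: Inv_def inversions_def)
    then have "v c < v a" using le by (auto simp: inversions_def)
    then show "t \<in> Inv n v"
      using t tt coxeter_length_swap_iff(1)[OF v ac] by (simp add: Inv_def)
  qed
qed

lemma quotient_reps_iff:
  "w \<in> quotient_reps n \<alpha> \<longleftrightarrow> w \<in> hyperoct n \<and>
     (\<forall>i<n. simple_gen i \<notin> J_gens \<alpha> \<longrightarrow> w (low i) < w (int i + 1))"
proof (cases "w \<in> hyperoct n")
  case True
  have *: "coxeter_length n w < coxeter_length n (w \<circ> simple_gen i) \<longleftrightarrow> w (low i) < w (int i + 1)" if "i < n" for i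
    unfolding simple_gen_eq by (rule coxeter_length_swap_iff(2)[OF True low_pm(1)[OF that] low_pm(2)[OF that] low_pm(3)])
  have "w \<in> quotient_reps n \<alpha> \<longleftrightarrow> (\<forall>i<n. simple_gen i \<notin> J_gens \<alpha> \<longrightarrow>
      coxeter_length n w < coxeter_length n (w \<circ> simple_gen i))"
    using True by (auto simp only: quotient_reps_def simple_gens_def mem_Collect_eq Ball_def
        Diff_iff image_iff Bex_def atLeastLessThan_iff le0)
  with True * show ?thesis by simp
qed (simp add: quotient_reps_def)

section \<open>Consecutive values and reconstruction from inversion sets\<close>

lemma succ_pm_gr: "v < succ_pm v"
  by (simp add: succ_pm_def)

lemma succ_pm_least: "v < w \<Longrightarrow> w \<noteq> 0 \<Longrightarrow> succ_pm v \<le> w"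
  by (simp add: succ_pm_def)

lemma succ_pm_pm: "v \<in> pm n \<Longrightarrow> w \<in> pm n \<Longrightarrow> v < w \<Longrightarrow> succ_pm v \<in> pm n"
  by (auto simp: succ_pm_def pm_iff)

lemma inversions_iff:
  "(a, c) \<in> inversions n w \<longleftrightarrow> a \<in> pm n \<and> c \<in> pm n \<and> a < c \<and> w c < w a"
  by (simp add: inversions_def)

lemma inversions_uminus:
  "w \<in> hyperoct n \<Longrightarrow> (- c, - a) \<in> inversions n w \<longleftrightarrow> (a, c) \<in> inversions n w"
  by (auto simp: inversions_iff hyperoct_odd)

lemma trans_inversions: "trans (inversions n w)"
  by (rule transI) (auto simp: inversions_iff)

text \<open>Equal inversion sets mean that \<open>x\<close> and \<open>y\<close> order any two
  positions alike, so \<open>x \<circ> inv y\<close> has no descents.\<close>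

lemma inversions_inj:
  assumes x: "x \<in> hyperoct n" and y: "y \<in> hyperoct n" and eq: "inversions n x = inversions n y"
  shows "x = y"
proof -
  let ?w = "x \<circ> inv y"
  have iy: "inv y \<in> hyperoct n" using hyperoct_inv[OF y] .
  have w: "?w \<in> hyperoct n" using hyperoct_comp[OF x iy] .
  have "?w (low i) < ?w (int i + 1)" if i: "i < n" for i
  proof -
    let ?a = "inv y (low i)" and ?b = "inv y (int i + 1)"
    have pm: "?a \<in> pm n" "?b \<in> pm n" using hyperoct_pm[OF iy] low_pm(1,2)[OF i] by auto
    have lt: "y ?a < y ?b"
      using permutes_inverses(1)[OF hyperoct_permutes[OF y]] low_pm(3)[of i] by simp
    then have "?a \<noteq> ?b" by auto
    then consider "?a < ?b" | "?b < ?a" by linarith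
    then have "x ?a < x ?b"
    proof cases
      case 1
      have "(?a, ?b) \<notin> inversions n y" using lt by (simp add: inversions_iff)
      then have "(?a, ?b) \<notin> inversions n x" using eq by simp
      then have "\<not> x ?b < x ?a" using pm 1 by (simp add: inversions_iff)
      then show ?thesis using hyperoct_eq_iff[OF x, of ?a ?b] 1 by simp
    next
      case 2
      have "(?b, ?a) \<in> inversions n y" using lt pm 2 by (simp add: inversions_iff)
      then have "(?b, ?a) \<in> inversions n x" using eq by simp
      then show ?thesis by (simp add: inversions_iff)
    qed
    then show ?thesis by simp
  qed
  from no_descent_id[OF w this] have "?w = id" .
  then have "(x \<circ> inv y) (y a) = y a" for a by simp
  then have "x a = y a" for a using permutes_inverses(2)[OF hyperoct_permutes[OF y]] by simp
  then show ?thesis by (rule ext)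
qed

lemma card_pm: "card (pm n) = 2 * n"
  by (simp add: pm_def card_Diff_singleton)

text \<open>A transitive and co-transitive set prescribes a total order on \<open>pm n\<close>;
  ranking the positions gives the permutation, and the symmetry of \<open>S\<close> makes it
  odd.\<close>

lemma biclosed_realization:
  assumes S: "\<And>a c. (a, c) \<in> S \<Longrightarrow> a \<in> pm n \<and> c \<in> pm n \<and> a < c"
    and sym: "\<And>a c. (a, c) \<in> S \<Longrightarrow> (- c, - a) \<in> S"
    and tr: "\<And>a b c. (a, b) \<in> S \<Longrightarrow> (b, c) \<in> S \<Longrightarrow> (a, c) \<in> S"
    and cotr: "\<And>a b c. (a, c) \<in> S \<Longrightarrow> b \<in> pm n \<Longrightarrow> a < b \<Longrightarrow> b < c \<Longrightarrow> (a, b) \<in> S \<or> (b, c) \<in> S"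
  obtains x where "x \<in> hyperoct n" "inversions n x = S"
proof -
  define prec where "prec a c \<longleftrightarrow> a \<in> pm n \<and> c \<in> pm n \<and> (a < c \<and> (a, c) \<notin> S \<or> c < a \<and> (c, a) \<in> S)" for a c
  have prec_pm: "a \<in> pm n" "c \<in> pm n" if "prec a c" for a c using that by (auto simp: prec_def)
  have irrefl: "\<not> prec a a" for a by (simp add: prec_def)
  have asym: "\<not> prec c a" if "prec a c" for a c using that by (auto simp: prec_def)
  have total: "prec a c \<or> prec c a" if "a \<in> pm n" "c \<in> pm n" "a \<noteq> c" for a c
    using that by (auto simp: prec_def)
  have prec_trans: "prec a c" if ab: "prec a b" and bc: "prec b c" for a b c
  proof -
    have pm: "a \<in> pm n" "b \<in> pm n" "c \<in> pm n" using prec_pm[OF ab] prec_pm[OF bc] by auto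
    have ne: "a \<noteq> b" "b \<noteq> c" "a \<noteq> c" using ab bc irrefl asym by blast+
    \<comment> \<open>Each of the six relative orders is one instance of transitivity or of
      co-transitivity.\<close>
    consider "a < b" "b < c" | "a < c" "c < b" | "b < a" "a < c" | "b < c" "c < a" | "c < a" "a < b" | "c < b" "b < a"
      using ne by linarith
    then show ?thesis
    proof cases
      case 1
      then show ?thesis using ab bc cotr[of a c b] pm by (auto simp: prec_def)
    next
      case 2
      then show ?thesis using ab bc tr[of a c b] pm by (auto simp: prec_def)
    next
      case 3
      then show ?thesis using ab bc tr[of b a c] pm by (auto simp: prec_def)
    next
      case 4
      then show ?thesis using ab bc cotr[of b a c] pm by (auto simp: prec_def)
    next
      case 5
      then show ?thesis using ab bc cotr[of c b a] pm by (auto simp: prec_def)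
    next
      case 6
      then show ?thesis using ab bc tr[of c b a] pm by (auto simp: prec_def)
    qed
  qed
  have sym_iff: "(- c, - a) \<in> S \<longleftrightarrow> (a, c) \<in> S" for a c using sym[of a c] sym[of "- c" "- a"] by auto
  have prec_uminus: "prec (- c) (- a) \<longleftrightarrow> prec a c" for a c
    unfolding prec_def using sym_iff[of a c] sym_iff[of c a] by auto
  define D where "D a = card {b. prec b a}" for a
  have fin: "finite {b. prec b a}" "finite {b. prec a b}" for a
    using finite_subset[OF _ finite_pm[of n]] prec_pm by (metis mem_Collect_eq subsetI)+
  have D_less: "D a < D c" if "prec a c" for a c
    unfolding D_def
  proof (rule psubset_card_mono[OF fin(1)])
    have "{b. prec b a} \<subseteq> {b. prec b c}" using prec_trans that by blast
    moreover have "a \<in> {b. prec b c}" "a \<notin> {b. prec b a}" using that irrefl by auto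
    ultimately show "{b. prec b a} \<subset> {b. prec b c}" by blast
  qed
  have D_less_iff: "D a < D c \<longleftrightarrow> prec a c" if "a \<in> pm n" "c \<in> pm n" for a c
    using D_less[of a c] D_less[of c a] total[OF that] by (cases "a = c") auto
  have D_uminus: "D (- a) + D a + 1 = 2 * n" if "a \<in> pm n" for a
  proof -
    have "{b. prec b (- a)} = uminus ` {b. prec a b}"
    proof (intro equalityI subsetI)
      fix b assume "b \<in> {b. prec b (- a)}"
      then have "prec a (- b)" using prec_uminus[of "- b" a] by simp
      then show "b \<in> uminus ` {b. prec a b}" by (intro image_eqI[of _ _ "- b"]) auto
    next
      fix b assume "b \<in> uminus ` {b. prec a b}"
      then show "b \<in> {b. prec b (- a)}" using prec_uminus by auto
    qed
    then have 1: "D (- a) = card {b. prec a b}" unfolding D_def by (simp add: card_image)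
    have "pm n = insert a ({b. prec a b} \<union> {b. prec b a})"
      using total that prec_pm by blast
    moreover have "a \<notin> {b. prec a b} \<union> {b. prec b a}" using irrefl by simp
    ultimately have "card (pm n) = Suc (card ({b. prec a b} \<union> {b. prec b a}))"
      using fin by simp
    also have "card ({b. prec a b} \<union> {b. prec b a}) = card {b. prec a b} + card {b. prec b a}"
      by (rule card_Un_disjoint[OF fin(2) fin(1)]) (use asym in blast)
    finally show ?thesis using 1 by (simp add: D_def card_pm)
  qed
  \<comment> \<open>The ranks \<open>D a\<close> run from \<open>0\<close> to
    \<open>2 * n - 1\<close>; the extra \<open>1\<close> in the upper half makes the values skip
    \<open>0\<close>.\<close>
  define x where "x a = (if a \<in> pm n then (if D a < n then int (D a) - int n else int (D a) - int n + 1) else a)" for a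
  have x_pm: "x a \<in> pm n" if "a \<in> pm n" for a
    using D_uminus[OF that] that by (auto simp: x_def pm_iff)
  have x_less: "x a < x c \<longleftrightarrow> prec a c" if "a \<in> pm n" "c \<in> pm n" for a c
    using D_less_iff[OF that] that by (auto simp: x_def)
  have x_inj: "inj_on x (pm n)"
  proof (rule inj_onI, rule ccontr)
    fix a c assume ac: "a \<in> pm n" "c \<in> pm n" "x a = x c" "a \<noteq> c"
    then have "prec a c \<or> prec c a" using total by blast
    then show False using x_less[OF ac(1,2)] x_less[OF ac(2,1)] ac(3) by auto
  qed
  have "x ` pm n \<subseteq> pm n" using x_pm by auto
  then have "bij_betw x (pm n) (pm n)"
    using x_inj endo_inj_surj[OF finite_pm] by (simp add: bij_betw_def)
  then have "x permutes pm n" by (rule bij_imp_permutes) (simp add: x_def)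
  moreover have "x (- a) = - x a" if "a \<in> pm n" for a
    using D_uminus[OF that] that by (auto simp: x_def)
  ultimately have hx: "x \<in> hyperoct n" by (simp add: hyperoct_def)
  have "(a, c) \<in> inversions n x \<longleftrightarrow> (a, c) \<in> S" for a c
  proof (cases "a \<in> pm n \<and> c \<in> pm n \<and> a < c")
    case True
    then have "(a, c) \<in> inversions n x \<longleftrightarrow> prec c a" using x_less[of c a] by (simp add: inversions_iff)
    also have "\<dots> \<longleftrightarrow> (a, c) \<in> S" using True by (auto simp: prec_def)
    finally show ?thesis .
  next
    case False
    then show ?thesis using S[of a c] by (auto simp: inversions_iff)
  qed
  then have "inversions n x = S" by auto
  with hx show thesis using that by blast
qed

text \<open>Among the positions from \<open>c\<close> on with values between \<open>x c\<close> and
  \<open>x a\<close>, take \<open>k\<close> with the largest value. The next value cannot occur from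
  \<open>c\<close> on by maximality, nor strictly between \<open>a\<close> and \<open>c\<close> by
  the gap condition, so it occurs at some \<open>i \<le> a\<close>.\<close>

lemma close_descent:
  assumes x: "x \<in> hyperoct n" and ac: "(a, c) \<in> inversions n x"
    and gap: "\<And>b. b \<in> pm n \<Longrightarrow> a < b \<Longrightarrow> b < c \<Longrightarrow> x c < x b \<Longrightarrow> x b < x a \<Longrightarrow> False"
  obtains i k where "i \<in> pm n" "k \<in> pm n" "i \<le> a" "c \<le> k" "x i = succ_pm (x k)" "x c \<le> x k" "x i \<le> x a"
proof -
  have pm: "a \<in> pm n" "c \<in> pm n" and lt: "a < c" "x c < x a" using ac by (auto simp: inversions_iff)
  define V where "V = {k \<in> pm n. c \<le> k \<and> x c \<le> x k \<and> x k \<le> x a}"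
  have "finite (x ` V)" "x ` V \<noteq> {}" using finite_pm pm lt by (auto simp: V_def)
  from Max_in[OF this] obtain k where k: "k \<in> V" "x k = Max (x ` V)" by auto
  have max: "x j \<le> x k" if "j \<in> V" for j
    using Max_ge[OF \<open>finite (x ` V)\<close>, of "x j"] that k(2) by auto
  have kV: "k \<in> pm n" "c \<le> k" "x c \<le> x k" "x k \<le> x a" using k(1) by (auto simp: V_def)
  have "x k \<noteq> x a" using hyperoct_eq_iff[OF x, of k a] kV(2) lt(1) by auto
  then have ka: "x k < x a" using kV(4) by simp
  have xk: "x k \<in> pm n" "x a \<in> pm n" using hyperoct_pm[OF x] kV(1) pm by auto
  have sp: "succ_pm (x k) \<in> pm n" using succ_pm_pm[OF xk ka] .
  define i where "i = inv x (succ_pm (x k))"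
  have xi: "x i = succ_pm (x k)" unfolding i_def
    using permutes_inverses(1)[OF hyperoct_permutes[OF x]] .
  have i_pm: "i \<in> pm n" using hyperoct_pm[OF x, of i] sp xi by simp
  have xia: "x i \<le> x a" using succ_pm_least[OF ka] xk(2) xi by (simp add: pm_iff)
  have xki: "x k < x i" using succ_pm_gr xi by simp
  have "\<not> c \<le> i" using max[of i] i_pm xia xki kV(3) by (auto simp: V_def)
  moreover have "i \<le> a"
  proof (rule ccontr)
    assume "\<not> i \<le> a"
    moreover from this have "x i \<noteq> x a" using hyperoct_eq_iff[OF x, of i a] by auto
    ultimately show False using gap[OF i_pm] \<open>\<not> c \<le> i\<close> xia xki kV(3) by simp
  qed
  ultimately show thesis using that[OF i_pm kV(1) _ kV(2) xi kV(3) xia] by blast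
qed

definition opp :: "(int \<times> int) set \<Rightarrow> (int \<times> int) set" where
  "opp S = {(a, c). (- c, - a) \<in> S}"

lemma opp_iff: "(a, c) \<in> opp S \<longleftrightarrow> (- c, - a) \<in> S"
  by (simp add: opp_def)

section \<open>Avoiders for a block function\<close>

text \<open>Only the order and the symmetry of the block numbering enter from here on; compositions
  return at the end.\<close>

locale signed_blocks =
  fixes n :: nat and \<beta> :: "int \<Rightarrow> int"
  assumes odd_block: "\<beta> (- a) = - \<beta> a"
    and mono_block: "a \<le> c \<Longrightarrow> \<beta> a \<le> \<beta> c"
begin

lemma less_of_block: "\<beta> a < \<beta> c \<Longrightarrow> a < c"
  using mono_block[of c a] by linarith

text \<open>
  Closing the forbidden patterns under negation, a middle position \<open>j\<close> is forbidden either to be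
  the top of a \<open>231\<close> or to be the bottom of a \<open>312\<close>; \<open>up\<close> singles out the first kind. The central
  block of a join composition (\<open>\<beta> = 0\<close>) contains positions of both kinds.
\<close>

definition up :: "int \<Rightarrow> bool" where
  "up b \<longleftrightarrow> \<beta> b > 0 \<or> \<beta> b = 0 \<and> b < 0"

lemma up_uminus: "b \<noteq> 0 \<Longrightarrow> up (- b) \<longleftrightarrow> \<not> up b"
  by (auto simp: up_def odd_block)

definition pairs :: "(int \<times> int) set" where
  "pairs = {(a, c). a \<in> pm n \<and> c \<in> pm n \<and> \<beta> a < \<beta> c}"

lemma pairs_iff: "(a, c) \<in> pairs \<longleftrightarrow> a \<in> pm n \<and> c \<in> pm n \<and> \<beta> a < \<beta> c"
  by (simp add: pairs_def)

lemma pairs_less: "(a, c) \<in> pairs \<Longrightarrow> a < c"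
  by (simp add: pairs_iff less_of_block)

lemma pairs_uminus: "(- c, - a) \<in> pairs \<longleftrightarrow> (a, c) \<in> pairs"
  by (auto simp: pairs_iff odd_block)

definition block_increasing :: "(int \<Rightarrow> int) set" where
  "block_increasing = {w \<in> hyperoct n. \<forall>a\<in>pm n. \<forall>c\<in>pm n. a < c \<longrightarrow> \<beta> a = \<beta> c \<longrightarrow> w a < w c}"

lemma block_increasing_iff:
  "w \<in> block_increasing \<longleftrightarrow> w \<in> hyperoct n \<and> inversions n w \<subseteq> pairs"
proof
  assume w: "w \<in> block_increasing"
  have "inversions n w \<subseteq> pairs"
  proof (rule subrelI)
    fix a c assume ac: "(a, c) \<in> inversions n w"
    then have "\<beta> a \<noteq> \<beta> c" using w by (force simp: block_increasing_def inversions_iff)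
    moreover have "\<beta> a \<le> \<beta> c" using ac mono_block[of a c] by (simp add: inversions_iff)
    ultimately show "(a, c) \<in> pairs" using ac by (simp add: inversions_iff pairs_iff)
  qed
  then show "w \<in> hyperoct n \<and> inversions n w \<subseteq> pairs" using w by (simp add: block_increasing_def)
next
  assume w: "w \<in> hyperoct n \<and> inversions n w \<subseteq> pairs"
  have "w a < w c" if "a \<in> pm n" "c \<in> pm n" "a < c" "\<beta> a = \<beta> c" for a c
  proof (rule ccontr)
    assume "\<not> w a < w c"
    moreover have "w a \<noteq> w c" using hyperoct_eq_iff[of w n a c] w that by simp
    ultimately have "(a, c) \<in> inversions n w" using that by (simp add: inversions_iff)
    then have "(a, c) \<in> pairs" using w by blast
    then show False using that by (simp add: pairs_iff)
  qed
  then show "w \<in> block_increasing" using w by (simp add: block_increasing_def)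
qed

definition avoiders :: "(int \<Rightarrow> int) set" where
  "avoiders = {x \<in> block_increasing. \<forall>i\<in>pm n. \<forall>j\<in>pm n. \<forall>k\<in>pm n.
     \<beta> i < \<beta> j \<longrightarrow> \<beta> j < \<beta> k \<longrightarrow> x i = succ_pm (x k) \<longrightarrow>
       (up j \<longrightarrow> x j < x i) \<and> (\<not> up j \<longrightarrow> x k < x j)}"

lemma avoiders_hyperoct: "x \<in> avoiders \<Longrightarrow> x \<in> hyperoct n"
  by (simp add: avoiders_def block_increasing_def)

lemma avoiders_pairs: "x \<in> avoiders \<Longrightarrow> inversions n x \<subseteq> pairs"
  using block_increasing_iff by (simp add: avoiders_def)

lemma avoiders_increasing:
  "x \<in> avoiders \<Longrightarrow> a \<in> pm n \<Longrightarrow> c \<in> pm n \<Longrightarrow> a \<le> c \<Longrightarrow> \<beta> a = \<beta> c \<Longrightarrow> x a \<le> x c"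
  by (cases "a = c") (force simp: avoiders_def block_increasing_def)+

lemma avoidersD:
  assumes "x \<in> avoiders" "i \<in> pm n" "j \<in> pm n" "k \<in> pm n" "\<beta> i < \<beta> j" "\<beta> j < \<beta> k" "x i = succ_pm (x k)"
  shows "up j \<Longrightarrow> x j < x i" "\<not> up j \<Longrightarrow> x k < x j"
  using assms by (simp_all add: avoiders_def)

text \<open>
  Avoidance imposed on all inversions and not only on descents. This is stronger than being an
  avoider: when the block of the middle position \<open>b\<close> has several positions, avoiders may violate it.
\<close>

definition aligned :: "(int \<times> int) set \<Rightarrow> bool" where
  "aligned S \<longleftrightarrow> (\<forall>i k b. (i, k) \<in> S \<longrightarrow> b \<in> pm n \<longrightarrow> i < b \<longrightarrow> b < k \<longrightarrow>
     (\<beta> b \<noteq> \<beta> k \<longrightarrow> \<beta> b = \<beta> i \<or> \<not> up b \<longrightarrow> (b, k) \<in> S) \<and>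
     (\<beta> b \<noteq> \<beta> i \<longrightarrow> \<beta> b = \<beta> k \<or> up b \<longrightarrow> (i, b) \<in> S))"

lemma aligned_left:
  "aligned S \<Longrightarrow> (i, k) \<in> S \<Longrightarrow> b \<in> pm n \<Longrightarrow> i < b \<Longrightarrow> b < k \<Longrightarrow> \<beta> b \<noteq> \<beta> k \<Longrightarrow>
   \<beta> b = \<beta> i \<or> \<not> up b \<Longrightarrow> (b, k) \<in> S"
  unfolding aligned_def by blast

lemma aligned_right:
  "aligned S \<Longrightarrow> (i, k) \<in> S \<Longrightarrow> b \<in> pm n \<Longrightarrow> i < b \<Longrightarrow> b < k \<Longrightarrow> \<beta> b \<noteq> \<beta> i \<Longrightarrow>
   \<beta> b = \<beta> k \<or> up b \<Longrightarrow> (i, b) \<in> S"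
  unfolding aligned_def by blast

lemma alignedI:
  assumes sym: "\<And>a c. (a, c) \<in> S \<Longrightarrow> (- c, - a) \<in> S"
    and left: "\<And>i k b. (i, k) \<in> S \<Longrightarrow> b \<in> pm n \<Longrightarrow> i < b \<Longrightarrow> b < k \<Longrightarrow> \<beta> b \<noteq> \<beta> k \<Longrightarrow>
       \<beta> b = \<beta> i \<or> \<not> up b \<Longrightarrow> (b, k) \<in> S"
  shows "aligned S"
  unfolding aligned_def
proof (intro allI impI conjI)
  fix i k b assume *: "(i, k) \<in> S" "b \<in> pm n" "i < b" "b < k"
  show "(b, k) \<in> S" if "\<beta> b \<noteq> \<beta> k" "\<beta> b = \<beta> i \<or> \<not> up b" using left[OF *] that by blast
  show "(i, b) \<in> S" if ne: "\<beta> b \<noteq> \<beta> i" and ub: "\<beta> b = \<beta> k \<or> up b"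
  proof -
    have "b \<noteq> 0" using *(2) by (simp add: pm_iff)
    then have "(- b, - i) \<in> S"
      using left[OF sym[OF *(1)], of "- b"] * ne ub by (auto simp: odd_block up_uminus)
    then show ?thesis using sym[of "- b" "- i"] by simp
  qed
qed

text \<open>Alignment yields co-transitivity: a middle position that is \<open>up\<close> is
  compared with the left end, any other with the right end, and one in an end block with the
  opposite end. Descents of the resulting permutation belong to \<open>S\<close>, so alignment also
  gives avoidance.\<close>

lemma aligned_realization:
  assumes S: "S \<subseteq> pairs" and sym: "\<And>a c. (a, c) \<in> S \<Longrightarrow> (- c, - a) \<in> S"
    and tr: "trans S" and al: "aligned S"
  obtains x where "x \<in> avoiders" "inversions n x = S"
proof -
  have S': "a \<in> pm n \<and> c \<in> pm n \<and> \<beta> a < \<beta> c" if "(a, c) \<in> S" for a c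
    using S that by (auto simp: pairs_iff)
  obtain x where x: "x \<in> hyperoct n" "inversions n x = S"
  proof (rule biclosed_realization[of S n])
    show "a \<in> pm n \<and> c \<in> pm n \<and> a < c" if "(a, c) \<in> S" for a c
      using S'[OF that] less_of_block by blast
    show "(- c, - a) \<in> S" if "(a, c) \<in> S" for a c using sym[OF that] .
    show "(a, c) \<in> S" if "(a, b) \<in> S" "(b, c) \<in> S" for a b c using transD[OF tr that] .
    show "(a, b) \<in> S \<or> (b, c) \<in> S" if "(a, c) \<in> S" "b \<in> pm n" "a < b" "b < c" for a b c
    proof -
      note l = aligned_left[OF al that] and r = aligned_right[OF al that]
      show ?thesis
      proof (cases "\<beta> b = \<beta> a")
        case True
        then show ?thesis using l S'[OF that(1)] by simp
      next
        case False
        then show ?thesis using l r by (cases "up b"; cases "\<beta> b = \<beta> c") auto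
      qed
    qed
  qed
  have "x \<in> block_increasing" using x S by (simp add: block_increasing_iff)
  moreover have "(up j \<longrightarrow> x j < x i) \<and> (\<not> up j \<longrightarrow> x k < x j)"
    if pm: "i \<in> pm n" "j \<in> pm n" "k \<in> pm n" and b: "\<beta> i < \<beta> j" "\<beta> j < \<beta> k" and d: "x i = succ_pm (x k)" for i j k
  proof -
    have lt: "i < j" "j < k" using b less_of_block by auto
    have "(i, k) \<in> inversions n x" using pm lt d succ_pm_gr[of "x k"] by (simp add: inversions_iff)
    then have ik: "(i, k) \<in> S" using x(2) by simp
    have "x j < x i" if "up j"
      using aligned_right[OF al ik pm(2) lt] that b unfolding x(2)[symmetric] by (simp add: inversions_iff)
    moreover have "x k < x j" if "\<not> up j"
      using aligned_left[OF al ik pm(2) lt] that b unfolding x(2)[symmetric] by (simp add: inversions_iff)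
    ultimately show ?thesis by blast
  qed
  ultimately have "x \<in> avoiders" by (simp add: avoiders_def)
  then show thesis using that x(2) by blast
qed

text \<open>
  \<open>dn t\<close> is the smallest aligned set containing \<open>t\<close>. All its members are nested in \<open>t\<close>, which is
  what makes truncation by height a congruence; the inversion set \<open>cl t\<close> of the join-irreducible
  itself may contain longer pairs, produced by composition through the central block.
\<close>

definition dn :: "int \<times> int \<Rightarrow> (int \<times> int) set" where
  "dn t = {(d, u). (d, u) \<in> pairs \<and> fst t \<le> d \<and> u \<le> snd t \<and>
     (\<beta> d = \<beta> (fst t) \<or> \<not> up d) \<and> (\<beta> u = \<beta> (snd t) \<or> up u)}"

lemma dn_iff: "(d, u) \<in> dn (a, c) \<longleftrightarrow> (d, u) \<in> pairs \<and> a \<le> d \<and> u \<le> c \<and>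
     (\<beta> d = \<beta> a \<or> \<not> up d) \<and> (\<beta> u = \<beta> c \<or> up u)"
  by (simp add: dn_def)

lemma dn_self: "t \<in> pairs \<Longrightarrow> t \<in> dn t"
  by (cases t) (simp add: dn_iff)

lemma dn_pairs: "dn t \<subseteq> pairs"
  by (auto simp: dn_def)

text \<open>Only the central block matters: its \<open>up\<close> positions are the negative ones,
  so they precede the others.\<close>

lemma up_same_block_le: "\<beta> d = \<beta> a \<Longrightarrow> a \<le> d \<Longrightarrow> \<not> up a \<Longrightarrow> \<not> up d"
  "\<beta> d = \<beta> a \<Longrightarrow> d \<le> a \<Longrightarrow> up a \<Longrightarrow> up d"
  by (auto simp: up_def)

lemma dn_mono: "s \<in> dn t \<Longrightarrow> dn s \<subseteq> dn t"
proof (rule subrelI)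
  fix d u assume s: "s \<in> dn t" and du: "(d, u) \<in> dn s"
  obtain a c where t: "t = (a, c)" by (cases t)
  obtain a' c' where s': "s = (a', c')" by (cases s)
  have "\<beta> d = \<beta> a \<or> \<not> up d" using s du up_same_block_le(1)[of d a'] unfolding t s' dn_iff by auto
  moreover have "\<beta> u = \<beta> c \<or> up u" using s du up_same_block_le(2)[of u c'] unfolding t s' dn_iff by auto
  ultimately show "(d, u) \<in> dn t" using s du unfolding t s' dn_iff by auto
qed

text \<open>Apart from lying in different blocks, the two ends are constrained separately and may be
  recombined.\<close>

lemma dn_product:
  "(d, u) \<in> dn t \<Longrightarrow> (d', u') \<in> dn t \<Longrightarrow> \<beta> d < \<beta> u' \<Longrightarrow> (d, u') \<in> dn t"
  by (cases t) (auto simp: dn_iff pairs_iff)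

lemma dn_uminus: "dn (- c, - a) = opp (dn (a, c))"
proof -
  have "(d, u) \<in> dn (- c, - a) \<longleftrightarrow> (- u, - d) \<in> dn (a, c)" for d u
  proof (cases "d \<in> pm n \<and> u \<in> pm n")
    case True
    then have "d \<noteq> 0" "u \<noteq> 0" by (auto simp: pm_iff)
    then show ?thesis using up_uminus[of d] up_uminus[of u]
      by (auto simp: dn_iff pairs_uminus odd_block)
  qed (auto simp: dn_iff pairs_iff)
  then show ?thesis by (auto simp: opp_iff)
qed

lemma aligned_dn: "aligned (dn t)"
  unfolding aligned_def
proof (intro allI impI conjI)
  obtain a c where t: "t = (a, c)" by (cases t)
  fix i k b assume ik: "(i, k) \<in> dn t" and b: "b \<in> pm n" "i < b" "b < k"
  have ik': "(i, k) \<in> pairs" "a \<le> i" "k \<le> c" "\<beta> i = \<beta> a \<or> \<not> up i" "\<beta> k = \<beta> c \<or> up k"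
    using ik by (auto simp: t dn_iff)
  have bb: "\<beta> i \<le> \<beta> b" "\<beta> b \<le> \<beta> k" using mono_block b by auto
  show "(b, k) \<in> dn t" if "\<beta> b \<noteq> \<beta> k" "\<beta> b = \<beta> i \<or> \<not> up b"
  proof -
    have "\<beta> b = \<beta> a \<or> \<not> up b" using that(2) ik'(4) up_same_block_le(1)[of b i] b by auto
    then show ?thesis using that(1) ik' b bb by (auto simp: t dn_iff pairs_iff)
  qed
  show "(i, b) \<in> dn t" if "\<beta> b \<noteq> \<beta> i" "\<beta> b = \<beta> k \<or> up b"
  proof -
    have "\<beta> b = \<beta> c \<or> up b" using that(2) ik'(5) up_same_block_le(2)[of b k] b by auto
    then show ?thesis using that(1) ik' b bb by (auto simp: t dn_iff pairs_iff)
  qed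
qed

lemma aligned_opp: "aligned S \<Longrightarrow> aligned (opp S)"
  unfolding aligned_def[of "opp S"] opp_iff
proof (intro allI impI conjI)
  fix i k b assume S: "aligned S" and *: "(- k, - i) \<in> S" "b \<in> pm n" "i < b" "b < k"
  have b: "- b \<in> pm n" "- k < - b" "- b < - i" "b \<noteq> 0" using * by (auto simp: pm_iff)
  show "(- k, - b) \<in> S" if "\<beta> b \<noteq> \<beta> k" "\<beta> b = \<beta> i \<or> \<not> up b"
    using aligned_right[OF S *(1) b(1-3)] that up_uminus[OF b(4)] by (auto simp: odd_block)
  show "(- b, - i) \<in> S" if "\<beta> b \<noteq> \<beta> i" "\<beta> b = \<beta> k \<or> up b"
    using aligned_left[OF S *(1) b(1-3)] that up_uminus[OF b(4)] by (auto simp: odd_block)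
qed

definition sdn :: "int \<times> int \<Rightarrow> (int \<times> int) set" where
  "sdn t = dn t \<union> opp (dn t)"

lemma sdn_uminus: "(a, c) \<in> sdn t \<Longrightarrow> (- c, - a) \<in> sdn t"
  by (auto simp: sdn_def opp_iff)

lemma aligned_sdn: "aligned (sdn t)"
  using aligned_dn[of t] aligned_opp[OF aligned_dn[of t]] unfolding sdn_def aligned_def by blast

lemma sdn_pairs: "(a, c) \<in> sdn t \<Longrightarrow> (a, c) \<in> pairs"
  using dn_pairs[of t] pairs_uminus[of c a] by (auto simp: sdn_def opp_iff)

text \<open>The middle position would lie strictly between the end blocks of \<open>t\<close>, so it
  would have to be \<open>up\<close> as a right end and not \<open>up\<close> as a left end.\<close>

lemma dn_no_composition: "(d, u) \<in> dn t \<Longrightarrow> (u, e) \<in> dn t \<Longrightarrow> False"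
proof -
  assume du: "(d, u) \<in> dn t" and ue: "(u, e) \<in> dn t"
  obtain a c where t: "t = (a, c)" by (cases t)
  have "\<beta> d < \<beta> u" "\<beta> u < \<beta> e" "a \<le> d" "e \<le> c" using du ue by (auto simp: t dn_iff pairs_iff)
  then have "\<beta> u \<noteq> \<beta> a" "\<beta> u \<noteq> \<beta> c" using mono_block[of a d] mono_block[of e c] by auto
  then show False using du ue by (auto simp: t dn_iff)
qed

text \<open>Only a pair of \<open>dn t\<close> and a mirrored one can be composed, and the
  conditions on \<open>u\<close> and \<open>- u\<close> then force \<open>u\<close> into the central
  block. There \<open>dn_product\<close> lets \<open>- u\<close> take over the role of
  \<open>u\<close>.\<close>

lemma sdn_composition:
  assumes "(d, u) \<in> sdn t" "(u, e) \<in> sdn t"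
  shows "\<beta> u = 0" "(- u, e) \<in> sdn t"
proof -
  obtain a c where t: "t = (a, c)" by (cases t)
  have u: "u \<noteq> 0" using sdn_pairs[OF assms(1)] by (auto simp: pairs_iff pm_iff)
  have duB: "\<beta> d < \<beta> u" "\<beta> u < \<beta> e" using sdn_pairs[OF assms(1)] sdn_pairs[OF assms(2)] by (auto simp: pairs_iff)
  consider (1) "(d, u) \<in> dn t" "(u, e) \<in> dn t" | (2) "(- u, - d) \<in> dn t" "(- e, - u) \<in> dn t"
    | (3) "(d, u) \<in> dn t" "(- e, - u) \<in> dn t" | (4) "(- u, - d) \<in> dn t" "(u, e) \<in> dn t"
    using assms by (auto simp: sdn_def opp_iff)
  then have "\<beta> u = 0 \<and> (- u, e) \<in> sdn t"
  proof cases
    case 1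
    then show ?thesis using dn_no_composition by blast
  next
    case 2
    then show ?thesis using dn_no_composition by blast
  next
    case 3
    have c: "\<beta> u \<le> \<beta> c" "- \<beta> u \<le> \<beta> c"
      using 3 mono_block[of u c] mono_block[of "- u" c] by (auto simp: t dn_iff odd_block)
    have "\<beta> u = \<beta> c \<or> up u" "- \<beta> u = \<beta> c \<or> \<not> up u"
      using 3 up_uminus[OF u] by (auto simp: t dn_iff odd_block)
    then have z: "\<beta> u = 0" using c by (auto simp: up_def)
    have "(- e, u) \<in> dn t" using dn_product[OF 3(2,1)] duB z by (simp add: odd_block)
    then show ?thesis using z by (simp add: sdn_def opp_iff)
  next
    case 4
    have c: "\<beta> a \<le> \<beta> u" "\<beta> a \<le> - \<beta> u"
      using 4 mono_block[of a u] mono_block[of a "- u"] by (auto simp: t dn_iff odd_block)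
    have "\<beta> u = \<beta> a \<or> \<not> up u" "- \<beta> u = \<beta> a \<or> up u"
      using 4 up_uminus[OF u] by (auto simp: t dn_iff odd_block)
    then have z: "\<beta> u = 0" using c by (auto simp: up_def)
    have "(- u, e) \<in> dn t" using dn_product[OF 4] duB z by (simp add: odd_block)
    then show ?thesis using z by (simp add: sdn_def)
  qed
  then show "\<beta> u = 0" "(- u, e) \<in> sdn t" by auto
qed

text \<open>Already the transitive closure: three factors would pass through two central positions,
  and no pair joins positions of the same block.\<close>

definition cl :: "int \<times> int \<Rightarrow> (int \<times> int) set" where
  "cl t = sdn t \<union> sdn t O sdn t"

lemma cl_uminus:
  assumes "(a, c) \<in> cl t" shows "(- c, - a) \<in> cl t"
proof -
  consider "(a, c) \<in> sdn t" | b where "(a, b) \<in> sdn t" "(b, c) \<in> sdn t" using assms by (auto simp: cl_def)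
  then show ?thesis
  proof cases
    case 1
    then show ?thesis using sdn_uminus by (simp add: cl_def)
  next
    case 2
    then show ?thesis using sdn_uminus[OF 2(1)] sdn_uminus[OF 2(2)] unfolding cl_def by blast
  qed
qed

lemma cl_pairs: "cl t \<subseteq> pairs"
proof (rule subrelI)
  fix a c assume "(a, c) \<in> cl t"
  then consider "(a, c) \<in> sdn t" | b where "(a, b) \<in> sdn t" "(b, c) \<in> sdn t" by (auto simp: cl_def)
  then show "(a, c) \<in> pairs"
  proof cases
    case 2
    then show ?thesis using sdn_pairs[OF 2(1)] sdn_pairs[OF 2(2)] by (auto simp: pairs_iff)
  qed (rule sdn_pairs)
qed

lemma trans_cl: "trans (cl t)"
proof (rule transI)
  have no3: False if "(a, b) \<in> sdn t" "(b, c) \<in> sdn t" "(c, d) \<in> sdn t" for a b c d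
    using sdn_composition(1)[OF that(1,2)] sdn_composition(1)[OF that(2,3)] sdn_pairs[OF that(2)]
    by (simp add: pairs_iff)
  fix a b c assume "(a, b) \<in> cl t" "(b, c) \<in> cl t"
  then show "(a, c) \<in> cl t" unfolding cl_def using no3 by blast
qed

lemma aligned_cl: "aligned (cl t)"
proof (rule alignedI)
  show "(- c, - a) \<in> cl t" if "(a, c) \<in> cl t" for a c using cl_uminus[OF that] .
  fix i k b assume ik: "(i, k) \<in> cl t" and b: "b \<in> pm n" "i < b" "b < k"
    and bk: "\<beta> b \<noteq> \<beta> k" and bi: "\<beta> b = \<beta> i \<or> \<not> up b"
  note left = aligned_left[OF aligned_sdn]
  have "(i, k) \<in> sdn t \<or> (\<exists>u. (i, u) \<in> sdn t \<and> (u, k) \<in> sdn t)" using ik by (auto simp: cl_def)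
  then show "(b, k) \<in> cl t"
  proof
    assume "(i, k) \<in> sdn t"
    then show ?thesis using left[OF _ b bk bi] by (simp add: cl_def)
  next
    assume "\<exists>u. (i, u) \<in> sdn t \<and> (u, k) \<in> sdn t"
    then obtain u where u: "(i, u) \<in> sdn t" "(u, k) \<in> sdn t" by blast
    have z: "\<beta> u = 0" and uk: "(- u, k) \<in> sdn t" using sdn_composition[OF u] by auto
    have iu: "\<beta> i < \<beta> u" using sdn_pairs[OF u(1)] by (simp add: pairs_iff)
    have "(b, k) \<in> sdn t \<or> (b, u) \<in> sdn t"
    proof (cases "\<beta> b = \<beta> u")
      case True
      consider "b = u" | "u < b" | "b < u" by linarith
      then show ?thesis
      proof cases
        case 1
        then show ?thesis using u(2) by simp
      next
        case 2
        then show ?thesis using left[OF u(2) b(1) 2 b(3) bk] True by simp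
      next
        case 3
        \<comment> \<open>Here \<open>b\<close> is a positive central position to the left of
          \<open>u\<close>; the mirrored factor \<open>(- u, k)\<close> starts to the left of
          \<open>b\<close>, so alignment is applied to it instead.\<close>
        then have "\<not> up b" using bi True iu by simp
        then have "0 < b" using True z b(1) by (auto simp: up_def pm_iff)
        then have "- u < b" using 3 by simp
        then show ?thesis using left[OF uk b(1) _ b(3) bk] True z by (simp add: odd_block)
      qed
    next
      case False
      show ?thesis
      proof (cases "b < u")
        case True
        then show ?thesis using left[OF u(1) b(1,2) True False bi] by simp
      next
        case nl: False
        then have "u < b" using False by (cases "b = u") auto
        moreover from this have "\<beta> u \<le> \<beta> b" using mono_block by simp
        then have "\<not> up b" using bi iu by auto
        ultimately show ?thesis using left[OF u(2) b(1) _ b(3) bk] by simp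
      qed
    qed
    then show ?thesis using u(2) by (auto simp: cl_def)
  qed
qed

section \<open>Descents, generation and joins of avoiders\<close>

lemma descent_dn:
  assumes x: "x \<in> avoiders" and ik: "i \<in> pm n" "k \<in> pm n" "i < k" and d: "x i = succ_pm (x k)"
  shows "(i, k) \<in> pairs" "dn (i, k) \<subseteq> inversions n x"
proof -
  have h: "x \<in> hyperoct n" using avoiders_hyperoct[OF x] .
  have lt: "x k < x i" using succ_pm_gr d by simp
  then have "(i, k) \<in> inversions n x" using ik by (simp add: inversions_iff)
  then show "(i, k) \<in> pairs" using avoiders_pairs[OF x] by blast
  show "dn (i, k) \<subseteq> inversions n x"
  proof (rule subrelI)
    fix p q assume "(p, q) \<in> dn (i, k)"
    then have pq: "p \<in> pm n" "q \<in> pm n" "\<beta> p < \<beta> q" "i \<le> p" "q \<le> k"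
      "\<beta> p = \<beta> i \<or> \<not> up p" "\<beta> q = \<beta> k \<or> up q" by (auto simp: dn_iff pairs_iff)
    have b: "\<beta> i \<le> \<beta> p" "\<beta> q \<le> \<beta> k" using mono_block pq(4,5) by auto
    \<comment> \<open>No value lies strictly between \<open>x k\<close> and \<open>x i\<close>, so
      the avoidance bound \<open>x k < x p\<close> improves to \<open>x i \<le> x p\<close>; dually
      for \<open>q\<close>.\<close>
    have "x i \<le> x p"
    proof (cases "\<beta> p = \<beta> i")
      case True
      then show ?thesis using avoiders_increasing[OF x ik(1) pq(1,4)] by simp
    next
      case False
      then have "x k < x p" using avoidersD(2)[OF x ik(1) pq(1) ik(2) _ _ d] pq b by simp
      moreover have "x p \<noteq> 0" using hyperoct_pm[OF h, of p] pq(1) by (auto simp: pm_iff)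
      ultimately show ?thesis using succ_pm_least[of "x k" "x p"] d by simp
    qed
    moreover have "x q \<le> x k"
    proof (cases "\<beta> q = \<beta> k")
      case True
      then show ?thesis using avoiders_increasing[OF x pq(2) ik(2) pq(5)] by simp
    next
      case False
      then have "x q < x i" using avoidersD(1)[OF x ik(1) pq(2) ik(2) _ _ d] pq b by simp
      moreover have "x q \<noteq> 0" using hyperoct_pm[OF h, of q] pq(2) by (auto simp: pm_iff)
      ultimately show ?thesis using succ_pm_least[of "x k" "x q"] d by linarith
    qed
    ultimately show "(p, q) \<in> inversions n x" using lt pq less_of_block[OF pq(3)] by (simp add: inversions_iff)
  qed
qed

text \<open>An avoider is the join of the join-irreducibles below it, in a form localized to an interval.\<close>

lemma inversion_in_trans:
  assumes x: "x \<in> avoiders" and Y: "trans Y" and ac: "(a, c) \<in> inversions n x"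
    and gen: "\<And>p q. (p, q) \<in> pairs \<Longrightarrow> dn (p, q) \<subseteq> inversions n x \<Longrightarrow> a \<le> p \<Longrightarrow> q \<le> c \<Longrightarrow> (p, q) \<in> Y"
  shows "(a, c) \<in> Y"
  using ac gen
proof (induction "nat (x a - x c)" arbitrary: a c rule: less_induct)
  case less
  have ac: "a \<in> pm n" "c \<in> pm n" "a < c" "x c < x a" using less.prems(1) by (auto simp: inversions_iff)
  show ?case
  proof (cases "\<exists>b\<in>pm n. a < b \<and> b < c \<and> x c < x b \<and> x b < x a")
    case True
    then obtain b where b: "b \<in> pm n" "a < b" "b < c" "x c < x b" "x b < x a" by blast
    have "(a, b) \<in> Y"
    proof (rule less.hyps)
      show "nat (x a - x b) < nat (x a - x c)" using b by simp
      show "(a, b) \<in> inversions n x" using b ac by (simp add: inversions_iff)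
      show "(p, q) \<in> Y" if "(p, q) \<in> pairs" "dn (p, q) \<subseteq> inversions n x" "a \<le> p" "q \<le> b" for p q
        using less.prems(2)[OF that(1,2,3)] that(4) b(3) by simp
    qed
    moreover have "(b, c) \<in> Y"
    proof (rule less.hyps)
      show "nat (x b - x c) < nat (x a - x c)" using b by simp
      show "(b, c) \<in> inversions n x" using b ac by (simp add: inversions_iff)
      show "(p, q) \<in> Y" if "(p, q) \<in> pairs" "dn (p, q) \<subseteq> inversions n x" "b \<le> p" "q \<le> c" for p q
        using less.prems(2)[OF that(1,2) _ that(4)] that(3) b(2) by simp
    qed
    ultimately show ?thesis using transD[OF Y] by blast
  next
    case False
    \<comment> \<open>Without intermediate values at intermediate positions, the inversion belongs
      to \<open>dn (i, k)\<close> for an enclosing descent, and \<open>descent_dn\<close> supplies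
      all of \<open>dn (a, c)\<close>.\<close>
    obtain i k where ik: "i \<in> pm n" "k \<in> pm n" "i \<le> a" "c \<le> k" "x i = succ_pm (x k)" "x c \<le> x k" "x i \<le> x a"
      using close_descent[OF avoiders_hyperoct[OF x] less.prems(1)] False by metis
    have lt: "i < k" using ik ac by simp
    have acp: "(a, c) \<in> pairs" using avoiders_pairs[OF x] less.prems(1) by blast
    then have bac: "\<beta> a < \<beta> c" by (simp add: pairs_iff)
    have b: "\<beta> i \<le> \<beta> a" "\<beta> c \<le> \<beta> k" using mono_block ik(3,4) by auto
    have "\<beta> a = \<beta> i \<or> \<not> up a"
      using avoidersD(1)[OF x ik(1) ac(1) ik(2) _ _ ik(5)] b bac ik(7) by force
    moreover have "\<beta> c = \<beta> k \<or> up c"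
      using avoidersD(2)[OF x ik(1) ac(2) ik(2) _ _ ik(5)] b bac ik(6) by force
    ultimately have "(a, c) \<in> dn (i, k)" using acp ik by (simp add: dn_iff)
    then have "dn (a, c) \<subseteq> inversions n x" using dn_mono descent_dn(2)[OF x ik(1,2) lt ik(5)] by blast
    then show ?thesis using less.prems(2)[OF acp] by simp
  qed
qed

lemma trancl_pairs: "R \<subseteq> pairs \<Longrightarrow> R\<^sup>+ \<subseteq> pairs"
proof (rule subrelI)
  fix a c assume R: "R \<subseteq> pairs" and "(a, c) \<in> R\<^sup>+"
  from this(2) show "(a, c) \<in> pairs"
    by induction (use R in \<open>auto simp: pairs_iff\<close>)
qed

text \<open>A union of inversion sets is co-transitive, and so is its transitive closure. A descent
  \<open>(i, k)\<close> of \<open>w\<close> is not composite, hence already an inversion of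
  \<open>x\<close> or \<open>y\<close>; there \<open>close_descent\<close> finds an enclosing
  descent whose avoidance passes to \<open>(i, k)\<close>.\<close>

lemma exists_join:
  assumes x: "x \<in> avoiders" and y: "y \<in> avoiders"
  obtains w where "w \<in> avoiders" "inversions n w = (inversions n x \<union> inversions n y)\<^sup>+"
proof -
  define R where "R = inversions n x \<union> inversions n y"
  have hx: "x \<in> hyperoct n" and hy: "y \<in> hyperoct n" using avoiders_hyperoct x y by auto
  have R: "R \<subseteq> pairs" using avoiders_pairs x y by (auto simp: R_def)
  have Rp: "(a, c) \<in> pairs" if "(a, c) \<in> R\<^sup>+" for a c using trancl_pairs[OF R] that by blast
  have Rsym: "(- c, - a) \<in> R" if "(a, c) \<in> R" for a c
    using that inversions_uminus[OF hx] inversions_uminus[OF hy] by (auto simp: R_def)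
  have Rco: "(a, b) \<in> R \<or> (b, c) \<in> R" if "(a, c) \<in> R" "b \<in> pm n" "a < b" "b < c" for a b c
    using that unfolding R_def Un_iff inversions_iff by linarith
  obtain w where w: "w \<in> hyperoct n" "inversions n w = R\<^sup>+"
  proof (rule biclosed_realization[of "R\<^sup>+" n])
    show "a \<in> pm n \<and> c \<in> pm n \<and> a < c" if "(a, c) \<in> R\<^sup>+" for a c
      using Rp[OF that] pairs_less by (auto simp: pairs_iff)
    show "(- c, - a) \<in> R\<^sup>+" if "(a, c) \<in> R\<^sup>+" for a c
      using that
    proof induction
      case (base b)
      then show ?case using Rsym by blast
    next
      case (step b c)
      then show ?case using Rsym[OF step(2)] by (meson trancl_into_trancl2)
    qed
    show "(a, c) \<in> R\<^sup>+" if "(a, b) \<in> R\<^sup>+" "(b, c) \<in> R\<^sup>+" for a b c using trancl_trans[OF that] .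
    show "(a, b) \<in> R\<^sup>+ \<or> (b, c) \<in> R\<^sup>+" if "(a, c) \<in> R\<^sup>+" "b \<in> pm n" "a < b" "b < c" for a b c
      using that(1,4)
    proof induction
      case (base c)
      then show ?case using Rco[OF base(1) that(2,3)] by blast
    next
      case (step d c)
      consider "b < d" | "b = d" | "d < b" by linarith
      then show ?case
      proof cases
        case 1
        then show ?thesis using step.IH step.hyps(2) trancl_into_trancl[of b d R c] by blast
      next
        case 2
        then show ?thesis using step.hyps(1) by simp
      next
        case 3
        then show ?thesis
          using Rco[OF step.hyps(2) that(2) 3 step.prems] step.hyps(1) trancl_into_trancl[of a d R b] by blast
      qed
    qed
  qed
  have wH: "w \<in> block_increasing" using w trancl_pairs[OF R] by (simp add: block_increasing_iff)
  have "(up j \<longrightarrow> w j < w i) \<and> (\<not> up j \<longrightarrow> w k < w j)"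
    if pm: "i \<in> pm n" "j \<in> pm n" "k \<in> pm n" and b: "\<beta> i < \<beta> j" "\<beta> j < \<beta> k" and d: "w i = succ_pm (w k)" for i j k
  proof -
    have lt: "i < j" "j < k" using b less_of_block by auto
    have gap: False if "(i, e) \<in> inversions n w" "(e, k) \<in> inversions n w" for e
    proof -
      have "w k < w e" "w e < w i" "e \<in> pm n" using that by (auto simp: inversions_iff)
      moreover from this have "w e \<noteq> 0" using hyperoct_pm[OF w(1), of e] by (auto simp: pm_iff)
      ultimately show False using succ_pm_least[of "w k" "w e"] d by simp
    qed
    have "(i, k) \<in> inversions n w" using pm lt d succ_pm_gr[of "w k"] by (simp add: inversions_iff)
    then have "(i, k) \<in> R\<^sup>+" using w(2) by simp
    then have "(i, k) \<in> R"
    proof cases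
      case (step e)
      then show ?thesis using gap[of e] w(2) by blast
    qed
    moreover have "inversions n x \<subseteq> inversions n w" "inversions n y \<subseteq> inversions n w"
      unfolding w(2) R_def by auto
    ultimately obtain z where z: "z \<in> avoiders" "(i, k) \<in> inversions n z" "inversions n z \<subseteq> inversions n w"
      using x y unfolding R_def by blast
    have gz: False if "e \<in> pm n" "i < e" "e < k" "z k < z e" "z e < z i" for e
    proof -
      have "(i, e) \<in> inversions n z" "(e, k) \<in> inversions n z" using that pm by (auto simp: inversions_iff)
      then show False using gap z(3) by blast
    qed
    obtain i' k' where ik: "i' \<in> pm n" "k' \<in> pm n" "i' \<le> i" "k \<le> k'" "z i' = succ_pm (z k')" "z k \<le> z k'" "z i' \<le> z i"
      by (rule close_descent[OF avoiders_hyperoct[OF z(1)] z(2) gz])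
    have b': "\<beta> i' < \<beta> j" "\<beta> j < \<beta> k'" using mono_block[OF ik(3)] mono_block[OF ik(4)] b by auto
    note av = avoidersD[OF z(1) ik(1) pm(2) ik(2) b' ik(5)]
    have "w j < w i" if "up j"
    proof -
      have "(i, j) \<in> inversions n z" using av(1)[OF that] ik(7) pm lt by (simp add: inversions_iff)
      then have "(i, j) \<in> inversions n w" using z(3) by blast
      then show ?thesis by (simp add: inversions_iff)
    qed
    moreover have "w k < w j" if "\<not> up j"
    proof -
      have "(j, k) \<in> inversions n z" using av(2)[OF that] ik(6) pm lt by (simp add: inversions_iff)
      then have "(j, k) \<in> inversions n w" using z(3) by blast
      then show ?thesis by (simp add: inversions_iff)
    qed
    ultimately show ?thesis by blast
  qed
  then have "w \<in> avoiders" using wH by (simp add: avoiders_def)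
  then show thesis using that w(2) unfolding R_def by blast
qed

text \<open>Representatives of the pairs modulo \<open>(a, c) \<mapsto> (-c, -a)\<close>.\<close>

definition reps :: "(int \<times> int) set" where
  "reps = {(a, c) \<in> pairs. 0 \<le> a + c}"

definition rep :: "int \<times> int \<Rightarrow> int \<times> int" where
  "rep p = (if 0 \<le> fst p + snd p then p else (- snd p, - fst p))"

lemma rep_reps: "(a, c) \<in> pairs \<Longrightarrow> rep (a, c) \<in> reps"
  using pairs_uminus[of c a] by (auto simp: rep_def reps_def)

lemma rep_uminus: "rep (- c, - a) = rep (a, c)"
  by (auto simp: rep_def)

lemma rep_id: "t \<in> reps \<Longrightarrow> rep t = t"
  by (auto simp: rep_def reps_def)

lemma rep_cases: "rep (a, c) = (a, c) \<or> rep (a, c) = (- c, - a)"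
  by (simp add: rep_def)

lemma finite_reps: "finite reps"
  by (rule finite_subset[of _ "pm n \<times> pm n"]) (auto simp: reps_def pairs_iff finite_pm)

text \<open>An avoider may invert \<open>t\<close> without inverting all of \<open>dn t\<close>, so
  asking for \<open>t\<close> alone would admit generators that are not below
  \<open>x\<close>.\<close>

definition A :: "(int \<Rightarrow> int) \<Rightarrow> (int \<times> int) set" where
  "A x = {t \<in> reps. dn t \<subseteq> inversions n x}"

lemma opp_inversions: "x \<in> avoiders \<Longrightarrow> opp S \<subseteq> inversions n x \<longleftrightarrow> S \<subseteq> inversions n x"
proof -
  assume "x \<in> avoiders"
  then have h: "x \<in> hyperoct n" by (rule avoiders_hyperoct)
  show ?thesis
  proof
    assume o: "opp S \<subseteq> inversions n x"
    show "S \<subseteq> inversions n x"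
    proof (rule subrelI)
      fix a c assume "(a, c) \<in> S"
      then have "(- c, - a) \<in> inversions n x" using o by (auto simp: opp_iff)
      then show "(a, c) \<in> inversions n x" using inversions_uminus[OF h] by simp
    qed
  next
    assume S: "S \<subseteq> inversions n x"
    show "opp S \<subseteq> inversions n x"
    proof (rule subrelI)
      fix a c assume "(a, c) \<in> opp S"
      then have "(- c, - a) \<in> inversions n x" using S by (auto simp: opp_iff)
      then show "(a, c) \<in> inversions n x" using inversions_uminus[OF h] by simp
    qed
  qed
qed

lemma rep_A_iff:
  assumes x: "x \<in> avoiders" and p: "(a, c) \<in> pairs"
  shows "rep (a, c) \<in> A x \<longleftrightarrow> dn (a, c) \<subseteq> inversions n x"
  using rep_cases[of a c] rep_reps[OF p] opp_inversions[OF x, of "dn (a, c)"] dn_uminus[of c a]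
  by (auto simp: A_def)

lemma rep_inversions:
  assumes x: "x \<in> avoiders" and p: "rep (a, c) \<in> inversions n x"
  shows "(a, c) \<in> inversions n x"
  using rep_cases[of a c] p inversions_uminus[OF avoiders_hyperoct[OF x], of c a] by auto

lemma A_sub_inversions: "A x \<subseteq> inversions n x"
  using dn_self by (auto simp: A_def reps_def)

lemma A_sub_iff:
  assumes x: "x \<in> avoiders" and y: "y \<in> avoiders"
  shows "A x \<subseteq> A y \<longleftrightarrow> inversions n x \<subseteq> inversions n y"
proof
  assume A: "A x \<subseteq> A y"
  show "inversions n x \<subseteq> inversions n y"
  proof (rule subrelI)
    fix a c assume "(a, c) \<in> inversions n x"
    then show "(a, c) \<in> inversions n y"
    proof (rule inversion_in_trans[OF x trans_inversions])
      fix p q assume pq: "(p, q) \<in> pairs" "dn (p, q) \<subseteq> inversions n x"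
      then have "rep (p, q) \<in> A y" using rep_A_iff[OF x] A by blast
      then show "(p, q) \<in> inversions n y" using A_sub_inversions[of y] rep_inversions[OF y] by blast
    qed
  qed
qed (auto simp: A_def)

lemma sub_cl: "x \<in> avoiders \<Longrightarrow> dn t \<subseteq> inversions n x \<Longrightarrow> cl t \<subseteq> inversions n x"
proof -
  assume x: "x \<in> avoiders" and d: "dn t \<subseteq> inversions n x"
  have s: "sdn t \<subseteq> inversions n x" using d opp_inversions[OF x, of "dn t"] by (simp add: sdn_def)
  have "sdn t O sdn t \<subseteq> inversions n x"
    using s trans_inversions[of n x] by (auto dest: transD)
  then show ?thesis using s by (simp add: cl_def)
qed

definition gen :: "int \<times> int \<Rightarrow> int \<Rightarrow> int" where
  "gen t = (SOME x. x \<in> avoiders \<and> inversions n x = cl t)"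

lemma gen: "gen t \<in> avoiders" "inversions n (gen t) = cl t"
proof -
  obtain x where "x \<in> avoiders" "inversions n x = cl t"
    by (rule aligned_realization[OF cl_pairs cl_uminus trans_cl aligned_cl])
  then have "\<exists>x. x \<in> avoiders \<and> inversions n x = cl t" by blast
  from someI_ex[OF this] show "gen t \<in> avoiders" "inversions n (gen t) = cl t"
    unfolding gen_def by auto
qed

definition Join :: "(int \<Rightarrow> int) \<Rightarrow> (int \<Rightarrow> int) \<Rightarrow> int \<Rightarrow> int" where
  "Join x y = (SOME w. w \<in> avoiders \<and> inversions n w = (inversions n x \<union> inversions n y)\<^sup>+)"

lemma Join:
  assumes "x \<in> avoiders" "y \<in> avoiders"
  shows "Join x y \<in> avoiders" "inversions n (Join x y) = (inversions n x \<union> inversions n y)\<^sup>+"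
proof -
  obtain w where "w \<in> avoiders" "inversions n w = (inversions n x \<union> inversions n y)\<^sup>+"
    by (rule exists_join[OF assms])
  then have "\<exists>w. w \<in> avoiders \<and> inversions n w = (inversions n x \<union> inversions n y)\<^sup>+" by blast
  from someI_ex[OF this]
  show "Join x y \<in> avoiders" "inversions n (Join x y) = (inversions n x \<union> inversions n y)\<^sup>+"
    unfolding Join_def by auto
qed

text \<open>
  The order in which the chain of initial segments acquires its inversions: first the values at
  outer positive positions drop below those at the positive central positions, then sums of two
  outer values become negative by increasing height, then the outer values drop below those at the
  negative central positions, and finally the outer positive positions are reversed block by block.
\<close>

definition phase :: "int \<Rightarrow> int" where
  "phase a = (if \<beta> a > 0 then 3 else if \<beta> a < 0 then 1 else if a > 0 then 0 else 2)"

text \<open>The last two entries make the key injective and, in the last phase, order the pairs with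
  left ends in the same block compatibly with alignment.\<close>

definition key :: "int \<times> int \<Rightarrow> int \<times> int \<times> int \<times> int" where
  "key t = (phase (fst t), if \<beta> (fst t) > 0 then \<beta> (fst t) else snd t - fst t, - fst t, snd t)"

lemma key_inj: "inj_on key reps"
  by (rule inj_onI) (auto simp: key_def)

text \<open>An alignment step never increases the key; with \<open>key_trans\<close> this makes the
  pairs represented in an initial segment an aligned, transitive set. A left end that is not
  \<open>up\<close> belongs to one of the first two phases.\<close>

lemma key_left:
  assumes ik: "(i, k) \<in> pairs" and b: "b \<in> pm n" "i < b" "b < k" and bk: "\<beta> b \<noteq> \<beta> k"
    and bi: "\<beta> b = \<beta> i \<or> \<not> up b"
  shows "key (rep (b, k)) \<le> key (rep (i, k))"
proof -
  have mono: "\<beta> i \<le> \<beta> b" "\<beta> b \<le> \<beta> k" using mono_block b by auto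
  have nz: "i \<noteq> 0" "b \<noteq> 0" "k \<noteq> 0" using ik b by (auto simp: pairs_iff pm_iff)
  show ?thesis
  proof (cases "0 \<le> i + k")
    case True
    then have r: "rep (i, k) = (i, k)" "rep (b, k) = (b, k)" using b by (auto simp: rep_def)
    show ?thesis
      unfolding r using bi b nz mono by (auto simp: key_def phase_def up_def)
  next
    case False
    then have r: "rep (i, k) = (- k, - i)" by (simp add: rep_def)
    show ?thesis
    proof (cases "0 \<le> b + k")
      case True
      then have r': "rep (b, k) = (b, k)" by (simp add: rep_def)
      have k: "0 < k" using True b by simp
      have "- \<beta> k \<le> \<beta> b" using mono_block[of "- k" b] True by (simp add: odd_block)
      then have kp: "0 < \<beta> k" using bk mono by linarith
      have i: "\<beta> i \<le> - \<beta> k" using mono_block[of i "- k"] False by (simp add: odd_block)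
      show ?thesis
        unfolding r r' using bi b nz mono kp i by (auto simp: key_def phase_def up_def odd_block)
    next
      case False
      then have "rep (b, k) = (- k, - b)" by (simp add: rep_def)
      then show ?thesis unfolding r using b by (auto simp: key_def)
    qed
  qed
qed

text \<open>By mirroring, \<open>0 \<le> a + c\<close> may be assumed. If \<open>a\<close> is outer
  negative and \<open>b\<close> is outer negative or central positive, the mirrored pair
  \<open>(- b, - a)\<close> belongs to one of the last two phases and dominates; in all other cases
  \<open>(b, c)\<close> does.\<close>

lemma key_trans:
  assumes ab: "(a, b) \<in> pairs" and bc: "(b, c) \<in> pairs"
  shows "key (rep (a, c)) \<le> max (key (rep (a, b))) (key (rep (b, c)))"
proof -
  have main: "key (rep (a, c)) \<le> key (rep (a, b)) \<or> key (rep (a, c)) \<le> key (rep (b, c))"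
    if ab: "(a, b) \<in> pairs" and bc: "(b, c) \<in> pairs" and s: "0 \<le> a + c" for a b c
  proof -
    have lt: "a < b" "b < c" "\<beta> a < \<beta> b" "\<beta> b < \<beta> c" "b \<noteq> 0"
      using pairs_less[OF ab] pairs_less[OF bc] ab bc by (auto simp: pairs_iff pm_iff)
    have r: "rep (a, c) = (a, c)" "rep (b, c) = (b, c)" using s lt by (auto simp: rep_def)
    show ?thesis
    proof (cases "\<beta> a < 0 \<and> (\<beta> b < 0 \<or> \<beta> b = 0 \<and> 0 < b)")
      case True
      have "\<not> 0 \<le> a + b"
      proof
        assume "0 \<le> a + b"
        then have "- \<beta> b \<le> \<beta> a" using mono_block[of "- b" a] by (simp add: odd_block)
        then show False using True lt(3) by linarith
      qed
      then have "rep (a, b) = (- b, - a)" by (simp add: rep_def)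
      then show ?thesis unfolding r using True by (auto simp: key_def phase_def odd_block)
    next
      case False
      then show ?thesis unfolding r using lt by (auto simp: key_def phase_def)
    qed
  qed
  show ?thesis
  proof (cases "0 \<le> a + c")
    case True
    then show ?thesis using main[OF ab bc] by (simp add: le_max_iff_disj)
  next
    case False
    have "(- c, - b) \<in> pairs" "(- b, - a) \<in> pairs" using pairs_uminus ab bc by auto
    from main[OF this] False show ?thesis by (auto simp: le_max_iff_disj rep_uminus)
  qed
qed

lemma exists_initial_segment:
  assumes U: "U \<subseteq> reps" and init: "\<And>s t. s \<in> U \<Longrightarrow> t \<in> reps \<Longrightarrow> key t \<le> key s \<Longrightarrow> t \<in> U"
  shows "\<exists>x\<in>avoiders. A x = U"
proof -
  define S where "S = {p \<in> pairs. rep p \<in> U}"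
  have sym: "(- c, - a) \<in> S" if "(a, c) \<in> S" for a c
    using that pairs_uminus by (simp add: S_def rep_uminus)
  have tr: "trans S"
  proof (rule transI)
    fix a b c assume "(a, b) \<in> S" "(b, c) \<in> S"
    then have p: "(a, b) \<in> pairs" "(b, c) \<in> pairs" and u: "rep (a, b) \<in> U" "rep (b, c) \<in> U"
      by (auto simp: S_def)
    have ac: "(a, c) \<in> pairs" using p by (auto simp: pairs_iff)
    from key_trans[OF p] have "rep (a, c) \<in> U"
      unfolding le_max_iff_disj using init[OF u(1) rep_reps[OF ac]] init[OF u(2) rep_reps[OF ac]] by blast
    then show "(a, c) \<in> S" using ac by (simp add: S_def)
  qed
  have al: "aligned S"
  proof (rule alignedI[OF sym])
    fix i k b assume ik: "(i, k) \<in> S" and b: "b \<in> pm n" "i < b" "b < k" "\<beta> b \<noteq> \<beta> k" "\<beta> b = \<beta> i \<or> \<not> up b"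
    have p: "(i, k) \<in> pairs" "rep (i, k) \<in> U" using ik by (auto simp: S_def)
    have bk: "(b, k) \<in> pairs" using p b mono_block[of b k] by (simp add: pairs_iff)
    have "rep (b, k) \<in> U" using init[OF p(2) rep_reps[OF bk] key_left[OF p(1) b]] .
    then show "(b, k) \<in> S" using bk by (simp add: S_def)
  qed
  obtain x where x: "x \<in> avoiders" "inversions n x = S"
    by (rule aligned_realization[OF _ sym tr al]) (auto simp: S_def)
  have "t \<in> A x \<longleftrightarrow> t \<in> U" for t
  proof
    assume "t \<in> A x"
    then have "t \<in> reps" "t \<in> S" using A_sub_inversions[of x] x(2) by (auto simp: A_def)
    then show "t \<in> U" using rep_id by (auto simp: S_def)
  next
    assume t: "t \<in> U"
    then have tr: "t \<in> reps" using U by blast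
    obtain a c where ac: "t = (a, c)" by (cases t)
    have tS: "(a, c) \<in> S" using t tr rep_id[OF tr] by (simp add: S_def ac reps_def)
    have "dn t \<subseteq> S"
    proof (rule subrelI)
      fix p q assume "(p, q) \<in> dn t"
      then have pq: "(p, q) \<in> pairs" "a \<le> p" "q \<le> c" "\<beta> p = \<beta> a \<or> \<not> up p" "\<beta> q = \<beta> c \<or> up q"
        by (auto simp: ac dn_iff)
      have pm: "p \<in> pm n" "q \<in> pm n" and bpq: "\<beta> p < \<beta> q" using pq by (auto simp: pairs_iff)
      have pltq: "p < q" using less_of_block[OF bpq] .
      have bpc: "\<beta> p \<noteq> \<beta> c" using bpq mono_block[OF pq(3)] by simp
      \<comment> \<open>The pair \<open>(p, q)\<close> is reached from \<open>(a, c)\<close> by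
        moving first the left and then the right end inward, each time by alignment.\<close>
      have "(p, c) \<in> S"
        using aligned_left[OF al tS pm(1) _ _ bpc pq(4)] tS pq(2,3) pltq by (cases "p = a") auto
      then show "(p, q) \<in> S"
        using aligned_right[OF al _ pm(2) pltq _ _ pq(5)] bpq pq(3) by (cases "q = c") auto
    qed
    then show "t \<in> A x" using tr x(2) by (simp add: A_def)
  qed
  then have "A x = U" by blast
  then show ?thesis using x(1) by blast
qed

section \<open>Joins avoiding a generator, and truncation by height\<close>

lemma Join_avoids:
  assumes t: "t \<in> reps" and x: "x \<in> avoiders" and y: "y \<in> avoiders"
    and gx: "A (gen t) \<subseteq> insert t (A x)" and gy: "A (gen t) \<subseteq> insert t (A y)"
    and nx: "t \<notin> A x" and ny: "t \<notin> A y"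
  shows "t \<notin> A (Join x y)"
proof
  assume tJ: "t \<in> A (Join x y)"
  obtain a c where ac: "t = (a, c)" by (cases t)
  have tp: "(a, c) \<in> pairs" and sum: "0 \<le> a + c" using t by (auto simp: ac reps_def)
  \<comment> \<open>Both \<open>x\<close> and \<open>y\<close> invert every pair of
    \<open>dn t\<close> except possibly \<open>t\<close>; hence neither inverts \<open>t\<close>
    itself, or it would contain the generator.\<close>
  have below: "(p, q) \<in> inversions n z"
    if z: "z \<in> avoiders" "A (gen t) \<subseteq> insert t (A z)" and pq: "(p, q) \<in> dn t" "(p, q) \<noteq> (a, c)" for z p q
  proof -
    have p: "(p, q) \<in> pairs" using pq(1) dn_pairs by blast
    have "dn (p, q) \<subseteq> inversions n (gen t)" using dn_mono[OF pq(1)] by (auto simp: gen(2) cl_def sdn_def)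
    then have "rep (p, q) \<in> A (gen t)" using rep_A_iff[OF gen(1) p] by simp
    \<comment> \<open>As \<open>0 \<le> a + c\<close>, the mirror image \<open>(- c, - a)\<close> is
      nested in \<open>(a, c)\<close> only if the two coincide.\<close>
    moreover have "rep (p, q) \<noteq> t"
    proof
      assume "rep (p, q) = t"
      then have "p = - c" "q = - a" using rep_cases[of p q] pq(2) by (auto simp: ac)
      then have "a \<le> - c" "- a \<le> c" using pq(1) by (auto simp: ac dn_iff)
      then show False using \<open>p = - c\<close> \<open>q = - a\<close> sum pq(2) by auto
    qed
    ultimately have "rep (p, q) \<in> A z" using z(2) by blast
    then show ?thesis using A_sub_inversions[of z] rep_inversions[OF z(1)] by blast
  qed
  have notin: "(a, c) \<notin> inversions n z"
    if z: "z \<in> avoiders" "A (gen t) \<subseteq> insert t (A z)" "t \<notin> A z" for z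
  proof
    assume "(a, c) \<in> inversions n z"
    then have "dn t \<subseteq> inversions n z" using below[OF z(1,2)] by auto
    then show False using z(3) t by (simp add: A_def)
  qed
  define R where "R = inversions n x \<union> inversions n y"
  have RP: "R \<subseteq> pairs" using avoiders_pairs x y by (auto simp: R_def)
  have upper: "(a, e) \<in> dn t" if "up e" "(a, e) \<in> pairs" "\<beta> e < \<beta> c" for e
    using that less_of_block[of e c] by (simp add: ac dn_iff)
  have lower: "(e, c) \<in> dn t" if "\<not> up e" "(e, c) \<in> pairs" "\<beta> a < \<beta> e" for e
    using that less_of_block[of a e] by (simp add: ac dn_iff)
  have no_mid: "\<not> (a, e) \<in> inversions n z \<or> \<not> (e, c) \<in> inversions n z" if "z = x \<or> z = y" for z e
    using notin[OF x gx nx] notin[OF y gy ny] that transD[OF trans_inversions, of a e n z c] by blast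
  \<comment> \<open>Walk along a chain of inversions of \<open>x\<close> and \<open>y\<close> from \<open>a\<close> to \<open>c\<close>: an intermediate point that
    is not \<open>up\<close> would already give the inversion \<open>(a, c)\<close> of \<open>x\<close> or \<open>y\<close>.\<close>
  have all_up: "up e" if "(a, e) \<in> R\<^sup>+" "\<beta> e < \<beta> c" for e
    using that
  proof induction
    case (base e)
    show ?case
    proof (rule ccontr)
      assume ne: "\<not> up e"
      have p: "(a, e) \<in> pairs" using base RP by blast
      have "(e, c) \<in> pairs" using p tp base.prems by (simp add: pairs_iff)
      then have d: "(e, c) \<in> dn t" using lower[OF ne] p by (simp add: pairs_iff)
      have "(e, c) \<noteq> (a, c)" using p by (auto simp: pairs_iff)
      then have "(e, c) \<in> inversions n x" "(e, c) \<in> inversions n y"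
        using below[OF x gx d] below[OF y gy d] by auto
      then show False using base.hyps no_mid[of x e] no_mid[of y e] by (auto simp: R_def)
    qed
  next
    case (step e f)
    show ?case
    proof (rule ccontr)
      assume nf: "\<not> up f"
      have p: "(a, e) \<in> pairs" "(e, f) \<in> pairs" using trancl_pairs[OF RP] step.hyps RP by auto
      have "up e" using step.IH step.prems p(2) by (simp add: pairs_iff)
      then have d: "(a, e) \<in> dn t" using upper[OF _ p(1)] p(2) step.prems by (simp add: pairs_iff)
      have "(f, c) \<in> pairs" using p tp step.prems by (simp add: pairs_iff)
      then have d': "(f, c) \<in> dn t" using lower[OF nf] p by (simp add: pairs_iff)
      have ne: "(a, e) \<noteq> (a, c)" "(f, c) \<noteq> (a, c)" using p step.prems by (auto simp: pairs_iff)
      from step.hyps(2) obtain z where z: "z = x \<or> z = y" "(e, f) \<in> inversions n z" by (auto simp: R_def)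
      have "(a, e) \<in> inversions n z" "(f, c) \<in> inversions n z"
        using below[OF x gx] below[OF y gy] d d' ne z(1) by auto
      then have "(a, c) \<in> inversions n z" using z(2) transD[OF trans_inversions] by blast
      then show False using notin[OF x gx nx] notin[OF y gy ny] z(1) by blast
    qed
  qed
  have "dn t \<subseteq> R\<^sup>+" using tJ Join(2)[OF x y] by (simp add: A_def R_def)
  then have "(a, c) \<in> R\<^sup>+" using dn_self[of t] tp by (auto simp: ac)
  then show False
  proof cases
    case base
    then show ?thesis using notin[OF x gx nx] notin[OF y gy ny] by (auto simp: R_def)
  next
    case (step e)
    have p: "(a, e) \<in> pairs" "(e, c) \<in> pairs" using trancl_pairs[OF RP] step RP by auto
    have bc: "\<beta> e < \<beta> c" using p by (simp add: pairs_iff)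
    \<comment> \<open>The last intermediate point is \<open>up\<close>, so \<open>(a, e)\<close> is
      inverted by both \<open>x\<close> and \<open>y\<close> and composes with \<open>(e, c)\<close>
      inside the one inverting the latter.\<close>
    have d: "(a, e) \<in> dn t" using upper[OF all_up[OF step(1) bc] p(1) bc] .
    have "(a, e) \<noteq> (a, c)" using bc by auto
    then have "(a, e) \<in> inversions n x" "(a, e) \<in> inversions n y"
      using below[OF x gx d] below[OF y gy d] by auto
    then show ?thesis
      using step(2) no_mid[of x e] no_mid[of y e]
      by (auto simp: R_def)
  qed
qed

text \<open>Chains between positions inside \<open>v\<close> use only pairs nested in
  \<open>v\<close>. Excluding \<open>t\<close> does no harm: a nested pair represented by
  \<open>t\<close> would be at least as high as \<open>v\<close>, hence equal to \<open>v\<close>,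
  which is not \<open>t\<close>.\<close>

lemma Join_restriction:
  assumes st: "s \<in> reps" "t \<in> reps" "s \<noteq> t" and h: "snd s - fst s \<le> snd t - fst t"
    and x: "x \<in> avoiders" and y: "y \<in> avoiders" and z: "z \<in> avoiders"
  defines "S \<equiv> {u \<in> reps. snd u - fst u \<le> snd s - fst s \<and> u \<noteq> t}"
  assumes eq: "A x \<inter> S = A y \<inter> S"
  shows "A (Join x z) \<inter> S \<subseteq> A (Join y z)"
proof
  fix v assume v: "v \<in> A (Join x z) \<inter> S"
  obtain a c where ac: "v = (a, c)" by (cases v)
  have vr: "v \<in> reps" "c - a \<le> snd s - fst s" "v \<noteq> t" using v by (auto simp: S_def ac)
  define Y where "Y = (inversions n y \<union> inversions n z)\<^sup>+"
  have Y: "trans Y" by (simp add: Y_def)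
  have nested: "rep (p, q) \<in> S" if pq: "(p, q) \<in> pairs" "a \<le> p" "q \<le> c" for p q
  proof -
    have hh: "snd (rep (p, q)) - fst (rep (p, q)) = q - p" by (auto simp: rep_def)
    have "rep (p, q) \<noteq> t"
    proof
      assume r: "rep (p, q) = t"
      then have "snd t - fst t = q - p" using hh by simp
      then have "p = a" "q = c" using pq h vr(2) by auto
      then have "rep v = t" using r ac by simp
      then show False using rep_id[OF vr(1)] vr(3) by simp
    qed
    then show ?thesis using hh rep_reps[OF pq(1)] pq(2,3) vr(2) by (auto simp: S_def)
  qed
  have gen_step: "(p, q) \<in> Y" if pq: "(p, q) \<in> inversions n x \<union> inversions n z" "a \<le> p" "q \<le> c" for p q
  proof (cases "(p, q) \<in> inversions n x")
    case True
    then show ?thesis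
    proof (rule inversion_in_trans[OF x Y])
      fix d e assume de: "(d, e) \<in> pairs" "dn (d, e) \<subseteq> inversions n x" "p \<le> d" "e \<le> q"
      then have "rep (d, e) \<in> A x \<inter> S" using rep_A_iff[OF x de(1)] nested[OF de(1)] pq by simp
      then have "rep (d, e) \<in> A y" using eq by blast
      then have "(d, e) \<in> inversions n y" using A_sub_inversions[of y] rep_inversions[OF y] by blast
      then show "(d, e) \<in> Y" by (auto simp: Y_def)
    qed
  next
    case False
    then show ?thesis using pq by (auto simp: Y_def)
  qed
  define R where "R = inversions n x \<union> inversions n z"
  have RP: "R \<subseteq> pairs" using avoiders_pairs x z by (auto simp: R_def)
  have chain: "(p, q) \<in> Y" if "(p, q) \<in> R\<^sup>+" "a \<le> p" "q \<le> c" for p q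
    using that
  proof induction
    case (base q)
    then show ?case using gen_step[of p q] by (simp add: R_def)
  next
    case (step e q)
    have "p < e" "e < q" using pairs_less trancl_pairs[OF RP] RP step.hyps by blast+
    then have "(p, e) \<in> Y" "(e, q) \<in> Y"
      using step.IH step.prems step.hyps(2) gen_step[of e q] by (auto simp: R_def)
    then show ?case using transD[OF Y] by blast
  qed
  have vd: "dn v \<subseteq> R\<^sup>+" using v Join(2)[OF x z] by (simp add: A_def R_def)
  have "dn v \<subseteq> Y"
  proof (rule subrelI)
    fix p q assume pq: "(p, q) \<in> dn v"
    then have "(p, q) \<in> R\<^sup>+" "a \<le> p" "q \<le> c" using vd by (auto simp: ac dn_iff)
    then show "(p, q) \<in> Y" by (rule chain)
  qed
  then show "v \<in> A (Join y z)" using vr(1) Join(2)[OF y z] by (simp add: A_def Y_def)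
qed

lemma representation:
  assumes L: "L = \<lparr>carrier = avoiders, eq = (=), le = weak_le n\<rparr>"
  shows "trim_representation L reps A Join gen key"
proof
  show "eq L = (=)" "finite reps" by (simp_all add: L finite_reps)
  show "A x \<subseteq> reps" for x by (auto simp: A_def)
  show le: "le L x y \<longleftrightarrow> A x \<subseteq> A y" if "x \<in> carrier L" "y \<in> carrier L" for x y
    using that weak_le_iff[OF avoiders_hyperoct avoiders_hyperoct] A_sub_iff by (simp add: L)
  show "inj_on A (carrier L)"
  proof (rule inj_onI)
    fix x y assume "x \<in> carrier L" "y \<in> carrier L" and eq: "A x = A y"
    then have c: "x \<in> avoiders" "y \<in> avoiders" by (simp_all add: L)
    have "inversions n x = inversions n y"
      using A_sub_iff[OF c] A_sub_iff[OF c(2,1)] eq by blast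
    then show "x = y" by (rule inversions_inj[OF avoiders_hyperoct[OF c(1)] avoiders_hyperoct[OF c(2)]])
  qed
  show "Join x y \<in> carrier L" if "x \<in> carrier L" "y \<in> carrier L" for x y
    using that Join(1) by (simp add: L)
  show "A x \<union> A y \<subseteq> A (Join x y)" if "x \<in> carrier L" "y \<in> carrier L" for x y
  proof -
    have c: "x \<in> avoiders" "y \<in> avoiders" using that by (auto simp: L)
    have "inversions n x \<subseteq> inversions n (Join x y)" "inversions n y \<subseteq> inversions n (Join x y)"
      unfolding Join(2)[OF c] by auto
    then show ?thesis using A_sub_iff c Join(1)[OF c] by simp
  qed
  show "A (Join x y) \<subseteq> A z" if "x \<in> carrier L" "y \<in> carrier L" "z \<in> carrier L" "A x \<union> A y \<subseteq> A z" for x y z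
  proof -
    have c: "x \<in> avoiders" "y \<in> avoiders" "z \<in> avoiders" using that by (auto simp: L)
    have "inversions n x \<union> inversions n y \<subseteq> inversions n z" using that(4) A_sub_iff c by simp
    then have "(inversions n x \<union> inversions n y)\<^sup>+ \<subseteq> (inversions n z)\<^sup>+" by (rule trancl_mono_subset)
    then have "inversions n (Join x y) \<subseteq> inversions n z"
      using Join(2)[OF c(1,2)] trans_inversions[of n z] by simp
    then show ?thesis using A_sub_iff[OF Join(1)[OF c(1,2)] c(3)] by simp
  qed
  show "gen t \<in> carrier L" for t using gen(1) by (simp add: L)
  show "t \<in> A (gen t)" if "t \<in> reps" for t using that by (auto simp: A_def gen(2) cl_def sdn_def)
  show "A (gen t) \<subseteq> A x" if "x \<in> carrier L" "t \<in> A x" for x t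
    using that sub_cl[of x t] A_sub_iff[OF gen(1), of x t] by (simp add: L gen(2) A_def)
  show "inj_on key reps" by (rule key_inj)
  show "\<exists>x\<in>carrier L. A x = U"
    if "U \<subseteq> reps" "\<And>s t. s \<in> U \<Longrightarrow> t \<in> reps \<Longrightarrow> key t \<le> key s \<Longrightarrow> t \<in> U" for U
    using exists_initial_segment[OF that] by (simp add: L)
  show "t \<notin> A (Join x y)"
    if "t \<in> reps" "x \<in> carrier L" "y \<in> carrier L" "A (gen t) \<subseteq> insert t (A x)"
      "A (gen t) \<subseteq> insert t (A y)" "t \<notin> A x" "t \<notin> A y" for t x y
    using Join_avoids[of t x y] that by (simp add: L)
  show "\<exists>S. (s \<in> S) \<noteq> (t \<in> S) \<and> (\<forall>x\<in>carrier L. \<forall>y\<in>carrier L. \<forall>z\<in>carrier L.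
        A x \<inter> S = A y \<inter> S \<longrightarrow> A (Join x z) \<inter> S \<subseteq> A (Join y z))"
    if st: "s \<in> reps" "t \<in> reps" "s \<noteq> t" for s t
  proof (cases "snd s - fst s \<le> snd t - fst t")
    case True
    \<comment> \<open>The threshold is the smaller of the two heights; removing the other generator
      covers equal heights.\<close>
    let ?S = "{u \<in> reps. snd u - fst u \<le> snd s - fst s \<and> u \<noteq> t}"
    have ne: "(s \<in> ?S) \<noteq> (t \<in> ?S)" using st by simp
    have "\<forall>x\<in>carrier L. \<forall>y\<in>carrier L. \<forall>z\<in>carrier L.
        A x \<inter> ?S = A y \<inter> ?S \<longrightarrow> A (Join x z) \<inter> ?S \<subseteq> A (Join y z)"
      using Join_restriction[OF st True] by (simp add: L)
    with ne show ?thesis by (intro exI[of _ ?S] conjI)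
  next
    case False
    then have h: "snd t - fst t \<le> snd s - fst s" by simp
    let ?S = "{u \<in> reps. snd u - fst u \<le> snd t - fst t \<and> u \<noteq> s}"
    have ne: "(s \<in> ?S) \<noteq> (t \<in> ?S)" using st by simp
    have "\<forall>x\<in>carrier L. \<forall>y\<in>carrier L. \<forall>z\<in>carrier L.
        A x \<inter> ?S = A y \<inter> ?S \<longrightarrow> A (Join x z) \<inter> ?S \<subseteq> A (Join y z)"
      using Join_restriction[OF st(2,1) not_sym[OF st(3)] h] by (simp add: L)
    with ne show ?thesis by (intro exI[of _ ?S] conjI)
  qed
qed

end

section \<open>Type-B compositions\<close>

text \<open>Block boundaries lie between \<open>q\<close> and \<open>q + 1\<close>, and symmetrically, for each cut \<open>q\<close>.\<close>

definition cuts :: "nat list \<Rightarrow> nat set" where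
  "cuts \<alpha> = psum \<alpha> ` {1..<length (pos_parts \<alpha>)} \<union> (if split_comp \<alpha> then {0} else {})"

text \<open>In the split case \<open>0\<close> is a cut and the positive blocks are numbered from
  \<open>1\<close>; in the join case the central block gets \<open>0\<close>. The sign makes the
  numbering odd.\<close>

definition block_index :: "nat list \<Rightarrow> int \<Rightarrow> int" where
  "block_index \<alpha> a = sgn a * int (card {q \<in> cuts \<alpha>. int q < \<bar>a\<bar>})"

lemma finite_cuts: "finite (cuts \<alpha>)"
  by (simp add: cuts_def)

lemma block_index_uminus: "block_index \<alpha> (- a) = - block_index \<alpha> a"
  by (simp add: block_index_def sgn_minus)

lemma block_index_pos: "0 < a \<Longrightarrow> block_index \<alpha> a = int (card {q \<in> cuts \<alpha>. int q < a})"
  by (simp add: block_index_def)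

lemma block_index_nonneg: "0 < a \<Longrightarrow> 0 \<le> block_index \<alpha> a"
  by (simp add: block_index_pos)

lemma block_index_mono:
  assumes "a \<le> c"
  shows "block_index \<alpha> a \<le> block_index \<alpha> c"
proof -
  have pos: "block_index \<alpha> a \<le> block_index \<alpha> c" if "0 < a" "a \<le> c" for a c
  proof -
    have "card {q \<in> cuts \<alpha>. int q < a} \<le> card {q \<in> cuts \<alpha>. int q < c}"
      by (rule card_mono) (use that finite_cuts in auto)
    then show ?thesis using that by (simp add: block_index_pos)
  qed
  have zero: "block_index \<alpha> 0 = 0" by (simp add: block_index_def)
  have neg: "block_index \<alpha> a \<le> 0" if "a < 0" for a
    using block_index_nonneg[of "- a" \<alpha>] that by (simp add: block_index_uminus)
  consider "0 < a" | "c < 0" | "a \<le> 0" "0 \<le> c" by linarith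
  then show ?thesis
  proof cases
    case 1
    then show ?thesis using pos assms by blast
  next
    case 2
    then show ?thesis using pos[of "- c" "- a"] assms by (simp add: block_index_uminus)
  next
    case 3
    then show ?thesis using neg[of a] block_index_nonneg[of c \<alpha>] zero by (cases "a = 0"; cases "c = 0") auto
  qed
qed

lemma signed_blocks_block_index: "signed_blocks (block_index \<alpha>)"
  by unfold_locales (use block_index_uminus block_index_mono in auto)

lemma simple_gen_J_gens_iff: "simple_gen i \<in> J_gens \<alpha> \<longleftrightarrow> i \<in> cuts \<alpha>"
  using simple_gen_inj by (auto simp: J_gens_def cuts_def)

lemma block_index_low_iff:
  "block_index \<alpha> (low i) = block_index \<alpha> (int i + 1) \<longleftrightarrow> i \<notin> cuts \<alpha>"
proof (cases "i = 0")
  case True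
  have "{q \<in> cuts \<alpha>. int q < 1} = (if 0 \<in> cuts \<alpha> then {0} else {})" by auto
  then show ?thesis using True by (simp add: low_def block_index_uminus block_index_pos)
next
  case False
  have "{q \<in> cuts \<alpha>. int q < int i + 1} = {q \<in> cuts \<alpha>. int q < int i} \<union> (if i \<in> cuts \<alpha> then {i} else {})"
    by (cases "i \<in> cuts \<alpha>") (auto simp: le_less)
  moreover have "card ({q \<in> cuts \<alpha>. int q < int i} \<union> {i}) = Suc (card {q \<in> cuts \<alpha>. int q < int i})"
    using finite_cuts[of \<alpha>] by simp
  ultimately show ?thesis using False by (auto simp: low_def block_index_pos)
qed

lemma succ_pm_uminus: "v \<noteq> 0 \<Longrightarrow> succ_pm (- succ_pm v) = - v"
  by (simp add: succ_pm_def)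

text \<open>The Coxeter condition compares neighbouring positions only; inside a block these
  comparisons chain together, and oddness supplies them at negative positions.\<close>

lemma quotient_reps_eq: "quotient_reps n \<alpha> = signed_blocks.block_increasing n (block_index \<alpha>)"
proof -
  interpret signed_blocks n "block_index \<alpha>" by (rule signed_blocks_block_index)
  let ?\<beta> = "block_index \<alpha>"
  have *: "(\<forall>i<n. i \<notin> cuts \<alpha> \<longrightarrow> w (low i) < w (int i + 1)) \<longleftrightarrow>
      (\<forall>a\<in>pm n. \<forall>c\<in>pm n. a < c \<longrightarrow> ?\<beta> a = ?\<beta> c \<longrightarrow> w a < w c)" (is "?L \<longleftrightarrow> ?R")
    if w: "w \<in> hyperoct n" for w
  proof
    assume ?R
    then have R: "w a < w c" if "a \<in> pm n" "c \<in> pm n" "a < c" "?\<beta> a = ?\<beta> c" for a c using that by blast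
    show ?L
    proof (intro allI impI)
      fix i assume "i < n" "i \<notin> cuts \<alpha>"
      then show "w (low i) < w (int i + 1)"
        using R[OF low_pm(1) low_pm(2) low_pm(3)] block_index_low_iff by simp
    qed
  next
    assume L: ?L
    have step: "w a < w (succ_pm a)" if a: "a \<in> pm n" "succ_pm a \<in> pm n" "?\<beta> a = ?\<beta> (succ_pm a)" for a
    proof -
      have "a \<noteq> 0" using a(1) by (simp add: pm_iff)
      then consider "0 < a" | "a = - 1" | "a < - 1" by linarith
      then show ?thesis
      proof cases
        case 1
        then show ?thesis using L[rule_format, of "nat a"] a block_index_low_iff[of \<alpha> "nat a"]
          by (simp add: low_def succ_pm_def pm_iff)
      next
        case 2
        then show ?thesis using L[rule_format, of 0] a block_index_low_iff[of \<alpha> 0]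
          by (simp add: low_def succ_pm_def pm_iff)
      next
        case 3
        \<comment> \<open>This generator exchanges the mirrored neighbours \<open>- a - 1\<close>
          and \<open>- a\<close>.\<close>
        let ?i = "nat (- a - 1)"
        have i: "low ?i = - (a + 1)" "int ?i + 1 = - a" "?i < n" using 3 a(1) by (auto simp: low_def pm_iff)
        have "?\<beta> (low ?i) = ?\<beta> (int ?i + 1)"
          unfolding i block_index_uminus using a(3) 3 by (simp add: succ_pm_def)
        then have "w (low ?i) < w (int ?i + 1)" using L i(3) block_index_low_iff by blast
        then have "w (- (a + 1)) < w (- a)" unfolding i .
        then show ?thesis unfolding hyperoct_odd[OF w] using 3 by (simp add: succ_pm_def)
      qed
    qed
    have "w a < w c" if "a \<in> pm n" "c \<in> pm n" "a < c" "?\<beta> a = ?\<beta> c" for a c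
      using that
    proof (induction "nat (c - a)" arbitrary: a rule: less_induct)
      case less
      have c0: "c \<noteq> 0" using less.prems(2) by (simp add: pm_iff)
      have le: "succ_pm a \<le> c" using succ_pm_least[OF less.prems(3) c0] .
      have s: "succ_pm a \<in> pm n" using succ_pm_pm[OF less.prems(1-3)] .
      have gr: "a < succ_pm a" by (rule succ_pm_gr)
      have b: "?\<beta> a = ?\<beta> (succ_pm a)"
        using mono_block[of a "succ_pm a"] mono_block[OF le] gr less.prems(4) by simp
      show ?case
      proof (cases "succ_pm a = c")
        case True
        then show ?thesis using step[OF less.prems(1) s b] by simp
      next
        case False
        have "w (succ_pm a) < w c"
          by (rule less.hyps) (use False le gr s b less.prems in auto)
        then show ?thesis using step[OF less.prems(1) s b] by simp
      qed
    qed
    then show ?R by blast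
  qed
  show ?thesis
  proof (rule Set.set_eqI)
    fix w
    show "w \<in> quotient_reps n \<alpha> \<longleftrightarrow> w \<in> block_increasing"
      unfolding quotient_reps_iff simple_gen_J_gens_iff block_increasing_def mem_Collect_eq
      by (intro conj_cong refl *)
  qed
qed

section \<open>Blocks and patterns in terms of the block index\<close>

context
  fixes n :: nat and \<alpha> :: "nat list"
  assumes n_pos: "n \<ge> 1" and composition: "typeB_composition n \<alpha>"
begin

lemma parts_pos: "\<And>a. a \<in> set (pos_parts \<alpha>) \<Longrightarrow> 0 < a"
  and parts_sum: "sum_list (pos_parts \<alpha>) = n"
  and join_parts: "\<not> split_comp \<alpha> \<Longrightarrow> hd \<alpha> = psum \<alpha> 1"
proof -
  from composition obtain b where b: "\<alpha> = b \<or> \<alpha> = 0 # b" "\<forall>a\<in>set b. 0 < a" "sum_list b = n"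
    unfolding typeB_composition_def by blast
  \<comment> \<open>As \<open>n\<close> is positive, \<open>b\<close> starts with a positive part,
    so a leading \<open>0\<close> can only be the split marker.\<close>
  have bne: "b \<noteq> []" using b(3) n_pos by auto
  have hb: "hd b \<noteq> 0" using b(2) bne hd_in_set[of b] by auto
  have split: "split_comp \<alpha> \<longleftrightarrow> \<alpha> = 0 # b"
    using b(1) bne hb by (auto simp: split_comp_def)
  then have p: "pos_parts \<alpha> = b" using b(1) by (auto simp: pos_parts_def)
  show "\<And>a. a \<in> set (pos_parts \<alpha>) \<Longrightarrow> 0 < a" "sum_list (pos_parts \<alpha>) = n" using b p by auto
  assume "\<not> split_comp \<alpha>"
  then have "\<alpha> = b" using b(1) split by blast
  then show "hd \<alpha> = psum \<alpha> 1" using p bne by (cases b) (auto simp: psum_def)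
qed

lemma psum_0: "psum \<alpha> 0 = 0" by (simp add: psum_def)

lemma psum_length: "psum \<alpha> (length (pos_parts \<alpha>)) = n"
  by (simp add: psum_def parts_sum)

lemma psum_less: "i < j \<Longrightarrow> j \<le> length (pos_parts \<alpha>) \<Longrightarrow> psum \<alpha> i < psum \<alpha> j"
proof (induction j)
  case (Suc j)
  have "psum \<alpha> (Suc j) = psum \<alpha> j + pos_parts \<alpha> ! j"
    using Suc.prems by (simp add: psum_def take_Suc_conv_app_nth)
  moreover have "0 < pos_parts \<alpha> ! j" using parts_pos Suc.prems by simp
  ultimately show ?case using Suc by (cases "i = j") auto
qed simp

lemma psum_less_iff:
  "i \<le> length (pos_parts \<alpha>) \<Longrightarrow> j \<le> length (pos_parts \<alpha>) \<Longrightarrow> psum \<alpha> i < psum \<alpha> j \<longleftrightarrow> i < j"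
  using psum_less[of i j] psum_less[of j i] by (cases i j rule: linorder_cases) auto

definition index_shift :: nat where "index_shift = (if split_comp \<alpha> then 1 else 0)"

text \<open>The cuts below a position of the \<open>i\<close>-th block are the \<open>i - 1\<close>
  earlier nonzero partial sums, together with \<open>0\<close> in the split case.\<close>

lemma block_index_pos_block:
  assumes i: "i \<in> {1..length (pos_parts \<alpha>)}" and p: "p \<in> pos_block \<alpha> i"
  shows "block_index \<alpha> p = int (i - 1 + index_shift)" "p \<in> pm n" "0 < p"
proof -
  have p': "int (psum \<alpha> (i - 1)) < p" "p \<le> int (psum \<alpha> i)" using p by (auto simp: pos_block_def)
  show pos: "0 < p" using p' by simp
  have "psum \<alpha> i \<le> n" using i psum_less[of i "length (pos_parts \<alpha>)"] psum_length by (cases "i = length (pos_parts \<alpha>)") auto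
  then show "p \<in> pm n" using p' pos by (simp add: pm_iff)
  have less: "int (psum \<alpha> j) < p \<longleftrightarrow> j < i" if "j \<in> {1..<length (pos_parts \<alpha>)}" for j
  proof
    assume "int (psum \<alpha> j) < p"
    then have "psum \<alpha> j < psum \<alpha> i" using p' by linarith
    then show "j < i" using psum_less_iff[of j i] that i by simp
  next
    assume "j < i"
    then consider "j = i - 1" | "j < i - 1" by linarith
    then have "psum \<alpha> j \<le> psum \<alpha> (i - 1)"
    proof cases
      case 2
      then have "psum \<alpha> j < psum \<alpha> (i - 1)" using psum_less[OF 2] i by auto
      then show ?thesis by simp
    qed simp
    then show "int (psum \<alpha> j) < p" using p' by linarith
  qed
  have inj: "inj_on (psum \<alpha>) {1..<i}"
  proof (rule inj_onI)
    fix j k assume jk: "j \<in> {1..<i}" "k \<in> {1..<i}" "psum \<alpha> j = psum \<alpha> k"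
    have "j \<le> length (pos_parts \<alpha>)" "k \<le> length (pos_parts \<alpha>)" using jk i by auto
    then have "\<not> j < k" "\<not> k < j" using psum_less[of j k] psum_less[of k j] jk(3) by auto
    then show "j = k" by simp
  qed
  have eq: "{q \<in> cuts \<alpha>. int q < p} = psum \<alpha> ` {1..<i} \<union> (if split_comp \<alpha> then {0} else {})"
  proof (intro equalityI subsetI)
    fix q assume "q \<in> {q \<in> cuts \<alpha>. int q < p}"
    then consider j where "q = psum \<alpha> j" "j \<in> {1..<length (pos_parts \<alpha>)}" "int (psum \<alpha> j) < p"
      | "split_comp \<alpha>" "q = 0" by (auto simp: cuts_def split: if_splits)
    then show "q \<in> psum \<alpha> ` {1..<i} \<union> (if split_comp \<alpha> then {0} else {})"
    proof cases
      case 1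
      then show ?thesis using less[OF 1(2)] by auto
    qed simp
  next
    fix q assume "q \<in> psum \<alpha> ` {1..<i} \<union> (if split_comp \<alpha> then {0} else {})"
    then consider j where "q = psum \<alpha> j" "j \<in> {1..<i}" | "split_comp \<alpha>" "q = 0" by (auto split: if_splits)
    then show "q \<in> {q \<in> cuts \<alpha>. int q < p}"
    proof cases
      case 1
      then have "j \<in> {1..<length (pos_parts \<alpha>)}" using i by auto
      then show ?thesis using less[of j] 1 by (auto simp: cuts_def)
    next
      case 2
      then show ?thesis using pos by (simp add: cuts_def)
    qed
  qed
  have "0 \<notin> psum \<alpha> ` {1..<i}"
  proof
    assume "0 \<in> psum \<alpha> ` {1..<i}"
    then obtain j where "j \<in> {1..<i}" "psum \<alpha> j = 0" by auto
    then show False using psum_less[of 0 j] i psum_0 by simp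
  qed
  then have "card {q \<in> cuts \<alpha>. int q < p} = i - 1 + index_shift"
    unfolding eq index_shift_def using card_image[OF inj] by simp
  then show "block_index \<alpha> p = int (i - 1 + index_shift)" using pos by (simp add: block_index_pos)
qed

lemma exists_pos_block:
  assumes "p \<in> pm n" "0 < p"
  obtains i where "i \<in> {1..length (pos_parts \<alpha>)}" "p \<in> pos_block \<alpha> i"
proof -
  define i where "i = (LEAST i. p \<le> int (psum \<alpha> i))"
  have ex: "p \<le> int (psum \<alpha> (length (pos_parts \<alpha>)))" using assms psum_length by (simp add: pm_iff)
  have le: "p \<le> int (psum \<alpha> i)" unfolding i_def by (rule LeastI[of _ "length (pos_parts \<alpha>)"]) (rule ex)
  have il: "i \<le> length (pos_parts \<alpha>)" unfolding i_def by (rule Least_le) (rule ex)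
  have i0: "i \<noteq> 0" using le assms(2) psum_0 by (cases "i = 0") auto
  have "\<not> p \<le> int (psum \<alpha> (i - 1))" using not_less_Least[of "i - 1" "\<lambda>i. p \<le> int (psum \<alpha> i)"] i0 by (simp add: i_def)
  then show thesis using that[of i] le il i0 by (simp add: pos_block_def)
qed

lemma neg_block_iff: "x \<in> neg_block \<alpha> i \<longleftrightarrow> - x \<in> pos_block \<alpha> i"
  by (auto simp: neg_block_def pos_block_def)

lemma length_pos_parts: "1 \<le> length (pos_parts \<alpha>)"
  using parts_sum n_pos by (cases "pos_parts \<alpha>") auto

text \<open>Recovers a block from its index, which turns distinctness of blocks into distinctness of
  indices.\<close>

definition block_of :: "int \<Rightarrow> int set" where
  "block_of v = (if 0 < v then pos_block \<alpha> (nat v + 1 - index_shift) else if v < 0 then neg_block \<alpha> (nat (- v) + 1 - index_shift)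
     else pos_block \<alpha> 1 \<union> neg_block \<alpha> 1)"

lemma neg_block_props:
  assumes i: "i \<in> {1..length (pos_parts \<alpha>)}" and p: "p \<in> neg_block \<alpha> i"
  shows "block_index \<alpha> p = - int (i - 1 + index_shift)"
  using block_index_pos_block(1)[OF i, of "- p"] p by (simp add: neg_block_iff block_index_uminus)

lemma Part_block:
  assumes "B \<in> Part \<alpha>"
  shows "\<exists>v. B = block_of v \<and> (\<forall>x\<in>B. block_index \<alpha> x = v)"
proof -
  let ?r = "length (pos_parts \<alpha>)"
  \<comment> \<open>The lower bound \<open>2 - index_shift\<close> is \<open>1\<close> for split and
    \<open>2\<close> for join compositions.\<close>
  consider i where "i \<in> {2 - index_shift..?r}" "B = pos_block \<alpha> i" | i where "i \<in> {2 - index_shift..?r}" "B = neg_block \<alpha> i"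
    | "\<not> split_comp \<alpha>" "B = pos_block \<alpha> 1 \<union> neg_block \<alpha> 1"
    using assms by (auto simp: Part_def Let_def index_shift_def split: if_splits)
  then show ?thesis
  proof cases
    case 1
    then have i: "i \<in> {1..?r}" "0 < i - 1 + index_shift" "i - 1 + index_shift + 1 - index_shift = i" by (auto simp: index_shift_def split: if_splits)
    have "block_of (int m) = pos_block \<alpha> (m + 1 - index_shift)" if "0 < m" for m
      using that by (simp add: block_of_def)
    from this[OF i(2)] have "B = block_of (int (i - 1 + index_shift))" unfolding i(3) 1(2) by simp
    then show ?thesis using block_index_pos_block(1)[OF i(1)] 1(2) by blast
  next
    case 2
    then have i: "i \<in> {1..?r}" "0 < i - 1 + index_shift" "i - 1 + index_shift + 1 - index_shift = i" by (auto simp: index_shift_def split: if_splits)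
    have "block_of (- int m) = neg_block \<alpha> (m + 1 - index_shift)" if "0 < m" for m
      using that by (simp add: block_of_def)
    from this[OF i(2)] have "B = block_of (- int (i - 1 + index_shift))" unfolding i(3) 2(2) by simp
    then show ?thesis using neg_block_props[OF i(1)] 2(2) by blast
  next
    case 3
    then have s: "index_shift = 0" by (simp add: index_shift_def)
    have one: "1 \<in> {1..?r}" using length_pos_parts by simp
    have "B = block_of 0" using 3 by (simp add: block_of_def)
    moreover have "block_index \<alpha> x = 0" if "x \<in> B" for x
      using that 3(2) block_index_pos_block(1)[OF one, of x] neg_block_props[OF one, of x] s by auto
    ultimately show ?thesis by blast
  qed
qed

lemma Part_cover:
  assumes x: "x \<in> pm n"
  shows "\<exists>B\<in>Part \<alpha>. x \<in> B"
proof -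
  let ?r = "length (pos_parts \<alpha>)"
  have cover: "(\<exists>B\<in>Part \<alpha>. p \<in> B) \<and> (\<exists>B\<in>Part \<alpha>. - p \<in> B)" if p: "p \<in> pm n" "0 < p" for p
  proof -
    obtain i where i: "i \<in> {1..?r}" "p \<in> pos_block \<alpha> i" using exists_pos_block[OF p] .
    have ni: "- p \<in> neg_block \<alpha> i" using i(2) by (simp add: neg_block_iff)
    show ?thesis
    proof (cases "\<not> split_comp \<alpha> \<and> i = 1")
      case True
      then have "pos_block \<alpha> i \<union> neg_block \<alpha> i \<in> Part \<alpha>" by (simp add: Part_def Let_def)
      then show ?thesis using UnI1[OF i(2)] UnI2[OF ni] by (intro conjI bexI)
    next
      case False
      then have "i \<in> {2..?r} \<or> split_comp \<alpha>" using i(1) by auto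
      then have "pos_block \<alpha> i \<in> Part \<alpha>" "neg_block \<alpha> i \<in> Part \<alpha>"
        using i(1) by (auto simp: Part_def Let_def)
      then show ?thesis using i(2) ni by (intro conjI bexI)
    qed
  qed
  show ?thesis
  proof (cases "0 < x")
    case True
    then show ?thesis using cover[OF x] by simp
  next
    case False
    then have "0 < - x" "- x \<in> pm n" using x by (simp_all add: pm_iff)
    from cover[OF this(2,1)] show ?thesis by simp
  qed
qed

lemma in_distinct_blocks_iff:
  assumes pm: "i \<in> pm n" "j \<in> pm n" "k \<in> pm n"
  shows "in_distinct_blocks \<alpha> i j k \<longleftrightarrow> block_index \<alpha> i \<noteq> block_index \<alpha> j \<and>
    block_index \<alpha> i \<noteq> block_index \<alpha> k \<and> block_index \<alpha> j \<noteq> block_index \<alpha> k"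
proof -
  have eq: "X = Y \<longleftrightarrow> block_index \<alpha> x = block_index \<alpha> y"
    if "X \<in> Part \<alpha>" "Y \<in> Part \<alpha>" "x \<in> X" "y \<in> Y" for X Y x y
  proof -
    from Part_block[OF that(1)] obtain v where v: "X = block_of v" "\<forall>x\<in>X. block_index \<alpha> x = v" by blast
    from Part_block[OF that(2)] obtain w where w: "Y = block_of w" "\<forall>x\<in>Y. block_index \<alpha> x = w" by blast
    have xv: "block_index \<alpha> x = v" and yw: "block_index \<alpha> y = w" using v(2) w(2) that(3,4) by blast+
    show ?thesis
    proof
      assume "X = Y"
      then have "block_index \<alpha> y = v" using v(2) that(4) by blast
      then show "block_index \<alpha> x = block_index \<alpha> y" using xv by simp
    next
      assume "block_index \<alpha> x = block_index \<alpha> y"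
      then show "X = Y" using xv yw v(1) w(1) by simp
    qed
  qed
  from Part_cover[OF pm(1)] obtain X where X: "X \<in> Part \<alpha>" "i \<in> X" by blast
  from Part_cover[OF pm(2)] obtain Y where Y: "Y \<in> Part \<alpha>" "j \<in> Y" by blast
  from Part_cover[OF pm(3)] obtain Z where Z: "Z \<in> Part \<alpha>" "k \<in> Z" by blast
  show ?thesis
  proof
    assume "in_distinct_blocks \<alpha> i j k"
    then obtain X' Y' Z' where *: "X' \<in> Part \<alpha>" "Y' \<in> Part \<alpha>" "Z' \<in> Part \<alpha>" "i \<in> X'" "j \<in> Y'" "k \<in> Z'"
      "X' \<noteq> Y'" "X' \<noteq> Z'" "Y' \<noteq> Z'" unfolding in_distinct_blocks_def by blast
    show "block_index \<alpha> i \<noteq> block_index \<alpha> j \<and> block_index \<alpha> i \<noteq> block_index \<alpha> k \<and> block_index \<alpha> j \<noteq> block_index \<alpha> k"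
      using eq[OF *(1,2,4,5)] eq[OF *(1,3,4,6)] eq[OF *(2,3,5,6)] *(7-9) by simp
  next
    assume "block_index \<alpha> i \<noteq> block_index \<alpha> j \<and> block_index \<alpha> i \<noteq> block_index \<alpha> k \<and> block_index \<alpha> j \<noteq> block_index \<alpha> k"
    then have "X \<noteq> Y" "X \<noteq> Z" "Y \<noteq> Z"
      using eq[OF X(1) Y(1) X(2) Y(2)] eq[OF X(1) Z(1) X(2) Z(2)] eq[OF Y(1) Z(1) Y(2) Z(2)] by auto
    then show "in_distinct_blocks \<alpha> i j k" unfolding in_distinct_blocks_def using X Y Z by blast
  qed
qed

lemma beyond_first_block_iff:
  assumes "\<not> split_comp \<alpha>" "j \<in> pm n" "0 < j"
  shows "int (hd \<alpha>) < j \<longleftrightarrow> 0 < block_index \<alpha> j"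
proof -
  obtain i where i: "i \<in> {1..length (pos_parts \<alpha>)}" "j \<in> pos_block \<alpha> i" using exists_pos_block[OF assms(2,3)] .
  have b: "block_index \<alpha> j = int (i - 1)" using block_index_pos_block(1)[OF i] assms(1) by (simp add: index_shift_def)
  have j: "int (psum \<alpha> (i - 1)) < j" "j \<le> int (psum \<alpha> i)" using i(2) by (auto simp: pos_block_def)
  show ?thesis
  proof (cases "i = 1")
    case True
    then show ?thesis using j b join_parts[OF assms(1)] by simp
  next
    case False
    then have "i - 1 = 1 \<or> 1 < i - 1" using i(1) by auto
    then have "psum \<alpha> 1 \<le> psum \<alpha> (i - 1)"
    proof
      assume "1 < i - 1"
      moreover have "i - 1 \<le> length (pos_parts \<alpha>)" using i(1) by auto
      ultimately show ?thesis by (rule less_imp_le[OF psum_less])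
    qed simp
    then show ?thesis using j b join_parts[OF assms(1)] i(1) False by auto
  qed
qed

lemma split_block_index_pos:
  assumes "split_comp \<alpha>" "j \<in> pm n" "0 < j"
  shows "0 < block_index \<alpha> j"
proof -
  obtain i where i: "i \<in> {1..length (pos_parts \<alpha>)}" "j \<in> pos_block \<alpha> i" using exists_pos_block[OF assms(2,3)] .
  then show ?thesis using block_index_pos_block(1)[OF i] assms(1) by (simp add: index_shift_def)
qed

text \<open>Patterns restrict \<open>j\<close> to positive positions, avoiders do not. Negation
  reverses a triple, turning a \<open>231\<close> at \<open>j\<close> into a \<open>312\<close> at
  \<open>- j\<close>; this is the origin of the two conditions governed by
  \<open>up\<close>.\<close>

lemma avoiders_231_eq: "avoiders_231 n \<alpha> = signed_blocks.avoiders n (block_index \<alpha>)"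
proof -
  interpret signed_blocks n "block_index \<alpha>" by (rule signed_blocks_block_index)
  let ?\<beta> = "block_index \<alpha>"
  have "(if split_comp \<alpha> then \<not> (\<exists>i j k. split_pattern n \<alpha> \<pi> i j k) else \<not> (\<exists>i j k. join_pattern n \<alpha> \<pi> i j k))
    \<longleftrightarrow> (\<forall>i\<in>pm n. \<forall>j\<in>pm n. \<forall>k\<in>pm n. ?\<beta> i < ?\<beta> j \<longrightarrow> ?\<beta> j < ?\<beta> k \<longrightarrow> \<pi> i = succ_pm (\<pi> k) \<longrightarrow>
       (up j \<longrightarrow> \<pi> j < \<pi> i) \<and> (\<not> up j \<longrightarrow> \<pi> k < \<pi> j))" (is "?L \<longleftrightarrow> ?R")
    if "\<pi> \<in> block_increasing" for \<pi>
  proof -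
    have h: "\<pi> \<in> hyperoct n" using that by (simp add: block_increasing_def)
    define pat where "pat i j k \<longleftrightarrow> i \<in> pm n \<and> j \<in> pm n \<and> k \<in> pm n \<and> ?\<beta> i < ?\<beta> j \<and> ?\<beta> j < ?\<beta> k \<and>
      0 < j \<and> \<pi> i = succ_pm (\<pi> k) \<and> (up j \<and> \<pi> i < \<pi> j \<or> \<not> up j \<and> \<pi> j < \<pi> k)" for i j k
    have distinct: "i < j \<and> j < k \<and> in_distinct_blocks \<alpha> i j k \<longleftrightarrow> ?\<beta> i < ?\<beta> j \<and> ?\<beta> j < ?\<beta> k"
      if "i \<in> pm n" "j \<in> pm n" "k \<in> pm n" for i j k
      using in_distinct_blocks_iff[OF that] mono_block[of i j] mono_block[of j k] less_of_block[of i j] less_of_block[of j k]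
      by auto
    have "(if split_comp \<alpha> then split_pattern n \<alpha> \<pi> i j k else join_pattern n \<alpha> \<pi> i j k) \<longleftrightarrow> pat i j k" for i j k
    proof (cases "i \<in> pm n \<and> j \<in> pm n \<and> k \<in> pm n \<and> 0 < j")
      case True
      then have pm: "i \<in> pm n" "j \<in> pm n" "k \<in> pm n" and j: "0 < j" by auto
      show ?thesis
      proof (cases "split_comp \<alpha>")
        case s: True
        have "up j" using split_block_index_pos[OF s pm(2) j] by (simp add: up_def)
        then show ?thesis using s distinct[OF pm] pm j unfolding split_pattern_def pat_def by auto
      next
        case s: False
        have "up j \<longleftrightarrow> int (hd \<alpha>) < j" using beyond_first_block_iff[OF s pm(2) j] j by (simp add: up_def)
        then show ?thesis using s distinct[OF pm] pm j unfolding join_pattern_def pat_def by auto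
      qed
    next
      case False
      then show ?thesis by (auto simp: split_pattern_def join_pattern_def pat_def)
    qed
    then have L: "?L \<longleftrightarrow> \<not> (\<exists>i j k. pat i j k)" by (cases "split_comp \<alpha>") auto
    have "\<not> (\<exists>i j k. pat i j k) \<longleftrightarrow> ?R"
    proof
      assume np: "\<not> (\<exists>i j k. pat i j k)"
      have pos: "(up j \<longrightarrow> \<pi> j < \<pi> i) \<and> (\<not> up j \<longrightarrow> \<pi> k < \<pi> j)"
        if pm: "i \<in> pm n" "j \<in> pm n" "k \<in> pm n" and b: "?\<beta> i < ?\<beta> j" "?\<beta> j < ?\<beta> k"
          and d: "\<pi> i = succ_pm (\<pi> k)" and j: "0 < j" for i j k
      proof -
        have "\<pi> j \<noteq> \<pi> i" "\<pi> j \<noteq> \<pi> k" using hyperoct_eq_iff[OF h] b by auto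
        moreover have "\<not> pat i j k" using np by blast
        ultimately show ?thesis using pm b d j unfolding pat_def by auto
      qed
      show ?R
      proof (intro ballI impI)
        fix i j k assume pm: "i \<in> pm n" "j \<in> pm n" "k \<in> pm n" and b: "?\<beta> i < ?\<beta> j" "?\<beta> j < ?\<beta> k"
          and d: "\<pi> i = succ_pm (\<pi> k)"
        show "(up j \<longrightarrow> \<pi> j < \<pi> i) \<and> (\<not> up j \<longrightarrow> \<pi> k < \<pi> j)"
        proof (cases "0 < j")
          case True
          then show ?thesis using pos pm b d by blast
        next
          case False
          have j: "j \<noteq> 0" using pm(2) by (simp add: pm_iff)
          have "\<pi> k \<noteq> 0" using hyperoct_pm[OF h, of k] pm(3) by (auto simp: pm_iff)
          \<comment> \<open>Since \<open>succ_pm\<close> skips \<open>0\<close>, consecutive values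
            remain consecutive under negation, in the opposite order.\<close>
          then have "\<pi> (- k) = succ_pm (\<pi> (- i))" using succ_pm_uminus d by (simp add: hyperoct_odd[OF h])
          then have "(up (- j) \<longrightarrow> \<pi> (- j) < \<pi> (- k)) \<and> (\<not> up (- j) \<longrightarrow> \<pi> (- i) < \<pi> (- j))"
            by (intro pos) (use pm b j False in \<open>auto simp: odd_block\<close>)
          then show ?thesis using up_uminus[OF j] by (simp add: hyperoct_odd[OF h])
        qed
      qed
    next
      assume ?R
      then show "\<not> (\<exists>i j k. pat i j k)" unfolding pat_def by force
    qed
    with L show ?thesis by simp
  qed
  then show ?thesis
    unfolding avoiders_231_def avoiders_def quotient_reps_eq by (intro Collect_cong conj_cong refl)
qed

end

theorem theorem2:
  fixes n :: nat and \<alpha> :: "nat list"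
  assumes "n \<ge> 1" and "typeB_composition n \<alpha>"
  shows "finite_lattice (Tam_B n \<alpha>) \<and> congruence_uniform (Tam_B n \<alpha>) \<and>
    semidistributive (Tam_B n \<alpha>) \<and> trim (Tam_B n \<alpha>)"
proof -
  interpret signed_blocks n "block_index \<alpha>" by (rule signed_blocks_block_index)
  have "Tam_B n \<alpha> = \<lparr>carrier = avoiders, eq = (=), le = weak_le n\<rparr>"
    unfolding Tam_B_def avoiders_231_eq[OF assms] ..
  from representation[OF this]
  interpret trim_representation "Tam_B n \<alpha>" reps A Join gen key .
  show ?thesis
    using finite_lattice_L congruence_uniform_L semidistributive_L trim_L by blast
qed

end
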